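(* There is an absolute constant $c>0$ such that for every positive integer $n$, if $A\subseteq A_n$ is $100$-global and $\mu(A)\ge e^{-cn^{1/3}}$ then $A^3=A_n$.
   Context: $A_n$ is the alternating group on $[n]$, $\mu(A)=|A|/|A_n|$, and $A^3=\{abc:a,b,c\in A\}$. Globalness: let $[n]_t$ be the set of $t$-tuples of distinct elements of $[n]$. For $I,J\in[n]_t$ let $U_{I\to J}=\{\sigma\in S_n:\sigma(I_s)=J_s \text{ for all } s\}$. A set $A\subseteq S_n$ (in particular a subset of $A_n\subseteq S_n$) is $r$-global if its indicator function $1_A$ satisfies $\|(1_A)_{I\to J}\|_2\le r^t\|1_A\|_2$ for every $t$ and all $I,J\in[n]_t$, where $(1_A)_{I\to J}$ is the restriction to $U_{I\to J}$, and $\|\cdot\|_2$ is with respect to the uniform probability measure on $U_{I\to J}$, respectively on $S_n$. *)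

theory Defs
  imports Complex_Main "HOL-Library.Indicator_Function" "HOL-Algebra.Sym_Groups"
begin

text \<open>
  The symmetric and alternating groups on \<open>{1..n}\<close> are \<open>sym_group n\<close> and \<open>alt_group n\<close>: their
  elements are functions \<open>nat \<Rightarrow> nat\<close> fixing every point outside \<open>{1..n}\<close>, multiplied by
  composition.
\<close>

definition distinct_tuples :: "nat \<Rightarrow> nat \<Rightarrow> nat list set" where
  "distinct_tuples n t = {I. length I = t \<and> distinct I \<and> set I \<subseteq> {1..n}}"

definition umvirate :: "nat \<Rightarrow> nat list \<Rightarrow> nat list \<Rightarrow> (nat \<Rightarrow> nat) set" where
  "umvirate n I J = {\<sigma> \<in> carrier (sym_group n). \<forall>s < length I. \<sigma> (I ! s) = J ! s}"

text \<open>
  The $L^2$ norm on the finite set \<open>U\<close> with its uniform probability measure. Only the values of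
  \<open>f\<close> on \<open>U\<close> matter, so for a function \<open>f\<close> on a larger set this is the norm of its
  restriction to \<open>U\<close>.
\<close>

definition l2_norm :: "'a set \<Rightarrow> ('a \<Rightarrow> real) \<Rightarrow> real" where
  "l2_norm U f = sqrt ((\<Sum>x\<in>U. \<bar>f x\<bar>\<^sup>2) / real (card U))"

definition is_global :: "nat \<Rightarrow> real \<Rightarrow> (nat \<Rightarrow> nat) set \<Rightarrow> bool" where
  "is_global n r A \<longleftrightarrow>
     (\<forall>t. \<forall>I\<in>distinct_tuples n t. \<forall>J\<in>distinct_tuples n t.
        l2_norm (umvirate n I J) (indicator A)
          \<le> r ^ t * l2_norm (carrier (sym_group n)) (indicator A))"

definition alt_density :: "nat \<Rightarrow> (nat \<Rightarrow> nat) set \<Rightarrow> real" where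
  "alt_density n A = real (card A) / real (card (carrier (alt_group n)))"

end

theory Submission
  imports Defs "HOL-Analysis.Function_Topology" "HOL-Analysis.Convex"
begin

text \<open>
  Decompose $L^2(A_n)$ orthogonally by level: a function has level greater than $d$ if it sums to
  zero over every coset $\{\sigma : \sigma|_D = \rho|_D\}$ with $|D| = d$. Convolution preserves
  levels, so with $f = g = 1_A$ and $h(\sigma) = 1_A(\sigma^{-1}x)$ the form
  $\langle f * g, h\rangle$ is $\mu(A)^3$ plus one term per level, and it suffices to show that these
  terms are small.

  For levels up to $L \approx n^{1/3}$ one needs the level-$d$ inequality
  $\|f^{=d}\|^2 \le \mu(A)^2 (C L/d)^d$ for global $f$. Pair up the points and consider conditional
  expectations antisymmetrised in $d$ pairs. Swapping points within pairs introduces independent random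
  signs, so Bonami's hypercontractive inequality applies; the moments of the remaining square function
  are bounded by revealing the permutation step by step, where globalness and induction on $d$
  control the restrictions to the revealed pairs. The gain $n^{-d/2}$ in the convolution comes from a
  Hilbert-Schmidt bound.

  For higher levels, an extremal eigenspace of $w \mapsto \|f * w\|^2$ is invariant under right
  translation and contains $2^j$ orthogonal vectors with $j \approx L/4$, told apart by commuting Klein
  four-groups; this multiplicity beats the trivial bound $\|f * w\| \le \|f\| \|w\|$.
\<close>

section \<open>Cosets in the alternating group\<close>

text \<open>Irreducible representations are avoided. In their place: a right-invariant quadratic
  form attains its extreme ratio to the norm on a whole right-invariant subspace, so a constant for
  an entire level can be tested on a convenient vector of that subspace. On low levels this is a
  function of few values, taken at points in different pairs. On high levels many orthogonal vectors
  of the subspace share the extreme ratio, and their number divides the trivial bound.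

  The exponent 1/3 comes from the low levels. The square of the level d term is bounded by three
  level weights, one for each of f, g, h, of size mu^2 (C L/d)^d up to factors 2^d; against them
  stands a gain of (m choose d), at least (m/d)^d, because the convolution bound holds for every
  choice of d pairs. Beating (L/d)^(3d) asks that L^3 be a small multiple of n. From the other side
  L must be a large multiple of log (1/mu): the level inequality assumes mu at least e^(-L), and on
  the high levels a gain of about 2^(L/4) has to beat mu^(-3).\<close>

text \<open>
  The points \<open>2 * t + 1\<close> and \<open>2 * t + 2\<close> with \<open>t < m\<close> form a pair; the two largest points stay
  unpaired, so that transposing them can correct the parity.
\<close>

locale alt_pairs =
  fixes n m :: nat
  assumes nm: "2 * m + 2 \<le> n"
begin

definition G :: "(nat \<Rightarrow> nat) set" where
  "G = {p. p permutes {1..n} \<and> evenperm p}"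

text \<open>
  The part of an umvirate $U_{I \to J}$ lying in the alternating group, with \<open>D\<close> the set of entries
  of $I$ and \<open>\<rho>\<close> any even permutation with $\rho(I) = J$.
\<close>

definition agr :: "nat set \<Rightarrow> (nat \<Rightarrow> nat) \<Rightarrow> (nat \<Rightarrow> nat) set" where
  "agr D \<rho> = {\<sigma> \<in> G. \<forall>x\<in>D. \<sigma> x = \<rho> x}"

lemma G_permutes: "p \<in> G \<Longrightarrow> p permutes {1..n}"
  by (simp add: G_def)

lemma G_permutation: "p \<in> G \<Longrightarrow> permutation p"
  using G_permutes permutation_permutes by blast

lemma G_inj: "p \<in> G \<Longrightarrow> inj p"
  using G_permutes permutes_inj by blast

lemma G_bij: "p \<in> G \<Longrightarrow> bij p"
  using G_permutes permutes_bij by blast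

lemma G_in: "p \<in> G \<Longrightarrow> p x \<in> {1..n} \<longleftrightarrow> x \<in> {1..n}"
  using G_permutes permutes_in_image by metis

lemma G_id [simp]: "id \<in> G"
  by (simp add: G_def)

lemma G_comp [intro]: "a \<in> G \<Longrightarrow> b \<in> G \<Longrightarrow> a \<circ> b \<in> G"
  using evenperm_comp[of a b] G_permutation[of a] G_permutation[of b]
  by (auto simp: G_def intro: permutes_compose)

lemma G_inv [intro]: "a \<in> G \<Longrightarrow> inv' a \<in> G"
  using evenperm_inv[of a] G_permutation[of a]
  by (auto simp: G_def intro: permutes_inv)

lemma G_inv_o [simp]: "a \<in> G \<Longrightarrow> inv' a \<circ> a = id" "a \<in> G \<Longrightarrow> a \<circ> inv' a = id"
  using G_permutes permutes_inv_o by blast+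

lemma G_inv_o' [simp]:
  "a \<in> G \<Longrightarrow> inv' a \<circ> (a \<circ> x) = x" "a \<in> G \<Longrightarrow> a \<circ> (inv' a \<circ> x) = x"
  "a \<in> G \<Longrightarrow> x \<circ> inv' a \<circ> a = x" "a \<in> G \<Longrightarrow> x \<circ> a \<circ> inv' a = x"
  by (simp_all add: o_assoc[symmetric]) (simp_all add: o_assoc)

lemma G_inv_inv [simp]: "a \<in> G \<Longrightarrow> inv' (inv' a) = a"
  using G_permutes permutes_inv_inv by blast

lemma G_inv_comp: "a \<in> G \<Longrightarrow> b \<in> G \<Longrightarrow> inv' (a \<circ> b) = inv' b \<circ> inv' a"
  by (simp add: G_bij o_inv_distrib)

lemma G_inv_apply [simp]: "a \<in> G \<Longrightarrow> inv' a (a x) = x" "a \<in> G \<Longrightarrow> a (inv' a x) = x"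
  using G_inv_o by (metis comp_apply id_apply)+

lemma G_comp_iff: "b \<in> G \<Longrightarrow> \<sigma> \<circ> b \<in> G \<longleftrightarrow> \<sigma> \<in> G"
  by (metis G_comp G_inv G_inv_o'(4))

lemma finite_G [simp]: "finite G"
  unfolding G_def using finite_permutations[of "{1..n}"] by (auto intro: finite_subset)

lemma G_nonempty: "G \<noteq> {}"
  using G_id by blast

lemma card_G_pos: "0 < card G"
  using G_nonempty finite_G by (simp add: card_gt_0_iff)

lemma bij_R: "b \<in> G \<Longrightarrow> bij_betw (\<lambda>\<sigma>. \<sigma> \<circ> b) G G"
  by (rule bij_betwI[where g = "\<lambda>\<sigma>. \<sigma> \<circ> inv' b"]) auto

lemma bij_L: "b \<in> G \<Longrightarrow> bij_betw (\<lambda>\<sigma>. b \<circ> \<sigma>) G G"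
  by (rule bij_betwI[where g = "\<lambda>\<sigma>. inv' b \<circ> \<sigma>"]) auto

lemma bij_inv: "bij_betw inv' G G"
  by (rule bij_betwI[where g = inv']) auto

lemma sum_R: "b \<in> G \<Longrightarrow> (\<Sum>\<sigma>\<in>G. f (\<sigma> \<circ> b)) = (\<Sum>\<sigma>\<in>G. f \<sigma>)"
  using sum.reindex_bij_betw[OF bij_R] by auto

lemma sum_L: "b \<in> G \<Longrightarrow> (\<Sum>\<sigma>\<in>G. f (b \<circ> \<sigma>)) = (\<Sum>\<sigma>\<in>G. f \<sigma>)"
  using sum.reindex_bij_betw[OF bij_L] by auto

lemma sum_inv: "(\<Sum>\<sigma>\<in>G. f (inv' \<sigma>)) = (\<Sum>\<sigma>\<in>G. f \<sigma>)"
  using sum.reindex_bij_betw[OF bij_inv] by auto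

lemma agr_subset: "agr D \<rho> \<subseteq> G"
  by (auto simp: agr_def)

lemma finite_agr [simp]: "finite (agr D \<rho>)"
  using agr_subset finite_G finite_subset by blast

lemma agr_G: "\<sigma> \<in> agr D \<rho> \<Longrightarrow> \<sigma> \<in> G"
  by (simp add: agr_def)

lemma agr_refl: "\<rho> \<in> G \<Longrightarrow> \<rho> \<in> agr D \<rho>"
  by (simp add: agr_def)

lemma agr_cong: "(\<And>x. x \<in> D \<Longrightarrow> \<sigma> x = \<rho> x) \<Longrightarrow> agr D \<sigma> = agr D \<rho>"
  by (auto simp: agr_def)

lemma agr_eq: "\<sigma> \<in> agr D \<rho> \<Longrightarrow> agr D \<sigma> = agr D \<rho>"
  by (auto simp: agr_def)

lemma agr_empty [simp]: "agr {} \<rho> = G"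
  by (auto simp: agr_def)

lemma bij_agr_left:
  assumes "a \<in> G"
  shows "bij_betw (\<lambda>\<sigma>. a \<circ> \<sigma>) (agr D \<rho>) (agr D (a \<circ> \<rho>))"
  by (rule bij_betwI[where g = "\<lambda>\<sigma>. inv' a \<circ> \<sigma>"]) (use assms in \<open>auto simp: agr_def\<close>)

lemma bij_agr_right:
  assumes "b \<in> G"
  shows "bij_betw (\<lambda>\<sigma>. \<sigma> \<circ> b) (agr (b ` D) \<rho>) (agr D (\<rho> \<circ> b))"
  by (rule bij_betwI[where g = "\<lambda>\<sigma>. \<sigma> \<circ> inv' b"]) (use assms in \<open>auto simp: agr_def\<close>)

text \<open>At least two points lie outside \<open>D\<close>. Any bijective extension of
  \<open>g\<close> can be composed with their transposition, which corrects the parity and leaves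
  the values on \<open>D\<close> alone.\<close>

lemma extend_to_G:
  assumes D: "D \<subseteq> {1..n}" "card D + 2 \<le> n" and g: "inj_on g D" "g ` D \<subseteq> {1..n}"
  obtains \<rho> where "\<rho> \<in> G" "\<And>x. x \<in> D \<Longrightarrow> \<rho> x = g x"
proof -
  have finD: "finite D" using D finite_subset by blast
  have c: "card ({1..n} - D) = card ({1..n} - g ` D)"
    using D g finD by (simp add: card_Diff_subset card_image)
  obtain k where k: "bij_betw k ({1..n} - D) ({1..n} - g ` D)"
    using c finite_same_card_bij by (metis finite_Diff finite_atLeastAtMost)
  define p where "p x = (if x \<in> D then g x else if x \<in> {1..n} then k x else x)" for x
  have "bij_betw p ({1..n} - D) ({1..n} - g ` D)"
    using k by (rule bij_betw_cong[THEN iffD1, rotated]) (auto simp: p_def)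
  moreover have "bij_betw p D (g ` D)"
    using g by (auto simp: bij_betw_def p_def inj_on_def)
  ultimately have "bij_betw p (D \<union> ({1..n} - D)) (g ` D \<union> ({1..n} - g ` D))"
    by (intro bij_betw_combine) auto
  moreover have "D \<union> ({1..n} - D) = {1..n}" "g ` D \<union> ({1..n} - g ` D) = {1..n}"
    using D g by auto
  ultimately have "bij_betw p {1..n} {1..n}" by simp
  then have p: "p permutes {1..n}"
    by (rule bij_imp_permutes) (use D in \<open>auto simp: p_def\<close>)
  have "2 \<le> card ({1..n} - D)" using D finD by (simp add: card_Diff_subset)
  then obtain T where T: "T \<subseteq> {1..n} - D" "card T = 2"
    using obtain_subset_with_card_n by metis
  obtain x y where xy: "T = {x, y}" "x \<noteq> y" using T(2) card_2_iff by metis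
  define q where "q = (if evenperm p then p else p \<circ> transpose x y)"
  have pp: "permutation p" using p permutation_permutes by blast
  have t: "transpose x y permutes {1..n}" using xy T by (intro permutes_swap_id) auto
  have "q \<in> G"
    using p t xy evenperm_comp[OF pp permutation_swap_id[of x y]] evenperm_swap[of x y]
    by (auto simp: q_def G_def intro: permutes_compose)
  moreover have "q z = g z" if "z \<in> D" for z
  proof -
    have "z \<noteq> x" "z \<noteq> y" using xy T that by auto
    then show ?thesis using that by (simp add: q_def p_def transpose_def)
  qed
  ultimately show ?thesis using that by blast
qed

text \<open>The coset is a left translate of the even permutations of the complement of
  \<open>D\<close>. A transposition of two points of that complement matches even with odd
  permutations, hence the factor 2.\<close>

lemma card_agr:
  assumes D: "D \<subseteq> {1..n}" "card D + 2 \<le> n" and \<rho>: "\<rho> \<in> G"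
  shows "2 * card (agr D \<rho>) = fact (n - card D)"
proof -
  have finD: "finite D" using D finite_subset by blast
  have cD: "card ({1..n} - D) = n - card D" using D finD by (simp add: card_Diff_subset)
  define P where "P = {p. p permutes ({1..n} - D)}"
  have finP: "finite P" unfolding P_def by (simp add: finite_permutations)
  have cP: "card P = fact (n - card D)"
    unfolding P_def by (rule card_permutations) (use cD in auto)
  have "2 \<le> card ({1..n} - D)" using D finD by (simp add: card_Diff_subset)
  then obtain T where T: "T \<subseteq> {1..n} - D" "card T = 2"
    using obtain_subset_with_card_n by metis
  obtain x y where xy: "T = {x, y}" "x \<noteq> y" using T(2) card_2_iff by metis
  have perm: "permutation p" if "p \<in> P" for p
    using that permutation_permutes unfolding P_def by (metis finite_Diff finite_atLeastAtMost mem_Collect_eq)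
  have t: "transpose x y permutes {1..n} - D" using xy T by (intro permutes_swap_id) auto
  have even: "evenperm (p \<circ> transpose x y) \<longleftrightarrow> \<not> evenperm p" if "p \<in> P" for p
    using evenperm_comp[OF perm[OF that] permutation_swap_id[of x y]] evenperm_swap[of x y] xy by simp
  have inP: "p \<circ> transpose x y \<in> P" if "p \<in> P" for p
    using that t unfolding P_def by (auto intro: permutes_compose)
  have "bij_betw (\<lambda>p. p \<circ> transpose x y) {p \<in> P. evenperm p} {p \<in> P. \<not> evenperm p}"
    by (rule bij_betwI[where g = "\<lambda>p. p \<circ> transpose x y"])
      (auto simp: even inP fun_eq_iff)
  then have eq: "card {p \<in> P. evenperm p} = card {p \<in> P. \<not> evenperm p}"
    by (rule bij_betw_same_card)
  have "P = {p \<in> P. evenperm p} \<union> {p \<in> P. \<not> evenperm p}" by auto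
  then have "card P = card {p \<in> P. evenperm p} + card {p \<in> P. \<not> evenperm p}"
    by (metis (no_types, lifting) card_Un_disjoint disjoint_iff finP finite_Un mem_Collect_eq)
  then have c2: "2 * card {p \<in> P. evenperm p} = fact (n - card D)" using eq cP by simp
  have "{p \<in> P. evenperm p} = agr D id"
  proof (intro equalityI subsetI)
    fix p assume "p \<in> {p \<in> P. evenperm p}"
    then show "p \<in> agr D id" unfolding P_def agr_def G_def
      using permutes_subset[of p "{1..n} - D" "{1..n}"] permutes_not_in[of p "{1..n} - D"] by auto
  next
    fix p assume p: "p \<in> agr D id"
    then have "p permutes {1..n}" "\<And>x. x \<in> D \<Longrightarrow> p x = x" "evenperm p" by (auto simp: agr_def G_def)
    then have "p permutes {1..n} - D" using permutes_superset[of p "{1..n}" "{1..n} - D"] by auto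
    then show "p \<in> {p \<in> P. evenperm p}" using \<open>evenperm p\<close> by (simp add: P_def)
  qed
  moreover have "card (agr D id) = card (agr D \<rho>)"
    using bij_betw_same_card[OF bij_agr_left[OF \<rho>, of D id]] by simp
  ultimately show ?thesis using c2 by simp
qed


section \<open>Antisymmetrised conditional expectations\<close>

text \<open>The condition \<open>1 \<le> x\<close> matters: with truncated subtraction the point 0
  would otherwise belong to pair 0.\<close>

definition pr :: "nat set \<Rightarrow> nat set" where
  "pr T = {x. 1 \<le> x \<and> (x - 1) div 2 \<in> T}"

definition sw :: "nat set \<Rightarrow> nat \<Rightarrow> nat" where
  "sw S x = (if x \<in> pr S then (if odd x then x + 1 else x - 1)
             else if odd (card S) then transpose (n - 1) n x else x)"

lemma pr_alt: "pr T = (\<Union>t\<in>T. {2 * t + 1, 2 * t + 2})"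
proof (intro equalityI subsetI)
  fix x assume "x \<in> pr T"
  then have *: "1 \<le> x" "(x - 1) div 2 \<in> T" by (auto simp: pr_def)
  then have "x = 2 * ((x - 1) div 2) + 1 \<or> x = 2 * ((x - 1) div 2) + 2" by presburger
  then show "x \<in> (\<Union>t\<in>T. {2 * t + 1, 2 * t + 2})" using * by blast
qed (auto simp: pr_def)

lemma pr_Un: "pr (S \<union> T) = pr S \<union> pr T"
  by (auto simp: pr_def)

lemma pr_empty [simp]: "pr {} = {}"
  by (auto simp: pr_def)

lemma pr_mono: "S \<subseteq> T \<Longrightarrow> pr S \<subseteq> pr T"
  by (auto simp: pr_def)

lemma pr_disjoint: "S \<inter> T = {} \<Longrightarrow> pr S \<inter> pr T = {}"
  by (auto simp: pr_def)

lemma pr_bound: "T \<subseteq> {..<m} \<Longrightarrow> x \<in> pr T \<Longrightarrow> x < n - 1"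
  using nm by (auto simp: pr_alt)

lemma pr_subset: "T \<subseteq> {..<m} \<Longrightarrow> pr T \<subseteq> {1..n}"
  using nm by (auto simp: pr_alt)

lemma finite_pr [simp]: "T \<subseteq> {..<m} \<Longrightarrow> finite (pr T)"
  using pr_subset finite_subset by blast

lemma card_pr:
  assumes "finite T"
  shows "card (pr T) = 2 * card T"
  using assms
proof (induction T)
  case (insert t T)
  have "pr (insert t T) = {2 * t + 1, 2 * t + 2} \<union> pr T" by (auto simp: pr_alt)
  moreover have "{2 * t + 1, 2 * t + 2} \<inter> pr T = {}" using insert by (auto simp: pr_def)
  moreover have "finite (pr T)" using insert by (auto simp: pr_alt)
  ultimately show ?case using insert by (simp add: card_Un_disjoint)
qed simp

lemma card_pr_le: "T \<subseteq> {..<m} \<Longrightarrow> card (pr T) + 2 \<le> n"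
proof -
  assume T: "T \<subseteq> {..<m}"
  then have "card T \<le> m" using card_mono[of "{..<m}" T] by simp
  then show ?thesis using T nm card_pr[of T] finite_subset[OF T] by simp
qed

lemma flip_pr: "x \<in> pr S \<Longrightarrow> (if odd x then x + 1 else x - 1) \<in> pr S"
proof -
  assume "x \<in> pr S"
  then have x: "1 \<le> x" "(x - 1) div 2 \<in> S" by (auto simp: pr_def)
  have "(if odd x then x + 1 else x - 1) - 1 = (if odd x then x else x - 2)"
    "(if odd x then x else x - 2) div 2 = (x - 1) div 2" "1 \<le> (if odd x then x + 1 else x - 1)"
    using x(1) by (auto, presburger+)
  then show ?thesis using x(2) unfolding pr_def by simp
qed

lemma sw_in: "x \<in> pr S \<Longrightarrow> sw S x = (if odd x then x + 1 else x - 1)"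
  by (simp add: sw_def)

lemma sw_fix: "S \<subseteq> {..<m} \<Longrightarrow> T \<subseteq> {..<m} \<Longrightarrow> S \<inter> T = {} \<Longrightarrow> x \<in> pr T \<Longrightarrow> sw S x = x"
  using pr_disjoint[of S T] pr_bound[of T x] by (auto simp: sw_def transpose_def)

lemma sw_empty [simp]: "sw {} = id"
  by (auto simp: sw_def)

lemma sw_mem: "S \<subseteq> {..<m} \<Longrightarrow> T \<subseteq> {..<m} \<Longrightarrow> x \<in> pr T \<Longrightarrow> sw S x \<in> pr T"
proof -
  assume S: "S \<subseteq> {..<m}" and T: "T \<subseteq> {..<m}" and x: "x \<in> pr T"
  show ?thesis
  proof (cases "x \<in> pr S")
    case True
    then show ?thesis using flip_pr[OF x] by (simp add: sw_in)
  next
    case False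
    then show ?thesis using x pr_bound[OF T x] by (simp add: sw_def transpose_def)
  qed
qed

lemma sw_not_pr: "S \<subseteq> {..<m} \<Longrightarrow> T \<subseteq> {..<m} \<Longrightarrow> x \<notin> pr T \<Longrightarrow> sw S x \<notin> pr T"
proof
  assume S: "S \<subseteq> {..<m}" and T: "T \<subseteq> {..<m}" and x: "x \<notin> pr T" and y: "sw S x \<in> pr T"
  have "x \<in> pr T"
  proof (cases "x \<in> pr S")
    case True
    then have "sw S x \<in> pr T" "sw S x = (if odd x then x + 1 else x - 1)" using y by (auto simp: sw_in)
    moreover have "1 \<le> x" using True by (auto simp: pr_def)
    ultimately have "x = (if odd (sw S x) then sw S x + 1 else sw S x - 1)" by auto
    then show ?thesis using flip_pr[OF y] by simp
  next
    case False
    have "sw S x < n - 1" using pr_bound[OF T y] .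
    then have "sw S x = x" using False by (auto simp: sw_def transpose_def split: if_splits)
    then show ?thesis using y by simp
  qed
  then show False using x by simp
qed

lemma even_card_sym_diff:
  assumes "finite S" "finite T"
  shows "even (card (sym_diff S T)) \<longleftrightarrow> (even (card S) \<longleftrightarrow> even (card T))"
proof -
  have "card (sym_diff S T) = card (S - T) + card (T - S)"
    using assms by (intro card_Un_disjoint) auto
  moreover have "card S = card (S - T) + card (S \<inter> T)"
    using card_Diff_subset_Int[of S T] card_mono[of S "S \<inter> T"] assms by auto
  moreover have "card T = card (T - S) + card (S \<inter> T)"
    using card_Diff_subset_Int[of T S] card_mono[of T "S \<inter> T"] assms by (auto simp: Int_commute)
  ultimately show ?thesis by presburger
qed

text \<open>Parities add under symmetric difference, so the correction on the two largest points is
  consistent. The swaps thus form an elementary abelian 2-group, whose characters serve as the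
  independent signs.\<close>

lemma sw_sw:
  assumes S: "S \<subseteq> {..<m}" and T: "T \<subseteq> {..<m}"
  shows "sw S \<circ> sw T = sw (sym_diff S T)"
proof
  fix x
  have fin: "finite S" "finite T" using S T finite_subset by blast+
  have par: "even (card (sym_diff S T)) \<longleftrightarrow> (even (card S) \<longleftrightarrow> even (card T))"
    using even_card_sym_diff[OF fin] .
  have D: "sym_diff S T \<subseteq> {..<m}" using S T by auto
  show "(sw S \<circ> sw T) x = sw (sym_diff S T) x"
  proof (cases "x \<in> pr {..<m}")
    case True
    define f where "f y = (if odd y then y + 1 else y - 1 :: nat)" for y
    have y1: "1 \<le> x" using True by (auto simp: pr_def)
    have sw_eq: "sw U y = (if y \<in> pr U then f y else y)" if "U \<subseteq> {..<m}" "y \<in> pr {..<m}" for U y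
      using that pr_bound[of "{..<m}" y] by (auto simp: sw_def f_def transpose_def)
    have fx: "f x \<in> pr U \<longleftrightarrow> x \<in> pr U" for U
      using flip_pr[of x U] flip_pr[of "f x" U] y1 by (auto simp: f_def split: if_splits)
    have ff: "f (f x) = x" using y1 by (auto simp: f_def)
    have "f x \<in> pr {..<m}" using True fx by blast
    moreover have "x \<in> pr (sym_diff S T) \<longleftrightarrow> (x \<in> pr S) \<noteq> (x \<in> pr T)" by (auto simp: pr_def)
    ultimately show ?thesis using True S T D fx ff by (auto simp: sw_eq)
  next
    case False
    have sw_eq: "sw U y = (if odd (card U) then transpose (n - 1) n y else y)"
      if "U \<subseteq> {..<m}" "y \<notin> pr {..<m}" for U y
      using that pr_mono[OF that(1)] by (auto simp: sw_def)
    have "sw T x \<notin> pr {..<m}" using sw_not_pr[OF T _ False] by simp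
    then show ?thesis using False S T D by (simp add: sw_eq par)
  qed
qed

lemma sw_G: 
  assumes "S \<subseteq> {..<m}"
  shows "sw S \<in> G"
proof -
  have "finite S" using assms finite_subset by blast
  then show ?thesis using assms
  proof (induction S)
    case (insert t S)
    have t: "t < m" using insert by auto
    have ne: "2 * t + 1 \<noteq> n - 1" "2 * t + 1 \<noteq> n" "2 * t + 2 \<noteq> n - 1" "2 * t + 2 \<noteq> n" using t nm by auto
    have prt: "pr {t} = {2 * t + 1, 2 * t + 2}" by (auto simp: pr_alt)
    have "sw {t} = transpose (2 * t + 1) (2 * t + 2) \<circ> transpose (n - 1) n"
      using ne by (auto simp: sw_def prt transpose_def fun_eq_iff)
    also have "\<dots> \<in> G"
    proof -
      have "transpose (2 * t + 1) (2 * t + 2) permutes {1..n}" "transpose (n - 1) n permutes {1..n}"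
        using t nm by (auto intro!: permutes_swap_id)
      moreover have "evenperm (transpose (2 * t + 1) (2 * t + 2) \<circ> transpose (n - 1) n)"
        using nm by (simp add: evenperm_comp permutation_swap_id evenperm_swap)
      ultimately show ?thesis by (auto simp: G_def intro: permutes_compose)
    qed
    finally have "sw {t} \<in> G" .
    moreover have "sw S \<circ> sw {t} = sw (sym_diff S {t})" using insert by (intro sw_sw) auto
    moreover have "sym_diff S {t} = insert t S" using insert by auto
    ultimately show ?case using insert by (metis G_comp insert_subset)
  qed simp
qed

lemma sw_invol: "S \<subseteq> {..<m} \<Longrightarrow> sw S \<circ> sw S = id"
  using sw_sw[of S S] by simp

lemma sw_image: "S \<subseteq> {..<m} \<Longrightarrow> T \<subseteq> {..<m} \<Longrightarrow> sw S ` pr T = pr T"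
proof -
  assume S: "S \<subseteq> {..<m}" and T: "T \<subseteq> {..<m}"
  have "x \<in> sw S ` pr T" if "x \<in> pr T" for x
    using sw_invol[OF S] sw_mem[OF S T that] by (metis comp_apply id_apply image_eqI)
  then show ?thesis using sw_mem[OF S T] by auto
qed

text \<open>The parity correction acts outside all pairs, so on \<open>pr T\<close> only the swaps
  of pairs in \<open>T\<close> are visible, even if \<open>S\<close> and \<open>S \<inter> T\<close>
  differ in parity.\<close>

lemma sw_restrict:
  "S \<subseteq> {..<m} \<Longrightarrow> T \<subseteq> {..<m} \<Longrightarrow> x \<in> pr T \<Longrightarrow> sw S x = sw (S \<inter> T) x"
  using pr_bound[of T x] by (auto simp: sw_def pr_def transpose_def)


section \<open>Averages over cosets and their antisymmetrisation\<close>

definition av :: "nat set \<Rightarrow> (nat \<Rightarrow> nat) \<Rightarrow> ((nat \<Rightarrow> nat) \<Rightarrow> real) \<Rightarrow> real" where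
  "av D \<rho> f = (\<Sum>\<sigma>\<in>agr D \<rho>. f \<sigma>) / card (agr D \<rho>)"

text \<open>
  \<open>phi f T0 T\<close> is the conditional expectation of \<open>f\<close> given the values on the pairs in \<open>T0\<close> and \<open>T\<close>,
  antisymmetrised in each pair of \<open>T\<close>. The pairs in \<open>T0\<close> are those to which \<open>f\<close> has already been
  restricted.
\<close>

definition phi :: "((nat \<Rightarrow> nat) \<Rightarrow> real) \<Rightarrow> nat set \<Rightarrow> nat set \<Rightarrow> (nat \<Rightarrow> nat) \<Rightarrow> real" where
  "phi f T0 T \<sigma> = (\<Sum>S\<in>Pow T. (-1) ^ card S * av (pr (T0 \<union> T)) (\<sigma> \<circ> sw S) f) / 2 ^ card T"

lemma card_agr_eq: "\<rho> \<in> G \<Longrightarrow> \<rho>' \<in> G \<Longrightarrow> card (agr D \<rho>) = card (agr D \<rho>')"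
proof -
  have "card (agr D \<rho>) = card (agr D id)" if "\<rho> \<in> G" for \<rho>
    using bij_betw_same_card[OF bij_agr_left[OF that, of D id]] by simp
  then show "\<rho> \<in> G \<Longrightarrow> \<rho>' \<in> G \<Longrightarrow> card (agr D \<rho>) = card (agr D \<rho>')" by metis
qed

lemma card_agr_pos: "\<rho> \<in> G \<Longrightarrow> 0 < card (agr D \<rho>)"
  using agr_refl[of \<rho> D] finite_agr by (metis card_gt_0_iff empty_iff)

lemma av_cong: "(\<And>x. x \<in> D \<Longrightarrow> \<sigma> x = \<rho> x) \<Longrightarrow> av D \<sigma> f = av D \<rho> f"
  unfolding av_def using agr_cong[of D \<sigma> \<rho>] by simp

lemma av_fun_cong: "(\<And>\<sigma>. \<sigma> \<in> agr D \<rho> \<Longrightarrow> f \<sigma> = g \<sigma>) \<Longrightarrow> av D \<rho> f = av D \<rho> g"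
  unfolding av_def by simp

lemma av_cmult: "av D \<rho> (\<lambda>\<sigma>. c * f \<sigma>) = c * av D \<rho> f"
  unfolding av_def by (simp flip: sum_distrib_left)

lemma av_divide: "av D \<rho> (\<lambda>\<sigma>. f \<sigma> / c) = av D \<rho> f / c"
  unfolding av_def by (simp flip: sum_divide_distrib)

lemma av_sum: "av D \<rho> (\<lambda>\<sigma>. \<Sum>i\<in>I. f i \<sigma>) = (\<Sum>i\<in>I. av D \<rho> (f i))"
  unfolding av_def by (subst sum.swap) (simp add: sum_divide_distrib)

lemma av_nonneg: "(\<And>\<sigma>. \<sigma> \<in> agr D \<rho> \<Longrightarrow> 0 \<le> f \<sigma>) \<Longrightarrow> 0 \<le> av D \<rho> f"
  unfolding av_def by (simp add: sum_nonneg)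

lemma av_mono: "(\<And>\<sigma>. \<sigma> \<in> agr D \<rho> \<Longrightarrow> f \<sigma> \<le> g \<sigma>) \<Longrightarrow> av D \<rho> f \<le> av D \<rho> g"
  unfolding av_def by (simp add: sum_mono divide_right_mono)

lemma av_const: "\<rho> \<in> G \<Longrightarrow> (\<And>\<sigma>. \<sigma> \<in> agr D \<rho> \<Longrightarrow> f \<sigma> = c) \<Longrightarrow> av D \<rho> f = c"
  using card_agr_pos[of \<rho> D] unfolding av_def by auto

lemma sum_agr_tower:
  assumes "\<rho> \<in> G" "D \<subseteq> E"
  shows "(\<Sum>\<sigma>\<in>agr D \<rho>. \<Sum>\<tau>\<in>agr E \<sigma>. f \<tau>) = card (agr E id) * (\<Sum>\<tau>\<in>agr D \<rho>. f \<tau> :: real)"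
proof -
  have "(\<Sum>\<sigma>\<in>agr D \<rho>. \<Sum>\<tau>\<in>agr E \<sigma>. f \<tau>) =
      (\<Sum>\<sigma>\<in>agr D \<rho>. \<Sum>\<tau>\<in>{\<tau> \<in> agr D \<rho>. \<forall>x\<in>E. \<tau> x = \<sigma> x}. f \<tau>)"
    by (intro sum.cong refl) (use assms in \<open>auto simp: agr_def\<close>)
  also have "\<dots> = (\<Sum>\<tau>\<in>agr D \<rho>. \<Sum>\<sigma>\<in>{\<sigma> \<in> agr D \<rho>. \<forall>x\<in>E. \<tau> x = \<sigma> x}. f \<tau>)"
    by (rule sum.swap_restrict) auto
  also have "\<dots> = (\<Sum>\<tau>\<in>agr D \<rho>. \<Sum>\<sigma>\<in>agr E \<tau>. f \<tau>)"
    by (intro sum.cong refl) (use assms in \<open>auto simp: agr_def\<close>)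
  also have "\<dots> = (\<Sum>\<tau>\<in>agr D \<rho>. card (agr E id) * f \<tau>)"
    by (intro sum.cong refl) (simp, metis card_agr_eq G_id agr_G)
  finally show ?thesis by (simp add: sum_distrib_left)
qed

lemma av_tower:
  assumes "\<rho> \<in> G" "D \<subseteq> E"
  shows "av D \<rho> (\<lambda>\<sigma>. av E \<sigma> f) = av D \<rho> f"
proof -
  have "(\<Sum>\<sigma>\<in>agr D \<rho>. av E \<sigma> f) = (\<Sum>\<sigma>\<in>agr D \<rho>. (\<Sum>\<tau>\<in>agr E \<sigma>. f \<tau>) / card (agr E id))"
    unfolding av_def by (intro sum.cong refl) (metis card_agr_eq G_id agr_G)
  also have "\<dots> = (\<Sum>\<tau>\<in>agr D \<rho>. f \<tau>)"
    using sum_agr_tower[OF assms, of f] card_agr_pos[OF G_id, of E]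
    by (auto simp: card_gt_0_iff simp flip: sum_divide_distrib)
  finally show ?thesis by (simp add: av_def)
qed

lemma av_right:
  assumes "b \<in> G"
  shows "av (b ` D) \<rho> (\<lambda>\<sigma>. f (\<sigma> \<circ> b)) = av D (\<rho> \<circ> b) f"
  unfolding av_def
  using sum.reindex_bij_betw[OF bij_agr_right[OF assms], of f D \<rho>]
    bij_betw_same_card[OF bij_agr_right[OF assms], of D \<rho>] by simp

lemma av_sw:
  assumes "\<rho> \<in> G" "S \<subseteq> {..<m}" "T \<subseteq> {..<m}" "S \<inter> T = {}"
  shows "av (pr T) \<rho> (\<lambda>\<sigma>. f (\<sigma> \<circ> sw S)) = av (pr T) \<rho> f"
proof -
  have "av (pr T) \<rho> (\<lambda>\<sigma>. f (\<sigma> \<circ> sw S)) = av (sw S ` pr T) \<rho> (\<lambda>\<sigma>. f (\<sigma> \<circ> sw S))"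
    using assms sw_image by simp
  also have "\<dots> = av (pr T) (\<rho> \<circ> sw S) f" using assms sw_G by (intro av_right) auto
  also have "\<dots> = av (pr T) \<rho> f" by (rule av_cong) (use assms sw_fix in auto)
  finally show ?thesis .
qed

lemma phi_cong:
  assumes "T0 \<subseteq> {..<m}" "T \<subseteq> {..<m}" "\<And>x. x \<in> pr (T0 \<union> T) \<Longrightarrow> \<sigma> x = \<sigma>' x"
  shows "phi f T0 T \<sigma> = phi f T0 T \<sigma>'"
proof -
  have "av (pr (T0 \<union> T)) (\<sigma> \<circ> sw S) f = av (pr (T0 \<union> T)) (\<sigma>' \<circ> sw S) f" if "S \<subseteq> T" for S
    using sw_mem[of S "T0 \<union> T"] assms that by (intro av_cong) auto
  then show ?thesis unfolding phi_def by (auto intro!: sum.cong)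
qed

lemma minus_one_sym_diff:
  assumes "finite S" "finite T"
  shows "(-1 :: real) ^ card (sym_diff S T) = (-1) ^ card S * (-1) ^ card T"
  using even_card_sym_diff[OF assms] by (auto simp: minus_one_power_iff)

text \<open>Composing with \<open>sw S'\<close> permutes the summands by symmetric difference with
  \<open>S' \<inter> T\<close>; the parity of that set is the sign. Under random swaps
  \<open>phi f T0 T\<close> is therefore a multiple of the character of \<open>T\<close>, which
  makes the Bonami inequality applicable.\<close>

lemma phi_sw:
  assumes T0: "T0 \<subseteq> {..<m}" and T: "T \<subseteq> {..<m}" and S': "S' \<subseteq> {..<m}" "S' \<inter> T0 = {}" and \<sigma>: "\<sigma> \<in> G"
  shows "phi f T0 T (\<sigma> \<circ> sw S') = (-1) ^ card (S' \<inter> T) * phi f T0 T \<sigma>"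
proof -
  define A where "A = S' \<inter> T"
  have fin: "finite T" using T finite_subset by blast
  have finA: "finite A" using fin by (simp add: A_def)
  have "(\<Sum>S\<in>Pow T. (-1) ^ card S * av (pr (T0 \<union> T)) (\<sigma> \<circ> sw S' \<circ> sw S) f) =
      (\<Sum>S\<in>Pow T. (-1) ^ card A * ((-1) ^ card (sym_diff A S) * av (pr (T0 \<union> T)) (\<sigma> \<circ> sw (sym_diff A S)) f))"
  proof (intro sum.cong refl)
    fix S assume "S \<in> Pow T"
    then have S: "S \<subseteq> T" by simp
    have finS: "finite S" using S fin finite_subset by blast
    have "av (pr (T0 \<union> T)) (\<sigma> \<circ> sw S' \<circ> sw S) f = av (pr (T0 \<union> T)) (\<sigma> \<circ> sw (sym_diff A S)) f"
    proof (rule av_cong)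
      fix x assume x: "x \<in> pr (T0 \<union> T)"
      have "sw S' \<circ> sw S = sw (sym_diff S' S)" using S' S T by (intro sw_sw) auto
      moreover have "sw (sym_diff S' S) x = sw (sym_diff S' S \<inter> (T0 \<union> T)) x"
        using S' S T T0 x by (intro sw_restrict) auto
      moreover have "sym_diff S' S \<inter> (T0 \<union> T) = sym_diff A S" using S S' by (auto simp: A_def)
      ultimately show "(\<sigma> \<circ> sw S' \<circ> sw S) x = (\<sigma> \<circ> sw (sym_diff A S)) x" by (simp add: o_assoc[symmetric])
    qed
    then show "(-1) ^ card S * av (pr (T0 \<union> T)) (\<sigma> \<circ> sw S' \<circ> sw S) f =
      (-1) ^ card A * ((-1) ^ card (sym_diff A S) * av (pr (T0 \<union> T)) (\<sigma> \<circ> sw (sym_diff A S)) f)"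
      by (simp add: minus_one_sym_diff finS finA flip: power_mult_distrib mult.assoc)
  qed
  also have "\<dots> = (-1) ^ card A * (\<Sum>S\<in>Pow T. (-1) ^ card (sym_diff A S) * av (pr (T0 \<union> T)) (\<sigma> \<circ> sw (sym_diff A S)) f)"
    by (simp add: sum_distrib_left)
  also have "(\<Sum>S\<in>Pow T. (-1) ^ card (sym_diff A S) * av (pr (T0 \<union> T)) (\<sigma> \<circ> sw (sym_diff A S)) f) =
     (\<Sum>S\<in>Pow T. (-1) ^ card S * av (pr (T0 \<union> T)) (\<sigma> \<circ> sw S) f)"
    by (rule sum.reindex_bij_witness[where i = "\<lambda>S. sym_diff A S" and j = "\<lambda>S. sym_diff A S"])
      (auto simp: A_def)
  finally show ?thesis unfolding phi_def A_def by (simp only: times_divide_eq_right)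
qed

lemma sum_Pow_Un:
  assumes "S \<inter> T = {}" "finite S" "finite T"
  shows "(\<Sum>A\<in>Pow (S \<union> T). f A) = (\<Sum>A\<in>Pow S. \<Sum>B\<in>Pow T. (f (A \<union> B) :: real))"
  unfolding sum.cartesian_product
  by (rule sum.reindex_bij_witness[where j = "\<lambda>A. (A \<inter> S, A \<inter> T)" and i = "\<lambda>(A, B). A \<union> B"])
    (use assms in \<open>auto intro!: arg_cong[where f = f]\<close>)

text \<open>A subset of \<open>T \<union> T'\<close> is a subset of each part. Summing over the part
  in \<open>T'\<close> first leaves an antisymmetrisation in \<open>T'\<close> for functions already
  restricted on \<open>T\<close>; this is how a level is traded for a restriction.\<close>

lemma phi_split:
  assumes T0: "T0 \<subseteq> {..<m}" and T: "T \<subseteq> {..<m}" "T' \<subseteq> {..<m}" and dis: "T \<inter> T' = {}" "T0 \<inter> T = {}"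
  shows "phi f T0 (T \<union> T') \<sigma> = (\<Sum>S\<in>Pow T. (-1) ^ card S * phi f (T0 \<union> T) T' (\<sigma> \<circ> sw S)) / 2 ^ card T"
proof -
  have fin: "finite T" "finite T'" using T finite_subset by blast+
  have "(-1) ^ card (A \<union> B) * av (pr (T0 \<union> (T \<union> T'))) (\<sigma> \<circ> sw (A \<union> B)) f =
     (-1) ^ card A * ((-1) ^ card B * av (pr (T0 \<union> T \<union> T')) (\<sigma> \<circ> sw A \<circ> sw B) f)"
    if "A \<subseteq> T" "B \<subseteq> T'" for A B
  proof -
    have d: "A \<inter> B = {}" "finite A" "finite B" using that dis fin finite_subset by blast+
    have "sw A \<circ> sw B = sw (sym_diff A B)" using that T by (intro sw_sw) auto
    moreover have "sym_diff A B = A \<union> B" using d by auto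
    ultimately have "sw (A \<union> B) = sw A \<circ> sw B" by simp
    then show ?thesis using d by (simp add: card_Un_disjoint power_add Un_assoc o_assoc)
  qed
  then have "(\<Sum>S\<in>Pow (T \<union> T'). (-1) ^ card S * av (pr (T0 \<union> (T \<union> T'))) (\<sigma> \<circ> sw S) f) =
    (\<Sum>A\<in>Pow T. \<Sum>B\<in>Pow T'. (-1) ^ card A * ((-1) ^ card B * av (pr (T0 \<union> T \<union> T')) (\<sigma> \<circ> sw A \<circ> sw B) f))"
    by (simp add: sum_Pow_Un[OF dis(1) fin])
  then show ?thesis unfolding phi_def using dis fin
    by (simp add: card_Un_disjoint power_add sum_divide_distrib sum_distrib_left mult.commute[of "2 ^ card T'"])
qed

text \<open>On the coset, \<open>phi f T0 T\<close> is the orthogonal projection of \<open>f\<close>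
  onto the functions of the values on the pairs in \<open>T0\<close> and \<open>T\<close> that
  change sign under every swap in \<open>T\<close>.\<close>

lemma phi_inner:
  assumes T0: "T0 \<subseteq> {..<m}" and T: "T \<subseteq> {..<m}" and dis: "T0 \<inter> T = {}" and \<rho>: "\<rho> \<in> G"
  shows "av (pr T0) \<rho> (\<lambda>\<sigma>. f \<sigma> * phi f T0 T \<sigma>) = av (pr T0) \<rho> (\<lambda>\<sigma>. (phi f T0 T \<sigma>)\<^sup>2)"
proof -
  define g where "g = phi f T0 T"
  define D where "D = pr (T0 \<union> T)"
  have fin: "finite T" using T finite_subset by blast
  have D: "pr T0 \<subseteq> D" by (auto simp: D_def pr_def)
  have gc: "g \<sigma>' = g \<sigma>" if "\<sigma>' \<in> agr D \<sigma>" for \<sigma> \<sigma>'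
    unfolding g_def by (rule phi_cong[OF T0 T]) (use that in \<open>auto simp: agr_def D_def\<close>)
  have 1: "av (pr T0) \<rho> (\<lambda>\<sigma>. f \<sigma> * g \<sigma>) = av (pr T0) \<rho> (\<lambda>\<sigma>. g \<sigma> * av D \<sigma> f)"
  proof -
    have "av (pr T0) \<rho> (\<lambda>\<sigma>. f \<sigma> * g \<sigma>) = av (pr T0) \<rho> (\<lambda>\<sigma>. av D \<sigma> (\<lambda>\<sigma>. f \<sigma> * g \<sigma>))"
      using av_tower[OF \<rho> D] by simp
    also have "\<dots> = av (pr T0) \<rho> (\<lambda>\<sigma>. av D \<sigma> (\<lambda>\<sigma>'. g \<sigma> * f \<sigma>'))"
      by (intro av_fun_cong) (auto simp: gc)
    finally show ?thesis by (simp add: av_cmult)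
  qed
  \<comment> \<open>Substituting \<open>\<sigma> \<circ> sw S\<close> preserves the average over the
    coset while \<open>g\<close> changes by the sign of \<open>S\<close>. Averaging the outcome over
    all \<open>S\<close> rebuilds \<open>g\<close> from the conditional expectation of
    \<open>f\<close>.\<close>
  have 2: "av (pr T0) \<rho> (\<lambda>\<sigma>. g \<sigma> * av D \<sigma> f) =
      av (pr T0) \<rho> (\<lambda>\<sigma>. g \<sigma> * ((-1) ^ card S * av D (\<sigma> \<circ> sw S) f))" if "S \<subseteq> T" for S
  proof -
    have "av (pr T0) \<rho> (\<lambda>\<sigma>. g \<sigma> * av D \<sigma> f) = av (pr T0) \<rho> (\<lambda>\<sigma>. g (\<sigma> \<circ> sw S) * av D (\<sigma> \<circ> sw S) f)"
      using av_sw[of \<rho> S T0 "\<lambda>\<sigma>. g \<sigma> * av D \<sigma> f"] that T T0 \<rho> dis by (auto simp: Int_commute disjoint_iff subset_iff)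
    also have "\<dots> = av (pr T0) \<rho> (\<lambda>\<sigma>. g \<sigma> * ((-1) ^ card S * av D (\<sigma> \<circ> sw S) f))"
    proof (rule av_fun_cong)
      fix \<sigma> assume "\<sigma> \<in> agr (pr T0) \<rho>"
      then have "g (\<sigma> \<circ> sw S) = (-1) ^ card (S \<inter> T) * g \<sigma>"
        unfolding g_def using that T T0 dis agr_G by (intro phi_sw) auto
      moreover have "S \<inter> T = S" using that by auto
      ultimately show "g (\<sigma> \<circ> sw S) * av D (\<sigma> \<circ> sw S) f = g \<sigma> * ((-1) ^ card S * av D (\<sigma> \<circ> sw S) f)" by simp
    qed
    finally show ?thesis .
  qed
  have "2 ^ card T * av (pr T0) \<rho> (\<lambda>\<sigma>. g \<sigma> * av D \<sigma> f) = (\<Sum>S\<in>Pow T. av (pr T0) \<rho> (\<lambda>\<sigma>. g \<sigma> * av D \<sigma> f))"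
    by (simp add: card_Pow fin)
  also have "\<dots> = (\<Sum>S\<in>Pow T. av (pr T0) \<rho> (\<lambda>\<sigma>. g \<sigma> * ((-1) ^ card S * av D (\<sigma> \<circ> sw S) f)))"
    using 2 by (intro sum.cong) auto
  also have "\<dots> = av (pr T0) \<rho> (\<lambda>\<sigma>. 2 ^ card T * (g \<sigma>)\<^sup>2)"
    unfolding av_sum[symmetric]
  proof (intro av_fun_cong)
    fix \<sigma>
    have "(\<Sum>S\<in>Pow T. (-1) ^ card S * av D (\<sigma> \<circ> sw S) f) = 2 ^ card T * g \<sigma>"
      by (simp add: g_def phi_def D_def)
    then show "(\<Sum>S\<in>Pow T. g \<sigma> * ((-1) ^ card S * av D (\<sigma> \<circ> sw S) f)) = 2 ^ card T * (g \<sigma>)\<^sup>2"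
      by (simp add: power2_eq_square flip: sum_distrib_left)
  qed
  finally have "av (pr T0) \<rho> (\<lambda>\<sigma>. g \<sigma> * av D \<sigma> f) = av (pr T0) \<rho> (\<lambda>\<sigma>. (g \<sigma>)\<^sup>2)"
    by (simp add: av_cmult)
  then show ?thesis using 1 unfolding g_def by simp
qed

end

section \<open>The level inequality\<close>

text \<open>Jensen's inequality for the convex even power, with weights that need not sum to
  1.\<close>

lemma sum_power_le_power_sum:
  fixes w x :: "'a \<Rightarrow> real"
  assumes "finite I" "\<And>i. i \<in> I \<Longrightarrow> 0 \<le> w i" "even k" "0 < k"
  shows "(\<Sum>i\<in>I. w i * x i) ^ k \<le> (\<Sum>i\<in>I. w i) ^ (k - 1) * (\<Sum>i\<in>I. w i * x i ^ k)"
proof (cases "sum w I = 0")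
  case True
  then have "\<And>i. i \<in> I \<Longrightarrow> w i = 0"
    using sum_nonneg_eq_0_iff[OF assms(1), of w] assms(2) by blast
  then show ?thesis using assms by (simp add: power_0_left)
next
  case False
  define W where "W = sum w I"
  have W: "0 < W" using False sum_nonneg[of I w] assms(2) unfolding W_def by fastforce
  have k: "W ^ k = W * W ^ (k - 1)" using assms(4) by (cases k) simp_all
  have "(\<Sum>i\<in>I. (w i / W) *\<^sub>R x i) ^ k \<le> (\<Sum>i\<in>I. (w i / W) * x i ^ k)"
  proof (rule convex_on_sum[OF assms(1) _ convex_power_even[OF assms(3)]])
    show "I \<noteq> {}" using False by auto
    have "(\<Sum>i\<in>I. w i / W) = W / W" unfolding W_def by (rule sum_divide_distrib[symmetric])
    then show "(\<Sum>i\<in>I. w i / W) = 1" using W by simp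
  qed (use W assms in auto)
  moreover have "(\<Sum>i\<in>I. (w i / W) *\<^sub>R x i) = (\<Sum>i\<in>I. w i * x i) / W"
    unfolding sum_divide_distrib by simp
  moreover have "(\<Sum>i\<in>I. (w i / W) * x i ^ k) = (\<Sum>i\<in>I. w i * x i ^ k) / W"
    unfolding sum_divide_distrib by simp
  ultimately have "(\<Sum>i\<in>I. w i * x i) ^ k / W ^ k \<le> (\<Sum>i\<in>I. w i * x i ^ k) / W"
    by (simp add: power_divide)
  then have "(\<Sum>i\<in>I. w i * x i) ^ k \<le> (\<Sum>i\<in>I. w i * x i ^ k) / W * W ^ k"
    using W by (subst (asm) pos_divide_le_eq) auto
  also have "\<dots> = W ^ (k - 1) * (\<Sum>i\<in>I. w i * x i ^ k)"
  proof -
    have "X / W * (W * P) = P * X" for X P using W by simp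
    then show ?thesis unfolding k by blast
  qed
  finally show ?thesis by (simp add: W_def)
qed

text \<open>Minkowski's inequality for the r-th power norm, phrased through bounds to avoid roots.
  It is convexity at \<open>(a i + b i) / (A + B)\<close>, seen as the mean of
  \<open>a i / A\<close> and \<open>b i / B\<close> with weights proportional to \<open>A\<close>
  and \<open>B\<close>.\<close>

lemma sum_power_add_le:
  fixes a b :: "'a \<Rightarrow> real"
  assumes I: "finite I" and a: "\<And>i. i \<in> I \<Longrightarrow> 0 \<le> a i" and b: "\<And>i. i \<in> I \<Longrightarrow> 0 \<le> b i"
    and A: "0 \<le> A" "(\<Sum>i\<in>I. a i ^ r) \<le> N * A ^ r"
    and B: "0 \<le> B" "(\<Sum>i\<in>I. b i ^ r) \<le> N * B ^ r" and r: "0 < r"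
  shows "(\<Sum>i\<in>I. (a i + b i) ^ r) \<le> N * (A + B) ^ r"
proof -
  have z: "\<And>i. i \<in> I \<Longrightarrow> f i = 0" if "(\<Sum>i\<in>I. f i ^ r) \<le> 0" "\<And>i. i \<in> I \<Longrightarrow> 0 \<le> f i" for f :: "'a \<Rightarrow> real"
    using that I sum_nonneg_eq_0_iff[of I "\<lambda>i. f i ^ r"] sum_nonneg[of I "\<lambda>i. f i ^ r"] r by fastforce
  consider "A = 0" | "B = 0" | "0 < A" "0 < B" using A B by fastforce
  then show ?thesis
  proof cases
    case 1
    then have "\<And>i. i \<in> I \<Longrightarrow> a i = 0" using z[of a] A a r by (simp add: power_0_left)
    then show ?thesis using B 1 by simp
  next
    case 2
    then have "\<And>i. i \<in> I \<Longrightarrow> b i = 0" using z[of b] B b r by (simp add: power_0_left)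
    then show ?thesis using A 2 by simp
  next
    case 3
    define p q where "p = A / (A + B)" and "q = B / (A + B)"
    have pq: "0 \<le> p" "0 \<le> q" "p + q = 1" using 3 by (auto simp: p_def q_def simp flip: add_divide_distrib)
    have cvx: "convex_on {0..} (\<lambda>x::real. x ^ r)"
    proof (cases "even r")
      case True
      then show ?thesis using convex_power_even convex_on_subset by blast
    next
      case False
      then show ?thesis using convex_power_odd by blast
    qed
    have "(a i + b i) ^ r \<le> (A + B) ^ r * (p * (a i ^ r / A ^ r) + q * (b i ^ r / B ^ r))" if i: "i \<in> I" for i
    proof -
      have "(p *\<^sub>R (a i / A) + q *\<^sub>R (b i / B)) ^ r \<le> p * (a i / A) ^ r + q * (b i / B) ^ r"
      proof -
        have q1: "0 \<le> q" "q \<le> 1" and p: "p = 1 - q" using pq by auto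
        have ab: "a i / A \<in> {0..}" "b i / B \<in> {0..}" using 3 a[OF i] b[OF i] by auto
        show ?thesis unfolding p by (rule convex_onD[OF cvx q1 ab])
      qed
      moreover have "p *\<^sub>R (a i / A) + q *\<^sub>R (b i / B) = (a i + b i) / (A + B)"

      proof -
        have "p * (a i / A) = a i / (A + B)" "q * (b i / B) = b i / (A + B)"
          using 3 by (simp_all add: p_def q_def)
        then show ?thesis by (simp only: real_scaleR_def add_divide_distrib)
      qed
      ultimately have "((a i + b i) / (A + B)) ^ r \<le> p * (a i ^ r / A ^ r) + q * (b i ^ r / B ^ r)"
        by (simp add: power_divide)
      then show ?thesis using 3 by (simp add: power_divide divide_le_eq mult.commute)
    qed
    then have "(\<Sum>i\<in>I. (a i + b i) ^ r) \<le> (\<Sum>i\<in>I. (A + B) ^ r * (p * (a i ^ r / A ^ r) + q * (b i ^ r / B ^ r)))"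
      by (rule sum_mono)
    also have "\<dots> = (A + B) ^ r * (p * ((\<Sum>i\<in>I. a i ^ r) / A ^ r) + q * ((\<Sum>i\<in>I. b i ^ r) / B ^ r))"
      by (simp add: sum.distrib sum_distrib_left sum_divide_distrib distrib_left)
    also have "\<dots> \<le> (A + B) ^ r * (p * N + q * N)"
      using A B 3 pq by (intro mult_left_mono add_mono) (auto simp: divide_le_eq)
    also have "\<dots> = N * (A + B) ^ r" using pq by (simp flip: distrib_right)
    finally show ?thesis .
  qed
qed

section \<open>Hypercontractivity for random signs\<close>

lemma binomial_Suc_mult: "Suc k * (n choose Suc k) = (n - k) * (n choose k)"
  using Suc_times_binomial[of k "n - 1"] binomial_absorb_comp[of n k] by (cases n) auto

text \<open>From \<open>j\<close> to \<open>Suc j\<close> the left side grows by (r-j)(2r-2j-1) /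
  ((2j+1)(j+1)) and the right side by 2r(r-j) / (j+1), which is at least as large.\<close>

lemma binomial_even_le: "(2 * r) choose (2 * j) \<le> (r choose j) * (2 * r) ^ j"
proof (induction j)
  case (Suc j)
  define a b c where "a = (2 * r) choose (2 * j)" and "b = (2 * r) choose (2 * j + 1)"
    and "c = (2 * r) choose (2 * Suc j)"
  define x y where "x = r choose j" and "y = r choose Suc j"
  have c: "(2 * j + 2) * c = (2 * r - (2 * j + 1)) * b"
    using binomial_Suc_mult[of "2 * j + 1" "2 * r"] unfolding b_def c_def by simp
  have b: "(2 * j + 1) * b = (2 * r - 2 * j) * a"
    using binomial_Suc_mult[of "2 * j" "2 * r"] unfolding a_def b_def by simp
  have y: "Suc j * y = (r - j) * x"
    using binomial_Suc_mult[of j r] unfolding x_def y_def by simp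
  have a: "a \<le> x * (2 * r) ^ j" using Suc unfolding a_def x_def .
  have "((2 * j + 1) * (2 * j + 2)) * c = (2 * r - (2 * j + 1)) * ((2 * j + 1) * b)"
  proof -
    have "((2 * j + 1) * (2 * j + 2)) * c = (2 * j + 1) * ((2 * j + 2) * c)" by (rule mult.assoc)
    then show ?thesis unfolding c by (simp only: mult_ac)
  qed
  also have "\<dots> = (2 * r - (2 * j + 1)) * ((2 * r - 2 * j) * a)" unfolding b ..
  also have "\<dots> \<le> ((2 * j + 1) * (2 * r)) * ((2 * r - 2 * j) * (x * (2 * r) ^ j))"
    using a by (intro mult_mono) auto
  also have "\<dots> = ((2 * j + 1) * (2 * r)) * (2 * ((r - j) * x) * (2 * r) ^ j)"
  proof -
    have "2 * r - 2 * j = 2 * (r - j)" by simp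
    then show ?thesis by (simp only: mult_ac)
  qed
  also have "\<dots> = ((2 * j + 1) * (2 * j + 2)) * (y * (2 * r) ^ Suc j)"
  proof -
    have "2 * j + 2 = 2 * Suc j" by simp
    then show ?thesis unfolding y[symmetric] power_Suc by (simp only: mult_ac)
  qed
  finally have "c \<le> y * (2 * r) ^ Suc j" by (rule mult_left_le_imp_le) simp
  then show ?case unfolding c_def y_def .
qed simp

text \<open>Odd powers of \<open>h\<close> cancel; each even term is dominated by the matching term
  in the binomial expansion of the right side. This is hypercontractivity for a single random
  sign.\<close>

lemma two_point_inequality:
  fixes g h :: real
  shows "(g + h) ^ (2 * r) + (g - h) ^ (2 * r) \<le> 2 * (g\<^sup>2 + real (2 * r) * h\<^sup>2) ^ r"
proof -
  define F where "F k = real ((2 * r) choose k) * h ^ k * g ^ (2 * r - k)" for k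
  have sp: "(\<Sum>k\<le>2 * r. F k * (1 + (-1) ^ k)) = (\<Sum>j\<le>r. 2 * F (2 * j))"
  proof -
    have "(\<Sum>k\<le>2 * r. F k * (1 + (-1) ^ k)) = (\<Sum>k\<in>(\<lambda>j. 2 * j) ` {..r}. F k * (1 + (-1) ^ k))"
    proof (rule sum.mono_neutral_right)
      show "\<forall>k\<in>{..2 * r} - (\<lambda>j. 2 * j) ` {..r}. F k * (1 + (-1) ^ k) = 0"
      proof
        fix k assume k: "k \<in> {..2 * r} - (\<lambda>j. 2 * j) ` {..r}"
        have "odd k"
        proof
          assume "even k"
          then obtain j where "k = 2 * j" by blast
          then show False using k by auto
        qed
        then show "F k * (1 + (-1) ^ k) = 0" by simp
      qed
    qed auto
    then show ?thesis by (simp add: sum.reindex inj_on_def mult.commute)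
  qed
  have "(g + h) ^ (2 * r) + (g - h) ^ (2 * r) = (\<Sum>k\<le>2 * r. F k * (1 + (-1) ^ k))"
  proof -
    have "(g + h) ^ (2 * r) = (\<Sum>k\<le>2 * r. F k)"
      using binomial_ring[of h g "2 * r"] by (simp add: F_def add.commute)
    moreover have "(g - h) ^ (2 * r) = (\<Sum>k\<le>2 * r. F k * (-1) ^ k)"
      using binomial_ring[of "- h" g "2 * r"]
      by (simp add: F_def power_minus[of h] mult_ac)
    ultimately show ?thesis by (simp add: distrib_left sum.distrib)
  qed
  also have "\<dots> = (\<Sum>j\<le>r. 2 * F (2 * j))" by (rule sp)
  also have "\<dots> \<le> (\<Sum>j\<le>r. 2 * (real (r choose j) * (real (2 * r) * h\<^sup>2) ^ j * (g\<^sup>2) ^ (r - j)))"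
  proof (intro sum_mono mult_left_mono)
    fix j assume "j \<in> {..r}"
    have "2 * r - 2 * j = 2 * (r - j)" by simp
    then have e: "h ^ (2 * j) * g ^ (2 * r - 2 * j) = (h\<^sup>2) ^ j * (g\<^sup>2) ^ (r - j)"
      by (simp add: power_mult)
    have "real ((2 * r) choose (2 * j)) \<le> real (r choose j) * real (2 * r) ^ j"
      using binomial_even_le[of r j] by (metis of_nat_le_iff of_nat_mult of_nat_power)
    then have "real ((2 * r) choose (2 * j)) * ((h\<^sup>2) ^ j * (g\<^sup>2) ^ (r - j)) \<le>
      real (r choose j) * real (2 * r) ^ j * ((h\<^sup>2) ^ j * (g\<^sup>2) ^ (r - j))"
      by (intro mult_right_mono) auto
    then show "F (2 * j) \<le> real (r choose j) * (real (2 * r) * h\<^sup>2) ^ j * (g\<^sup>2) ^ (r - j)"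
      unfolding F_def power_mult_distrib using e by (simp add: mult.assoc)
  qed simp
  also have "\<dots> = 2 * (g\<^sup>2 + real (2 * r) * h\<^sup>2) ^ r"
    using binomial_ring[of "real (2 * r) * h\<^sup>2" "g\<^sup>2" r] by (simp add: sum_distrib_left add.commute)
  finally show ?thesis .
qed

lemma sum_Pow_insert:
  assumes "x \<notin> V" "finite V"
  shows "(\<Sum>S\<in>Pow (insert x V). f S) = (\<Sum>S\<in>Pow V. f S + f (insert x S) :: real)"
proof -
  have "Pow V \<inter> insert x ` Pow V = {}" using assms by auto
  moreover have "inj_on (insert x) (Pow V)" using assms by (auto simp: inj_on_def)
  ultimately show ?thesis using assms by (simp add: Pow_insert sum.union_disjoint sum.reindex sum.distrib)
qed

text \<open>Splitting off one coordinate \<open>x\<close> turns the values into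
  \<open>g S + h S\<close> and \<open>g S - h S\<close>. The two-point inequality removes this sign
  pointwise, and Minkowski's inequality combines the induction hypotheses for \<open>g\<close> and
  \<open>h\<close>.\<close>

lemma bonami_lemma:
  fixes c :: "'a set \<Rightarrow> real"
  assumes "finite V" "0 < r"
  shows "(\<Sum>S\<in>Pow V. (\<Sum>T\<in>Pow V. (-1) ^ card (S \<inter> T) * c T) ^ (2 * r)) \<le>
    2 ^ card V * (\<Sum>T\<in>Pow V. real (2 * r) ^ card T * (c T)\<^sup>2) ^ r"
  using assms(1)
proof (induction V arbitrary: c)
  case empty
  show ?case by (simp add: power_mult)
next
  case (insert x V)
  define K where "K = real (2 * r)"
  define g h where "g S = (\<Sum>T\<in>Pow V. (-1) ^ card (S \<inter> T) * c T)"
    and "h S = (\<Sum>T\<in>Pow V. (-1) ^ card (S \<inter> T) * c (insert x T))" for S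
  define A B where "A = (\<Sum>T\<in>Pow V. K ^ card T * (c T)\<^sup>2)"
    and "B = (\<Sum>T\<in>Pow V. K ^ card T * (c (insert x T))\<^sup>2)"
  have K: "0 \<le> K" by (simp add: K_def)
  have f1: "(\<Sum>T\<in>Pow (insert x V). (-1) ^ card (S \<inter> T) * c T) = g S + h S" if "S \<in> Pow V" for S
  proof -
    have "S \<inter> insert x T = S \<inter> T" for T using that insert by auto
    then show ?thesis using insert by (simp add: sum_Pow_insert g_def h_def sum.distrib)
  qed
  have f2: "(\<Sum>T\<in>Pow (insert x V). (-1) ^ card (insert x S \<inter> T) * c T) = g S - h S" if S: "S \<in> Pow V" for S
  proof -
    have "(-1::real) ^ card (insert x S \<inter> T) = (-1) ^ card (S \<inter> T)"
      "(-1::real) ^ card (insert x S \<inter> insert x T) = - ((-1) ^ card (S \<inter> T))" if "T \<in> Pow V" for T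
    proof -
      have "insert x S \<inter> T = S \<inter> T" "insert x S \<inter> insert x T = insert x (S \<inter> T)" "x \<notin> S \<inter> T"
        "finite (S \<inter> T)"
        using that S insert finite_subset[of T V] by auto
      then show "(-1::real) ^ card (insert x S \<inter> T) = (-1) ^ card (S \<inter> T)"
        "(-1::real) ^ card (insert x S \<inter> insert x T) = - ((-1) ^ card (S \<inter> T))" by simp_all
    qed
    then show ?thesis using insert
      by (simp add: sum_Pow_insert g_def h_def sum.distrib sum_subtractf)
  qed
  have rhs: "(\<Sum>T\<in>Pow (insert x V). K ^ card T * (c T)\<^sup>2) = A + K * B"
  proof -
    have "K ^ card (insert x T) = K * K ^ card T" if "T \<in> Pow V" for T
    proof -
      have "x \<notin> T" "finite T" using that insert finite_subset by auto
      then show ?thesis by simp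
    qed
    then show ?thesis using insert
      by (simp add: sum_Pow_insert A_def B_def sum.distrib sum_distrib_left mult.assoc)
  qed
  have "(\<Sum>S\<in>Pow (insert x V). (\<Sum>T\<in>Pow (insert x V). (-1) ^ card (S \<inter> T) * c T) ^ (2 * r)) =
     (\<Sum>S\<in>Pow V. (g S + h S) ^ (2 * r) + (g S - h S) ^ (2 * r))"
    using insert by (subst sum_Pow_insert) (auto simp: f1 f2 intro!: sum.cong)
  also have "\<dots> \<le> (\<Sum>S\<in>Pow V. 2 * ((g S)\<^sup>2 + K * (h S)\<^sup>2) ^ r)"
    unfolding K_def by (intro sum_mono two_point_inequality)
  also have "\<dots> = 2 * (\<Sum>S\<in>Pow V. ((g S)\<^sup>2 + K * (h S)\<^sup>2) ^ r)"
    by (simp add: sum_distrib_left)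
  also have "(\<Sum>S\<in>Pow V. ((g S)\<^sup>2 + K * (h S)\<^sup>2) ^ r) \<le> 2 ^ card V * (A + K * B) ^ r"
  proof (rule sum_power_add_le)
    show "(\<Sum>S\<in>Pow V. ((g S)\<^sup>2) ^ r) \<le> 2 ^ card V * A ^ r"
      using insert.IH[of c] by (simp add: g_def A_def K_def power_mult)
    have "(\<Sum>S\<in>Pow V. ((h S)\<^sup>2) ^ r) \<le> 2 ^ card V * B ^ r"
      using insert.IH[of "\<lambda>T. c (insert x T)"] by (simp add: h_def B_def K_def power_mult)
    then have "K ^ r * (\<Sum>S\<in>Pow V. ((h S)\<^sup>2) ^ r) \<le> K ^ r * (2 ^ card V * B ^ r)"
      using K by (intro mult_left_mono) auto
    then show "(\<Sum>S\<in>Pow V. (K * (h S)\<^sup>2) ^ r) \<le> 2 ^ card V * (K * B) ^ r"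
      by (simp add: power_mult_distrib sum_distrib_left mult_ac)
  qed (use K insert assms in \<open>auto simp: A_def B_def intro!: sum_nonneg mult_nonneg_nonneg\<close>)
  finally have "(\<Sum>S\<in>Pow (insert x V). (\<Sum>T\<in>Pow (insert x V). (-1) ^ card (S \<inter> T) * c T) ^ (2 * r)) \<le>
     2 * (2 ^ card V * (A + K * B) ^ r)" by simp
  moreover have "(2 :: real) ^ card (insert x V) = 2 * 2 ^ card V" using insert by simp
  ultimately show ?case using rhs unfolding K_def by simp
qed

text \<open>A comparison of falling factorials: each of the \<open>f\<close> factors counted down
  from \<open>a\<close> is at most twice the corresponding one counted down from
  \<open>b\<close>.\<close>

lemma fact_ratio_le:
  assumes "f \<le> b" "f \<le> a" "a \<le> 2 * (b - f)"
  shows "fact a * fact (b - f) \<le> (2 ^ f * fact (a - f) * fact b :: nat)"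
  using assms
proof (induction f)
  case (Suc f)
  have IH: "fact a * fact (b - f) \<le> (2 ^ f * fact (a - f) * fact b :: nat)"
    using Suc by simp
  have b: "fact (b - f) = (b - f) * (fact (b - Suc f) :: nat)"
    using Suc by (metis Suc_diff_Suc Suc_le_eq fact_Suc of_nat_id)
  have a: "fact (a - f) = (a - f) * (fact (a - Suc f) :: nat)"
    using Suc by (metis Suc_diff_Suc Suc_le_eq fact_Suc of_nat_id)
  have "(b - f) * (fact a * fact (b - Suc f)) = fact a * (fact (b - f) :: nat)"
    unfolding b by (simp only: mult_ac)
  also have "\<dots> \<le> 2 ^ f * ((a - f) * fact (a - Suc f)) * fact b"
    using IH unfolding a .
  also have "\<dots> \<le> 2 ^ f * ((2 * (b - f)) * fact (a - Suc f)) * fact b"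
    using Suc by (intro mult_right_mono mult_left_mono) auto
  also have "\<dots> = (b - f) * (2 ^ Suc f * fact (a - Suc f) * fact b)"
    unfolding power_Suc by (simp only: mult_ac)
  finally show ?case by (rule mult_left_le_imp_le) (use Suc in simp)
qed simp

text \<open>The weak form of Stirling's formula, from (1 + 1/d)^d being at most e.\<close>

lemma power_self_le_exp_fact: "real d ^ d \<le> exp (real d) * fact d"
proof (induction d)
  case (Suc d)
  show ?case
  proof (cases "d = 0")
    case True
    then show ?thesis using exp_ge_add_one_self[of "1::real"] by simp
  next
    case False
    have "real (Suc d) ^ d = real d ^ d * (1 + 1 / real d) ^ d"
      using False by (simp add: field_simps flip: power_mult_distrib)
    also have "\<dots> \<le> real d ^ d * exp 1"
      using exp_ge_one_plus_x_over_n_power_n[of d 1] False by (intro mult_left_mono) auto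
    also have "\<dots> \<le> exp (real d) * fact d * exp 1"
      using Suc by (intro mult_right_mono) auto
    also have "\<dots> = exp (real (Suc d)) * fact d" by (simp add: exp_add mult_ac)
    finally have "real (Suc d) * real (Suc d) ^ d \<le> real (Suc d) * (exp (real (Suc d)) * fact d)"
      by (intro mult_left_mono) auto
    then show ?thesis by (simp add: mult_ac)
  qed
qed simp

text \<open>The terms that the induction hypothesis contributes to the moment bound. Bounding the
  binomial by (2L)^k / k! and (d-k)^(d-k) from below by (d-k)!, and absorbing
  \<open>2 * Q\<^sup>2\<close> into \<open>C\<close>, makes each term at most (d choose k) (C L)^d /
  d!. The sum gives 2^d, and replacing d! by (d/3)^d gives 3^d.\<close>

lemma binomial_level_sum:
  fixes C Q :: real and L d :: nat
  assumes d: "1 \<le> d" and C: "2 * Q\<^sup>2 \<le> C" "0 < C"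
  shows "(\<Sum>k\<in>{1..d}. real ((2 * L) choose k) * ((Q ^ k)\<^sup>2 * (C * L / real (d - k)) ^ (d - k)))
     \<le> 6 ^ d * (C * L / d) ^ d"
proof -
  have e: "real d ^ d \<le> 3 ^ d * fact d"
  proof -
    have "exp (real d) = exp 1 ^ d" using exp_of_nat_mult[of d "1::real"] by simp
    also have "\<dots> \<le> 3 ^ d" using exp_le by (intro power_mono) auto
    finally have "exp (real d) * fact d \<le> 3 ^ d * (fact d :: real)" by (intro mult_right_mono) auto
    then show ?thesis using power_self_le_exp_fact[of d] by linarith
  qed
  have "real ((2 * L) choose k) * ((Q ^ k)\<^sup>2 * (C * L / real (d - k)) ^ (d - k)) \<le>
     real (d choose k) * (3 ^ d * (C * L / d) ^ d)" if k: "k \<in> {1..d}" for k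
  proof -
    have 1: "real ((2 * L) choose k) \<le> (2 * real L) ^ k / fact k"
    proof -
      have "real (((2 * L) choose k) * fact k) \<le> real ((2 * L) ^ k)"
        using binomial_fact_pow[of "2 * L" k] by (rule of_nat_mono)
      then show ?thesis by (simp add: pos_le_divide_eq)
    qed
    have 2: "(C * L / real (d - k)) ^ (d - k) \<le> (C * L) ^ (d - k) / fact (d - k)"
    proof (cases "d = k")
      case False
      have "fact (d - k) \<le> real (d - k) ^ (d - k)" using fact_le_power[of "d - k"] by simp
      then show ?thesis unfolding power_divide using C False k
        by (intro divide_left_mono) (auto intro!: mult_pos_pos)
    qed simp
    have 3: "(2 * Q\<^sup>2) ^ k \<le> C ^ k" using C by (intro power_mono) auto
    have "real ((2 * L) choose k) * ((Q ^ k)\<^sup>2 * (C * L / real (d - k)) ^ (d - k)) \<le>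
      ((2 * real L) ^ k / fact k) * ((Q ^ k)\<^sup>2 * ((C * L) ^ (d - k) / fact (d - k)))"
      using 1 2 C by (intro mult_mono) auto
    also have "\<dots> = ((2 * Q\<^sup>2) ^ k * real L ^ k * (C * L) ^ (d - k)) / (fact k * fact (d - k))"
      by (simp add: power_mult_distrib power2_eq_square mult_ac)
    also have "\<dots> \<le> (C ^ k * real L ^ k * (C * L) ^ (d - k)) / (fact k * fact (d - k))"
      using 3 C by (intro divide_right_mono mult_right_mono) auto
    also have "C ^ k * real L ^ k * (C * L) ^ (d - k) = (C * L) ^ d"
      using k by (simp flip: power_mult_distrib power_add)
    also have "(C * L) ^ d / (fact k * fact (d - k)) = real (d choose k) * ((C * L) ^ d / fact d)"
      using k by (simp add: binomial_fact)
    also have "\<dots> \<le> real (d choose k) * (3 ^ d * (C * L / d) ^ d)"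
    proof (intro mult_left_mono)
      have "(C * L) ^ d * real d ^ d \<le> (C * L) ^ d * (3 ^ d * fact d)"
        using e C by (intro mult_left_mono) auto
      then show "(C * L) ^ d / fact d \<le> 3 ^ d * (C * L / d) ^ d"
        using d by (simp add: power_divide divide_simps mult_ac)
    qed simp
    finally show ?thesis .
  qed
  then have "(\<Sum>k\<in>{1..d}. real ((2 * L) choose k) * ((Q ^ k)\<^sup>2 * (C * L / real (d - k)) ^ (d - k)))
     \<le> (\<Sum>k\<in>{1..d}. real (d choose k) * (3 ^ d * (C * L / d) ^ d))" by (rule sum_mono)
  also have "\<dots> \<le> (\<Sum>k\<le>d. real (d choose k) * (3 ^ d * (C * L / d) ^ d))"
    using C by (intro sum_mono2) auto
  also have "\<dots> = 2 ^ d * (3 ^ d * (C * L / d) ^ d)"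
  proof -
    have "(\<Sum>k\<le>d. real (d choose k)) = 2 ^ d"
      using arg_cong[OF choose_row_sum[of d], of real] by simp
    then show ?thesis by (simp flip: sum_distrib_right)
  qed
  also have "\<dots> = 6 ^ d * (C * L / d) ^ d" by (simp flip: mult.assoc power_mult_distrib)
  finally show ?thesis .
qed

section \<open>Level weights of restrictions and their moments\<close>

context alt_pairs begin

text \<open>Conditioning on \<open>E\<close> instead of \<open>D\<close> matters for the values on
  \<open>F\<close> only by excluding more images. At most half of all points are involved, so each
  of the values on \<open>F\<close> becomes at most twice as likely.\<close>

lemma av_compare:
  assumes D: "D \<subseteq> E" "E \<inter> F = {}" "E \<union> F \<subseteq> {1..n}" "2 * card (E \<union> F) \<le> n" "card (E \<union> F) + 2 \<le> n"
    and g: "\<And>\<sigma>. \<sigma> \<in> G \<Longrightarrow> 0 \<le> g \<sigma>"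
      "\<And>\<sigma> \<tau>. \<sigma> \<in> G \<Longrightarrow> \<tau> \<in> agr (D \<union> F) \<sigma> \<Longrightarrow> g \<tau> = g \<sigma>"
    and \<rho>: "\<rho> \<in> G"
  shows "av E \<rho> g \<le> 2 ^ card F * av D \<rho> g"
proof -
  define c where "c X = real (card (agr X id))" for X
  have c: "real (card (agr X \<sigma>)) = c X" if "\<sigma> \<in> G" for X \<sigma>
    using card_agr_eq[OF that G_id, of X] by (simp add: c_def)
  have cpos: "0 < c X" for X using card_agr_pos[OF G_id, of X] by (simp add: c_def)
  have fin: "finite (E \<union> F)" using D finite_subset by blast
  then have finEF: "finite E" "finite F" "finite D" using D finite_subset by auto
  have cEF: "card (E \<union> F) = card E + card F" using D finEF by (simp add: card_Un_disjoint)
  have cDF: "card (D \<union> F) = card D + card F" using D finEF by (intro card_Un_disjoint) auto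
  have cDE: "card D \<le> card E" using D finEF by (simp add: card_mono)
  have "c (D \<union> F) * (\<Sum>\<sigma>\<in>agr E \<rho>. g \<sigma>) = (\<Sum>\<sigma>\<in>agr E \<rho>. \<Sum>\<tau>\<in>agr (D \<union> F) \<sigma>. g \<tau>)"
    using g(2) c by (auto simp: sum_distrib_left intro!: sum.cong dest: agr_G)
  also have "\<dots> = (\<Sum>\<sigma>\<in>agr E \<rho>. \<Sum>\<tau>\<in>{\<tau> \<in> agr D \<rho>. \<forall>x\<in>D \<union> F. \<tau> x = \<sigma> x}. g \<tau>)"
    by (intro sum.cong refl) (use D in \<open>auto simp: agr_def\<close>)
  also have "\<dots> = (\<Sum>\<tau>\<in>agr D \<rho>. \<Sum>\<sigma>\<in>{\<sigma> \<in> agr E \<rho>. \<forall>x\<in>D \<union> F. \<tau> x = \<sigma> x}. g \<tau>)"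
    by (rule sum.swap_restrict) auto
  also have "\<dots> \<le> (\<Sum>\<tau>\<in>agr D \<rho>. c (E \<union> F) * g \<tau>)"
  proof (rule sum_mono)
    fix \<tau> assume \<tau>: "\<tau> \<in> agr D \<rho>"
    let ?X = "{\<sigma> \<in> agr E \<rho>. \<forall>x\<in>D \<union> F. \<tau> x = \<sigma> x}"
    have "real (card ?X) \<le> c (E \<union> F)"
    proof (cases "?X = {}")
      case True
      then show ?thesis using cpos[of "E \<union> F"] by (metis card.empty less_eq_real_def of_nat_0)
    next
      case False
      then obtain \<sigma>0 where s0: "\<sigma>0 \<in> ?X" by blast
      then have "?X \<subseteq> agr (E \<union> F) \<sigma>0" by (auto simp: agr_def)
      then have "card ?X \<le> card (agr (E \<union> F) \<sigma>0)" by (intro card_mono) auto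
      moreover have "\<sigma>0 \<in> G" using s0 by (auto simp: agr_def)
      ultimately show ?thesis using c[of \<sigma>0 "E \<union> F"] by linarith
    qed
    then show "(\<Sum>\<sigma>\<in>?X. g \<tau>) \<le> c (E \<union> F) * g \<tau>"
      using g(1) \<tau> agr_G by (auto intro!: mult_right_mono)
  qed
  also have "\<dots> = c (E \<union> F) * (\<Sum>\<tau>\<in>agr D \<rho>. g \<tau>)" by (simp add: sum_distrib_left)
  finally have main: "c (D \<union> F) * (\<Sum>\<sigma>\<in>agr E \<rho>. g \<sigma>) \<le> c (E \<union> F) * (\<Sum>\<tau>\<in>agr D \<rho>. g \<tau>)" .
  have cf: "2 * c X = fact (n - card X)" if "X \<subseteq> {1..n}" "card X + 2 \<le> n" for X
    using arg_cong[OF card_agr[OF that G_id], of real] unfolding c_def by simp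
  have "fact (n - card D) * fact (n - card E - card F) \<le>
      (2 ^ card F * fact (n - card D - card F) * fact (n - card E) :: nat)"
    using D cEF cDE by (intro fact_ratio_le) auto
  then have "real (fact (n - card D) * fact (n - card E - card F)) \<le>
      real (2 ^ card F * fact (n - card D - card F) * fact (n - card E))"
    by (rule of_nat_mono)
  moreover have "2 * c (D \<union> F) = fact (n - card D - card F)"
    using cf[of "D \<union> F"] D cEF cDF cDE by (auto simp: diff_diff_add)
  moreover have "2 * c (E \<union> F) = fact (n - card E - card F)"
    using cf[of "E \<union> F"] D cEF by (simp add: diff_diff_add)
  moreover have "2 * c D = fact (n - card D)" "2 * c E = fact (n - card E)"
    using cf[of D] cf[of E] D cEF cDE by auto
  ultimately have "(2 * c D) * (2 * c (E \<union> F)) \<le> 2 ^ card F * (2 * c (D \<union> F)) * (2 * c E)"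
    by (simp only: of_nat_mult of_nat_power of_nat_numeral of_nat_fact)
  then have ratio: "c D * c (E \<union> F) \<le> 2 ^ card F * c (D \<union> F) * c E"
    by simp
  have S: "0 \<le> (\<Sum>\<tau>\<in>agr D \<rho>. g \<tau>)" using g(1) agr_G by (simp add: sum_nonneg)
  have "c (D \<union> F) * c D * (\<Sum>\<sigma>\<in>agr E \<rho>. g \<sigma>) \<le> c D * c (E \<union> F) * (\<Sum>\<tau>\<in>agr D \<rho>. g \<tau>)"
    using mult_left_mono[OF main, of "c D"] cpos[of D] by (simp add: mult_ac)
  also have "\<dots> \<le> 2 ^ card F * c (D \<union> F) * c E * (\<Sum>\<tau>\<in>agr D \<rho>. g \<tau>)"
    using ratio S by (rule mult_right_mono)
  finally have "c (D \<union> F) * (c D * (\<Sum>\<sigma>\<in>agr E \<rho>. g \<sigma>)) \<le>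
    c (D \<union> F) * (2 ^ card F * c E * (\<Sum>\<tau>\<in>agr D \<rho>. g \<tau>))" by (simp add: mult_ac)
  then have "c D * (\<Sum>\<sigma>\<in>agr E \<rho>. g \<sigma>) \<le> 2 ^ card F * c E * (\<Sum>\<tau>\<in>agr D \<rho>. g \<tau>)"
    using cpos[of "D \<union> F"] by simp
  then show ?thesis unfolding av_def c[OF \<rho>]
    using cpos[of D] cpos[of E] by (simp add: divide_simps mult_ac)
qed


definition pair_sets :: "nat \<Rightarrow> nat set \<Rightarrow> nat set set" where
  "pair_sets d T0 = {T. T \<subseteq> {..<m} - T0 \<and> card T = d}"

text \<open>A stand-in for the weight of \<open>f\<close> on level \<open>d\<close> after
  restriction on \<open>T0\<close>: it sees only the components that are antisymmetric in
  \<open>d\<close> different unrevealed pairs.\<close>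

definition level_weight :: "((nat \<Rightarrow> nat) \<Rightarrow> real) \<Rightarrow> nat \<Rightarrow> nat set \<Rightarrow> (nat \<Rightarrow> nat) \<Rightarrow> real" where
  "level_weight f d T0 \<rho> = (\<Sum>T\<in>pair_sets d T0. av (pr T0) \<rho> (\<lambda>\<sigma>. (phi f T0 T \<sigma>)\<^sup>2))"

lemma finite_pair_sets [simp]: "finite (pair_sets d T0)"
  unfolding pair_sets_def by (rule finite_subset[of _ "Pow {..<m}"]) auto

lemma pair_setsD: "T \<in> pair_sets d T0 \<Longrightarrow> T \<subseteq> {..<m}" "T \<in> pair_sets d T0 \<Longrightarrow> T0 \<inter> T = {}"
  "T \<in> pair_sets d T0 \<Longrightarrow> card T = d" "T \<in> pair_sets d T0 \<Longrightarrow> T \<subseteq> {..<m} - T0" "T \<in> pair_sets d T0 \<Longrightarrow> finite T"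
  unfolding pair_sets_def by (auto dest: finite_subset)

lemma level_weight_nonneg: "0 \<le> level_weight f d T0 \<rho>"
  unfolding level_weight_def by (intro sum_nonneg av_nonneg) auto

lemma level_weight_cong: "(\<And>x. x \<in> pr T0 \<Longrightarrow> \<rho>' x = \<rho> x) \<Longrightarrow> level_weight f d T0 \<rho>' = level_weight f d T0 \<rho>"
  unfolding level_weight_def using av_cong[of "pr T0" \<rho>' \<rho>] by simp

text \<open>The weight is the inner product of \<open>f\<close> with the sum \<open>g\<close> of all
  components. Jensen with the weight \<open>f\<close>, followed by \<open>f \<le> 1\<close>, leaves
  the moment of order \<open>2 * r\<close> of \<open>g\<close>; random swaps make \<open>g\<close>
  homogeneous of degree \<open>d\<close> in independent signs, and Bonami replaces it by the square
  function.\<close>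

lemma level_weight_moment:
  assumes T0: "T0 \<subseteq> {..<m}" and \<rho>: "\<rho> \<in> G" and f: "\<And>\<sigma>. \<sigma> \<in> G \<Longrightarrow> 0 \<le> f \<sigma> \<and> f \<sigma> \<le> 1" and r: "0 < r"
  shows "level_weight f d T0 \<rho> ^ (2 * r) \<le> av (pr T0) \<rho> f ^ (2 * r - 1) *
    (real (2 * r) ^ (d * r) * av (pr T0) \<rho> (\<lambda>\<sigma>. (\<Sum>T\<in>pair_sets d T0. (phi f T0 T \<sigma>)\<^sup>2) ^ r))"
proof -
  define V where "V = {..<m} - T0"
  define g where "g \<sigma> = (\<Sum>T\<in>pair_sets d T0. phi f T0 T \<sigma>)" for \<sigma>
  define A where "A = agr (pr T0) \<rho>"
  define c where "c = real (card A)"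
  have c: "0 < c" using card_agr_pos[OF \<rho>] by (simp add: c_def A_def)
  have fA: "0 \<le> f \<sigma>" "f \<sigma> \<le> 1" if "\<sigma> \<in> A" for \<sigma> using f that agr_G unfolding A_def by blast+
  have finV: "finite V" by (simp add: V_def)
  have level_weight: "level_weight f d T0 \<rho> = (\<Sum>\<sigma>\<in>A. f \<sigma> / c * g \<sigma>)"
  proof -
    have "level_weight f d T0 \<rho> = (\<Sum>T\<in>pair_sets d T0. av (pr T0) \<rho> (\<lambda>\<sigma>. f \<sigma> * phi f T0 T \<sigma>))"
      unfolding level_weight_def by (intro sum.cong refl phi_inner[symmetric] T0 \<rho>) (auto dest: pair_setsD)
    also have "\<dots> = av (pr T0) \<rho> (\<lambda>\<sigma>. f \<sigma> * g \<sigma>)"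
      unfolding g_def by (simp add: sum_distrib_left av_sum)
    finally show ?thesis by (simp add: av_def A_def c_def sum_divide_distrib)
  qed
  have "level_weight f d T0 \<rho> ^ (2 * r) \<le> (\<Sum>\<sigma>\<in>A. f \<sigma> / c) ^ (2 * r - 1) * (\<Sum>\<sigma>\<in>A. f \<sigma> / c * g \<sigma> ^ (2 * r))"
    unfolding level_weight using fA c r by (intro sum_power_le_power_sum) (auto simp: A_def)
  also have "\<dots> \<le> (\<Sum>\<sigma>\<in>A. f \<sigma> / c) ^ (2 * r - 1) * (\<Sum>\<sigma>\<in>A. 1 / c * g \<sigma> ^ (2 * r))"
  proof (rule mult_left_mono)
    show "(\<Sum>\<sigma>\<in>A. f \<sigma> / c * g \<sigma> ^ (2 * r)) \<le> (\<Sum>\<sigma>\<in>A. 1 / c * g \<sigma> ^ (2 * r))"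
      using fA c by (intro sum_mono mult_right_mono divide_right_mono) auto
    show "0 \<le> (\<Sum>\<sigma>\<in>A. f \<sigma> / c) ^ (2 * r - 1)"
      using fA c by (intro zero_le_power sum_nonneg) auto
  qed
  also have "(\<Sum>\<sigma>\<in>A. f \<sigma> / c) = av (pr T0) \<rho> f" by (simp add: av_def A_def c_def sum_divide_distrib)
  also have "(\<Sum>\<sigma>\<in>A. 1 / c * g \<sigma> ^ (2 * r)) = av (pr T0) \<rho> (\<lambda>\<sigma>. g \<sigma> ^ (2 * r))"
    by (simp add: av_def A_def c_def sum_divide_distrib)
  finally have 1: "level_weight f d T0 \<rho> ^ (2 * r) \<le> av (pr T0) \<rho> f ^ (2 * r - 1) * av (pr T0) \<rho> (\<lambda>\<sigma>. g \<sigma> ^ (2 * r))" .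
  \<comment> \<open>Swaps of unrevealed pairs preserve the coset, so \<open>g\<close> may be
    averaged over all of them.\<close>
  have "2 ^ card V * av (pr T0) \<rho> (\<lambda>\<sigma>. g \<sigma> ^ (2 * r)) = (\<Sum>S\<in>Pow V. av (pr T0) \<rho> (\<lambda>\<sigma>. g \<sigma> ^ (2 * r)))"
    by (simp add: card_Pow finV)
  also have "\<dots> = (\<Sum>S\<in>Pow V. av (pr T0) \<rho> (\<lambda>\<sigma>. g (\<sigma> \<circ> sw S) ^ (2 * r)))"
  proof (intro sum.cong refl)
    fix S assume "S \<in> Pow V"
    then have "S \<subseteq> {..<m}" "S \<inter> T0 = {}" unfolding V_def by auto
    then show "av (pr T0) \<rho> (\<lambda>\<sigma>. g \<sigma> ^ (2 * r)) = av (pr T0) \<rho> (\<lambda>\<sigma>. g (\<sigma> \<circ> sw S) ^ (2 * r))"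
      using av_sw[OF \<rho> _ T0, of S "\<lambda>\<sigma>. g \<sigma> ^ (2 * r)"] by simp
  qed
  also have "\<dots> = av (pr T0) \<rho> (\<lambda>\<sigma>. \<Sum>S\<in>Pow V. g (\<sigma> \<circ> sw S) ^ (2 * r))"
    by (simp add: av_sum)
  also have "\<dots> \<le> av (pr T0) \<rho> (\<lambda>\<sigma>. 2 ^ card V * (real (2 * r) ^ (d * r) * (\<Sum>T\<in>pair_sets d T0. (phi f T0 T \<sigma>)\<^sup>2) ^ r))"
  proof (rule av_mono)
    fix \<sigma> assume "\<sigma> \<in> agr (pr T0) \<rho>"
    then have \<sigma>: "\<sigma> \<in> G" by (rule agr_G)
    define a where "a T = (if card T = d then phi f T0 T \<sigma> else 0)" for T
    have pair_sets: "pair_sets d T0 = {T \<in> Pow V. card T = d}" by (auto simp: pair_sets_def V_def)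
    have "g (\<sigma> \<circ> sw S) = (\<Sum>T\<in>Pow V. (-1) ^ card (S \<inter> T) * a T)" if "S \<in> Pow V" for S
    proof -
      have "g (\<sigma> \<circ> sw S) = (\<Sum>T\<in>pair_sets d T0. (-1) ^ card (S \<inter> T) * phi f T0 T \<sigma>)"
        unfolding g_def using that by (intro sum.cong refl phi_sw T0 \<sigma>) (auto dest: pair_setsD simp: V_def)
      also have "\<dots> = (\<Sum>T\<in>Pow V. if card T = d then (-1) ^ card (S \<inter> T) * phi f T0 T \<sigma> else 0)"
        unfolding pair_sets using finV by (intro sum.inter_filter) auto
      also have "\<dots> = (\<Sum>T\<in>Pow V. (-1) ^ card (S \<inter> T) * a T)"
        by (intro sum.cong) (auto simp: a_def)
      finally show ?thesis .
    qed
    then have "(\<Sum>S\<in>Pow V. g (\<sigma> \<circ> sw S) ^ (2 * r)) = (\<Sum>S\<in>Pow V. (\<Sum>T\<in>Pow V. (-1) ^ card (S \<inter> T) * a T) ^ (2 * r))"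
      by simp
    also have "\<dots> \<le> 2 ^ card V * (\<Sum>T\<in>Pow V. real (2 * r) ^ card T * (a T)\<^sup>2) ^ r"
      by (rule bonami_lemma[OF finV r])
    also have "(\<Sum>T\<in>Pow V. real (2 * r) ^ card T * (a T)\<^sup>2) =
        (\<Sum>T\<in>Pow V. if card T = d then real (2 * r) ^ d * (phi f T0 T \<sigma>)\<^sup>2 else 0)"
      by (intro sum.cong) (auto simp: a_def)
    also have "\<dots> = real (2 * r) ^ d * (\<Sum>T\<in>pair_sets d T0. (phi f T0 T \<sigma>)\<^sup>2)"
      unfolding pair_sets using finV by (subst sum.inter_filter[symmetric]) (auto simp: sum_distrib_left)
    finally show "(\<Sum>S\<in>Pow V. g (\<sigma> \<circ> sw S) ^ (2 * r)) \<le>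
       2 ^ card V * (real (2 * r) ^ (d * r) * (\<Sum>T\<in>pair_sets d T0. (phi f T0 T \<sigma>)\<^sup>2) ^ r)"
      by (simp only: power_mult_distrib power_mult[of _ d r])
  qed
  also have "\<dots> = 2 ^ card V * (real (2 * r) ^ (d * r) * av (pr T0) \<rho> (\<lambda>\<sigma>. (\<Sum>T\<in>pair_sets d T0. (phi f T0 T \<sigma>)\<^sup>2) ^ r))"
    by (simp only: av_cmult)
  finally have 2: "av (pr T0) \<rho> (\<lambda>\<sigma>. g \<sigma> ^ (2 * r)) \<le>
     real (2 * r) ^ (d * r) * av (pr T0) \<rho> (\<lambda>\<sigma>. (\<Sum>T\<in>pair_sets d T0. (phi f T0 T \<sigma>)\<^sup>2) ^ r)" by simp
  have "0 \<le> av (pr T0) \<rho> f" using f agr_G by (intro av_nonneg) blast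
  then show ?thesis using 1 mult_left_mono[OF 2, of "av (pr T0) \<rho> f ^ (2 * r - 1)"] by simp
qed

text \<open>
  The permutation is revealed one set \<open>T\<close> of pairs at a time; \<open>U\<close> is the set of pairs revealed so far.
\<close>

lemma moment_bound:
  assumes T0: "T0 \<subseteq> {..<m}" and K: "0 \<le> K"
    and b: "\<And>U \<tau>. U \<subseteq> {..<m} - T0 \<Longrightarrow> card U \<le> B \<Longrightarrow> \<tau> \<in> agr (pr T0) \<rho> \<Longrightarrow>
      av (pr (T0 \<union> U)) \<tau> (\<lambda>\<sigma>. \<Sum>T\<in>pair_sets d T0. (phi f T0 T \<sigma>)\<^sup>2) \<le> K"
  shows "U \<subseteq> {..<m} - T0 \<Longrightarrow> card U + d * s \<le> B \<Longrightarrow> \<tau> \<in> agr (pr T0) \<rho> \<Longrightarrow>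
    av (pr (T0 \<union> U)) \<tau> (\<lambda>\<sigma>. (\<Sum>T\<in>pair_sets d T0. (phi f T0 T \<sigma>)\<^sup>2) ^ s) \<le> K ^ s"
proof (induction s arbitrary: U \<tau>)
  case 0
  then show ?case using av_const[OF agr_G[OF 0(3)], of _ "\<lambda>_. 1" 1] by simp
next
  case (Suc s)
  define \<Psi> where "\<Psi> \<sigma> = (\<Sum>T\<in>pair_sets d T0. (phi f T0 T \<sigma>)\<^sup>2)" for \<sigma>
  have \<tau>: "\<tau> \<in> G" using Suc agr_G by blast
  have "av (pr (T0 \<union> U)) \<tau> (\<lambda>\<sigma>. (phi f T0 T \<sigma>)\<^sup>2 * \<Psi> \<sigma> ^ s) \<le>
      K ^ s * av (pr (T0 \<union> U)) \<tau> (\<lambda>\<sigma>. (phi f T0 T \<sigma>)\<^sup>2)" if T: "T \<in> pair_sets d T0" for T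
  proof -
    have "av (pr (T0 \<union> U)) \<tau> (\<lambda>\<sigma>. (phi f T0 T \<sigma>)\<^sup>2 * \<Psi> \<sigma> ^ s) =
       av (pr (T0 \<union> U)) \<tau> (\<lambda>\<sigma>. av (pr (T0 \<union> (U \<union> T))) \<sigma> (\<lambda>\<sigma>. (phi f T0 T \<sigma>)\<^sup>2 * \<Psi> \<sigma> ^ s))"
      by (rule av_tower[symmetric, OF \<tau>]) (auto simp: pr_def)
    also have "\<dots> = av (pr (T0 \<union> U)) \<tau> (\<lambda>\<sigma>. av (pr (T0 \<union> (U \<union> T))) \<sigma> (\<lambda>\<sigma>'. (phi f T0 T \<sigma>)\<^sup>2 * \<Psi> \<sigma>' ^ s))"
    proof (intro av_fun_cong)
      fix \<sigma> \<sigma>' assume "\<sigma>' \<in> agr (pr (T0 \<union> (U \<union> T))) \<sigma>"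
      then have "phi f T0 T \<sigma>' = phi f T0 T \<sigma>"
        using pair_setsD[OF T] T0 by (intro phi_cong) (auto simp: agr_def pr_def)
      then show "(phi f T0 T \<sigma>')\<^sup>2 * \<Psi> \<sigma>' ^ s = (phi f T0 T \<sigma>)\<^sup>2 * \<Psi> \<sigma>' ^ s" by simp
    qed
    also have "\<dots> = av (pr (T0 \<union> U)) \<tau> (\<lambda>\<sigma>. (phi f T0 T \<sigma>)\<^sup>2 * av (pr (T0 \<union> (U \<union> T))) \<sigma> (\<lambda>\<sigma>'. \<Psi> \<sigma>' ^ s))"
      by (simp only: av_cmult)
    also have "\<dots> \<le> av (pr (T0 \<union> U)) \<tau> (\<lambda>\<sigma>. (phi f T0 T \<sigma>)\<^sup>2 * K ^ s)"
    proof (intro av_mono mult_left_mono)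
      fix \<sigma> assume s: "\<sigma> \<in> agr (pr (T0 \<union> U)) \<tau>"
      have "card (U \<union> T) \<le> card U + d" using card_Un_le[of U T] pair_setsD[OF T] by simp
      then show "av (pr (T0 \<union> (U \<union> T))) \<sigma> (\<lambda>\<sigma>'. \<Psi> \<sigma>' ^ s) \<le> K ^ s"
        unfolding \<Psi>_def using Suc.prems pair_setsD[OF T] s
        by (intro Suc.IH) (auto simp: agr_def pr_Un)
    qed auto
    finally show ?thesis by (simp only: mult.commute[of _ "K ^ s"] av_cmult)
  qed
  then have "(\<Sum>T\<in>pair_sets d T0. av (pr (T0 \<union> U)) \<tau> (\<lambda>\<sigma>. (phi f T0 T \<sigma>)\<^sup>2 * \<Psi> \<sigma> ^ s)) \<le>
     (\<Sum>T\<in>pair_sets d T0. K ^ s * av (pr (T0 \<union> U)) \<tau> (\<lambda>\<sigma>. (phi f T0 T \<sigma>)\<^sup>2))"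
    by (rule sum_mono)
  also have "\<dots> = K ^ s * av (pr (T0 \<union> U)) \<tau> \<Psi>"
    unfolding \<Psi>_def av_sum by (simp add: sum_distrib_left)
  also have "\<dots> \<le> K ^ s * K"
    unfolding \<Psi>_def using Suc.prems K by (intro mult_left_mono b) auto
  finally have "av (pr (T0 \<union> U)) \<tau> (\<lambda>\<sigma>. (\<Sum>T\<in>pair_sets d T0. (phi f T0 T \<sigma>)\<^sup>2) * \<Psi> \<sigma> ^ s) \<le> K ^ s * K"
    by (simp only: av_sum sum_distrib_right)
  then show ?case unfolding \<Psi>_def by (simp add: mult.commute)
qed

text \<open>Jensen applied to \<open>phi_split\<close>: the component is a signed mean of components
  of the restrictions, and the signs disappear in the squares.\<close>

lemma phi_square_split:
  assumes T0: "T0 \<subseteq> {..<m}" and T: "T \<subseteq> {..<m}" "T' \<subseteq> {..<m}" and dis: "T \<inter> T' = {}" "T0 \<inter> T = {}" and \<rho>: "\<rho> \<in> G"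
    and b: "\<And>S. S \<subseteq> T \<Longrightarrow> av (pr (T0 \<union> T)) (\<rho> \<circ> sw S) (\<lambda>\<sigma>. (phi f (T0 \<union> T) T' \<sigma>)\<^sup>2) = w S"
  shows "av (pr (T0 \<union> T)) \<rho> (\<lambda>\<sigma>. (phi f T0 (T \<union> T') \<sigma>)\<^sup>2) \<le> (\<Sum>S\<in>Pow T. w S) / 2 ^ card T"
proof -
  have fin: "finite T" using T finite_subset by blast
  have cp: "real (card (Pow T)) = 2 ^ card T" by (simp add: card_Pow fin)
  have "(phi f T0 (T \<union> T') \<sigma>)\<^sup>2 \<le> (\<Sum>S\<in>Pow T. (phi f (T0 \<union> T) T' (\<sigma> \<circ> sw S))\<^sup>2) / 2 ^ card T" for \<sigma>
  proof -
    have one: "(\<Sum>S\<in>Pow T. 1 / 2 ^ card T :: real) = 1" using cp by simp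
    have A: "(\<Sum>S\<in>Pow T. 1 / 2 ^ card T * ((-1) ^ card S * phi f (T0 \<union> T) T' (\<sigma> \<circ> sw S)))\<^sup>2 \<le>
      (\<Sum>S\<in>Pow T. 1 / 2 ^ card T) ^ (2 - 1) *
      (\<Sum>S\<in>Pow T. 1 / 2 ^ card T * ((-1) ^ card S * phi f (T0 \<union> T) T' (\<sigma> \<circ> sw S))\<^sup>2)"
      by (rule sum_power_le_power_sum) (use fin in auto)
    have sq: "((-1) ^ card S * x)\<^sup>2 = x\<^sup>2" for S :: "nat set" and x :: real
      by (simp add: power_mult_distrib flip: power_mult)
    show ?thesis
      using A[unfolded one sq] unfolding phi_split[OF T0 T dis] by (simp add: sum_divide_distrib)
  qed
  then have "av (pr (T0 \<union> T)) \<rho> (\<lambda>\<sigma>. (phi f T0 (T \<union> T') \<sigma>)\<^sup>2) \<le>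
     av (pr (T0 \<union> T)) \<rho> (\<lambda>\<sigma>. (\<Sum>S\<in>Pow T. (phi f (T0 \<union> T) T' (\<sigma> \<circ> sw S))\<^sup>2) / 2 ^ card T)"
    by (rule av_mono)
  also have "\<dots> = (\<Sum>S\<in>Pow T. av (pr (T0 \<union> T)) \<rho> (\<lambda>\<sigma>. (phi f (T0 \<union> T) T' (\<sigma> \<circ> sw S))\<^sup>2)) / 2 ^ card T"
    by (simp only: av_divide av_sum)
  also have "\<dots> = (\<Sum>S\<in>Pow T. w S) / 2 ^ card T"
  proof -
    have "av (pr (T0 \<union> T)) \<rho> (\<lambda>\<sigma>. (phi f (T0 \<union> T) T' (\<sigma> \<circ> sw S))\<^sup>2) = w S" if "S \<in> Pow T" for S
    proof -
      have S: "S \<subseteq> {..<m}" using that T by auto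
      have "av (sw S ` pr (T0 \<union> T)) \<rho> (\<lambda>\<sigma>. (phi f (T0 \<union> T) T' (\<sigma> \<circ> sw S))\<^sup>2) =
        av (pr (T0 \<union> T)) (\<rho> \<circ> sw S) (\<lambda>\<sigma>. (phi f (T0 \<union> T) T' \<sigma>)\<^sup>2)"
        by (rule av_right[OF sw_G[OF S]])
      then show ?thesis using sw_image[OF S, of "T0 \<union> T"] T0 T b that by simp
    qed
    then show ?thesis by simp
  qed
  finally show ?thesis .
qed


text \<open>Each \<open>T\<close> splits into its revealed part \<open>A = T \<inter> U\<close> and
  the rest. The revealed pairs outside \<open>A\<close> are forgotten at a bounded price; those in
  \<open>A\<close> become a restriction, leaving a level weight of degree
  \<open>d - card A\<close>.\<close>

lemma av_Psi_bound:
  assumes T0: "T0 \<subseteq> {..<m}" and U: "U \<subseteq> {..<m} - T0" and n: "4 * (card T0 + card U + d) \<le> n"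
    and \<rho>: "\<rho> \<in> G" and \<tau>: "\<tau> \<in> agr (pr T0) \<rho>"
    and b: "\<And>A \<rho>'. A \<subseteq> {..<m} - T0 \<Longrightarrow> card A \<le> d \<Longrightarrow> \<rho>' \<in> agr (pr T0) \<rho> \<Longrightarrow>
      level_weight f (d - card A) (T0 \<union> A) \<rho>' \<le> b (card A)"
  shows "av (pr (T0 \<union> U)) \<tau> (\<lambda>\<sigma>. \<Sum>T\<in>pair_sets d T0. (phi f T0 T \<sigma>)\<^sup>2) \<le>
    4 ^ d * (\<Sum>k\<le>d. real (card U choose k) * b k)"
proof -
  define V where "V = {..<m} - T0"
  define As where "As = {A \<in> Pow U. card A \<le> d}"
  define Ts where "Ts A = {T. T \<subseteq> V - U \<and> card T = d - card A}" for A :: "nat set"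
  have finU: "finite U" using U finite_subset by blast
  have finA: "finite As" using finU by (simp add: As_def)
  have finV: "finite (V - U)" by (simp add: V_def)
  have finT: "finite (Ts A)" for A
    by (rule finite_subset[of _ "Pow (V - U)"]) (auto simp: Ts_def finV)
  have \<tau>G: "\<tau> \<in> G" using \<tau> agr_G by blast
  define h where "h T = av (pr (T0 \<union> U)) \<tau> (\<lambda>\<sigma>. (phi f T0 T \<sigma>)\<^sup>2)" for T
  have "(\<Sum>T\<in>pair_sets d T0. h T) = (\<Sum>(A, T)\<in>Sigma As Ts. h (A \<union> T))"
  proof (rule sum.reindex_bij_witness[where j = "\<lambda>T. (T \<inter> U, T - U)" and i = "\<lambda>(A, T). A \<union> T"])
    fix T assume T: "T \<in> pair_sets d T0"
    then have "card T = card (T \<inter> U) + card (T - U)"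
      using pair_setsD(5) by (metis card_Diff_subset_Int card_mono finite_Int inf_le1 le_add_diff_inverse)
    then show "(T \<inter> U, T - U) \<in> Sigma As Ts" using pair_setsD[OF T] by (auto simp: As_def Ts_def V_def)
    show "(case (T \<inter> U, T - U) of (A, T) \<Rightarrow> A \<union> T) = T"
      "(case (T \<inter> U, T - U) of (A, T) \<Rightarrow> h (A \<union> T)) = h T" by (auto intro!: arg_cong[where f = h])
  next
    fix AT assume "AT \<in> Sigma As Ts"
    then obtain A T where AT: "AT = (A, T)" "A \<in> As" "T \<in> Ts A" by blast
    then have sub: "A \<subseteq> U" "card A \<le> d" "T \<subseteq> V - U" "card T = d - card A" by (auto simp: As_def Ts_def)
    moreover have "finite A" "finite T" using sub finU finV finite_subset by blast+
    moreover have "A \<inter> T = {}" using sub by auto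
    ultimately show "(case AT of (A, T) \<Rightarrow> A \<union> T) \<in> pair_sets d T0"
      using AT U by (auto simp: pair_sets_def V_def card_Un_disjoint)
    show "((case AT of (A, T) \<Rightarrow> A \<union> T) \<inter> U, (case AT of (A, T) \<Rightarrow> A \<union> T) - U) = AT"
      using AT sub by auto
  qed
  also have "\<dots> = (\<Sum>A\<in>As. \<Sum>T\<in>Ts A. h (A \<union> T))"
    using finA finT by (simp add: sum.Sigma)
  also have "\<dots> \<le> (\<Sum>A\<in>As. 4 ^ d * b (card A))"
  proof (rule sum_mono)
    fix A assume A: "A \<in> As"
    then have AU: "A \<subseteq> U" "card A \<le> d" by (auto simp: As_def)
    have finAA: "finite A" using AU finU finite_subset by blast
    define w where "w S T = av (pr (T0 \<union> A)) (\<tau> \<circ> sw S) (\<lambda>\<sigma>. (phi f (T0 \<union> A) T \<sigma>)\<^sup>2)" for S T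
    have "h (A \<union> T) \<le> 4 ^ d * ((\<Sum>S\<in>Pow A. w S T) / 2 ^ card A)" if T: "T \<in> Ts A" for T
    proof -
      have sub: "T \<subseteq> V - U" "card T = d - card A" using T by (auto simp: Ts_def)
      have finT: "finite T" using sub finV finite_subset by blast
      have TT: "T \<subseteq> {..<m}" "A \<subseteq> {..<m}" "A \<inter> T = {}" "T0 \<inter> A = {}" "U \<subseteq> {..<m}" "T0 \<inter> T = {}"
        using sub AU U by (auto simp: V_def)
      have pU: "pr (T0 \<union> U) \<union> pr T = pr (T0 \<union> U \<union> T)" by (simp add: pr_Un)
      have UT: "T0 \<union> U \<union> T \<subseteq> {..<m}" using TT T0 by auto
      have fin: "finite (T0 \<union> U \<union> T)" using UT finite_subset by blast
      have "card (T0 \<union> U \<union> T) \<le> card T0 + card U + card T"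
        using card_Un_le[of "T0 \<union> U" T] card_Un_le[of T0 U] by simp
      then have cd: "card (T0 \<union> U \<union> T) \<le> card T0 + card U + d" using sub by simp
      \<comment> \<open>Two points for each remaining pair give the factor
        \<open>2 ^ (2 * card T)\<close>, at most \<open>4 ^ d\<close>.\<close>
      have "h (A \<union> T) \<le> 2 ^ card (pr T) * av (pr (T0 \<union> A)) \<tau> (\<lambda>\<sigma>. (phi f T0 (A \<union> T) \<sigma>)\<^sup>2)"
        unfolding h_def
      proof (rule av_compare)
        show "pr (T0 \<union> A) \<subseteq> pr (T0 \<union> U)" using AU by (intro pr_mono) auto
        show "pr (T0 \<union> U) \<inter> pr T = {}" using sub TT by (intro pr_disjoint) auto
        show "pr (T0 \<union> U) \<union> pr T \<subseteq> {1..n}" using pr_subset[OF UT] pU by simp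
        show "2 * card (pr (T0 \<union> U) \<union> pr T) \<le> n" using cd n unfolding pU card_pr[OF fin] by simp
        show "card (pr (T0 \<union> U) \<union> pr T) + 2 \<le> n" unfolding pU by (rule card_pr_le[OF UT])
        show "(phi f T0 (A \<union> T) \<tau>')\<^sup>2 = (phi f T0 (A \<union> T) \<sigma>)\<^sup>2"
          if "\<tau>' \<in> agr (pr (T0 \<union> A) \<union> pr T) \<sigma>" for \<sigma> \<tau>'
          using that T0 TT phi_cong[of T0 "A \<union> T" \<tau>' \<sigma> f] by (auto simp: agr_def pr_Un)
      qed (use \<tau>G in auto)
      also have "\<dots> \<le> 4 ^ d * av (pr (T0 \<union> A)) \<tau> (\<lambda>\<sigma>. (phi f T0 (A \<union> T) \<sigma>)\<^sup>2)"
      proof (intro mult_right_mono av_nonneg)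
        have "(2::real) ^ card (pr T) = 4 ^ card T" unfolding card_pr[OF finT] by (simp add: power_mult)
        also have "\<dots> \<le> 4 ^ d" using sub by (intro power_increasing) auto
        finally show "(2::real) ^ card (pr T) \<le> 4 ^ d" .
      qed auto
      also have "\<dots> \<le> 4 ^ d * ((\<Sum>S\<in>Pow A. w S T) / 2 ^ card A)"
        by (intro mult_left_mono phi_square_split T0 TT \<tau>G) (auto simp: w_def)
      finally show ?thesis .
    qed
    then have "(\<Sum>T\<in>Ts A. h (A \<union> T)) \<le> (\<Sum>T\<in>Ts A. 4 ^ d * ((\<Sum>S\<in>Pow A. w S T) / 2 ^ card A))"
      by (rule sum_mono)
    also have "\<dots> = 4 ^ d * ((\<Sum>S\<in>Pow A. \<Sum>T\<in>Ts A. w S T) / 2 ^ card A)"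
      by (subst sum.swap) (simp add: sum_distrib_left sum_divide_distrib)
    also have "\<dots> \<le> 4 ^ d * ((\<Sum>S\<in>Pow A. b (card A)) / 2 ^ card A)"
    proof (intro mult_left_mono divide_right_mono sum_mono)
      fix S assume S: "S \<in> Pow A"
      have "(\<Sum>T\<in>Ts A. w S T) \<le> level_weight f (d - card A) (T0 \<union> A) (\<tau> \<circ> sw S)"
        unfolding level_weight_def w_def
      proof (rule sum_mono2)
        show "Ts A \<subseteq> pair_sets (d - card A) (T0 \<union> A)" using AU by (auto simp: Ts_def pair_sets_def V_def)
      qed (auto intro: av_nonneg)
      also have "\<dots> \<le> b (card A)"
      proof (rule b)
        show "A \<subseteq> {..<m} - T0" using AU U by auto
        have Sm: "S \<subseteq> {..<m}" "S \<inter> T0 = {}" using S AU U by auto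
        have "\<tau> \<circ> sw S \<in> G" using Sm sw_G \<tau>G by blast
        moreover have "(\<tau> \<circ> sw S) x = \<rho> x" if "x \<in> pr T0" for x
          using sw_fix[OF Sm(1) T0 Sm(2) that] \<tau> that by (simp add: agr_def)
        ultimately show "\<tau> \<circ> sw S \<in> agr (pr T0) \<rho>" by (simp add: agr_def)
      qed (use AU in auto)
      finally show "(\<Sum>T\<in>Ts A. w S T) \<le> b (card A)" .
    qed auto
    also have "\<dots> = 4 ^ d * b (card A)" using finAA by (simp add: card_Pow)
    finally show "(\<Sum>T\<in>Ts A. h (A \<union> T)) \<le> 4 ^ d * b (card A)" .
  qed
  also have "\<dots> = 4 ^ d * (\<Sum>A\<in>As. b (card A))" by (simp add: sum_distrib_left)
  also have "(\<Sum>A\<in>As. b (card A)) = (\<Sum>k\<le>d. \<Sum>A\<in>{A \<in> As. card A = k}. b (card A))"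
    by (rule sum.group[symmetric]) (use finA in \<open>auto simp: As_def\<close>)
  also have "\<dots> = (\<Sum>k\<le>d. real (card U choose k) * b k)"
  proof (rule sum.cong)
    fix k assume "k \<in> {..d}"
    then have "{A \<in> As. card A = k} = {A. A \<subseteq> U \<and> card A = k}" by (auto simp: As_def)
    then have "card {A \<in> As. card A = k} = card U choose k" using n_subsets[OF finU] by simp
    moreover have "(\<Sum>A\<in>{A \<in> As. card A = k}. b (card A)) = (\<Sum>A\<in>{A \<in> As. card A = k}. b k)"
      by (intro sum.cong) auto
    ultimately show "(\<Sum>A\<in>{A \<in> As. card A = k}. b (card A)) = real (card U choose k) * b k" by simp
  qed simp
  finally show ?thesis unfolding h_def by (simp add: av_sum)
qed

text \<open>
  If the bound failed, the term \<open>k = 0\<close> would dominate the moment bound; the resulting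
  inequality bounds a power of the level weight by a smaller power of itself, for the moment
  $2r \approx 2L/d$.
\<close>

lemma level_inequality:
  fixes L :: nat and C Q \<epsilon> :: real
  assumes f: "\<And>\<sigma>. \<sigma> \<in> G \<Longrightarrow> 0 \<le> f \<sigma> \<and> f \<sigma> \<le> 1"
    and glob: "\<And>T \<rho>. T \<subseteq> {..<m} \<Longrightarrow> card T \<le> L \<Longrightarrow> \<rho> \<in> G \<Longrightarrow> av (pr T) \<rho> f \<le> Q ^ card T * \<epsilon>"
    and \<epsilon>: "exp (- real L) \<le> \<epsilon>" and Q: "1 \<le> Q" and C: "2 * Q\<^sup>2 \<le> C" "400 \<le> C" and n: "16 * L \<le> n"
  shows "T0 \<subseteq> {..<m} \<Longrightarrow> card T0 + d \<le> L \<Longrightarrow> \<rho> \<in> G \<Longrightarrow>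
    level_weight f d T0 \<rho> \<le> (Q ^ card T0 * \<epsilon>)\<^sup>2 * (C * L / d) ^ d"
proof (induction d arbitrary: T0 \<rho> rule: less_induct)
  case (less d)
  note T0 = less.prems(1) and \<rho> = less.prems(3)
  define e where "e = Q ^ card T0 * \<epsilon>"
  have \<epsilon>0: "0 < \<epsilon>" using \<epsilon> exp_gt_zero[of "- real L"] by linarith
  have Q1: "1 \<le> Q ^ card T0" using Q by simp
  have e: "0 < e" "\<epsilon> \<le> e" using Q1 \<epsilon>0 by (auto simp: e_def)
  have av0: "0 \<le> av (pr T0) \<rho> f" using f agr_G by (intro av_nonneg) blast
  have ave: "av (pr T0) \<rho> f \<le> e" using glob[OF T0 _ \<rho>] less.prems by (simp add: e_def)
  show ?case
  proof (cases "d = 0")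
    \<comment> \<open>The factor \<open>(C * L / d) ^ d\<close> is a zeroth power, so it equals 1
      although the quotient divides by zero.\<close>
    case True
    have "pair_sets 0 T0 = {{}}" unfolding pair_sets_def by (auto dest: finite_subset)
    then have "level_weight f 0 T0 \<rho> = av (pr T0) \<rho> (\<lambda>\<sigma>. (av (pr T0) \<sigma> f)\<^sup>2)" by (simp add: level_weight_def phi_def)
    also have "\<dots> = (av (pr T0) \<rho> f)\<^sup>2"
    proof (rule av_const[OF \<rho>])
      fix \<sigma> assume "\<sigma> \<in> agr (pr T0) \<rho>"
      then show "(av (pr T0) \<sigma> f)\<^sup>2 = (av (pr T0) \<rho> f)\<^sup>2"
        using av_cong[of "pr T0" \<sigma> \<rho> f] by (simp add: agr_def)
    qed
    also have "\<dots> \<le> e\<^sup>2" using av0 ave by (intro power_mono) auto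
    finally show ?thesis using True by (simp add: e_def)
  next
    case False
    define Y Z where "Y = level_weight f d T0 \<rho>" and "Z = e\<^sup>2 * (C * L / d) ^ d"
    have d: "1 \<le> d" "d \<le> L" using False less.prems by auto
    have Z0: "0 \<le> Z" using C by (simp add: Z_def)
    have "Y \<le> Z"
    proof (rule ccontr)
      assume "\<not> Y \<le> Z"
      then have YZ: "Z < Y" by simp
      \<comment> \<open>The quotient of \<open>L\<close> by \<open>d\<close>, rounded up. Then
        \<open>L \<le> d * r\<close>, so that \<open>\<epsilon>\<close> is at least
        \<open>exp (- (d * r))\<close>, while \<open>d * r \<le> 2 * L\<close> bounds the number of
        pairs revealed in the moment argument.\<close>
      define r where "r = (L + d - 1) div d"
      have rd: "L \<le> d * r" "d * r \<le> 2 * L"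
      proof -
        have "L + d - 1 = d * r + (L + d - 1) mod d" by (simp add: r_def)
        moreover have "(L + d - 1) mod d < d" using d by simp
        ultimately show "L \<le> d * r" "d * r \<le> 2 * L" using d by linarith+
      qed
      have r: "0 < r" using rd d by (cases r) auto
      \<comment> \<open>For \<open>k = 0\<close> nothing more is restricted and the only available
        bound is the weight itself; for positive \<open>k\<close> this is the induction
        hypothesis.\<close>
      define b where "b k = (if k = 0 then Y else (Q ^ (card T0 + k) * \<epsilon>)\<^sup>2 * (C * L / real (d - k)) ^ (d - k))" for k
      have b0: "0 \<le> b k" for k using C Y_def level_weight_nonneg by (auto simp: b_def)
      define K where "K = 4 ^ d * (\<Sum>k\<le>d. real ((2 * L) choose k) * b k)"
      have K0: "0 \<le> K" using b0 by (auto simp: K_def intro!: sum_nonneg mult_nonneg_nonneg)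
      have bnd: "level_weight f (d - card A) (T0 \<union> A) \<rho>' \<le> b (card A)"
        if A: "A \<subseteq> {..<m} - T0" "card A \<le> d" and \<rho>': "\<rho>' \<in> agr (pr T0) \<rho>" for A \<rho>'
      proof (cases "A = {}")
        case True
        then show ?thesis using \<rho>' level_weight_cong[of T0 \<rho>' \<rho> f d] by (simp add: b_def Y_def agr_def)
      next
        case False
        have fin: "finite A" "finite T0" using A T0 finite_subset by blast+
        have c: "card (T0 \<union> A) = card T0 + card A" using fin A by (intro card_Un_disjoint) auto
        have cA: "card A \<noteq> 0" using fin False by simp
        have "level_weight f (d - card A) (T0 \<union> A) \<rho>' \<le>
          (Q ^ card (T0 \<union> A) * \<epsilon>)\<^sup>2 * (C * L / real (d - card A)) ^ (d - card A)"
        proof (rule less.IH)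
          show "d - card A < d" using cA d by simp
          show "T0 \<union> A \<subseteq> {..<m}" using A T0 by auto
          show "card (T0 \<union> A) + (d - card A) \<le> L" using c A less.prems by simp
          show "\<rho>' \<in> G" using \<rho>' agr_G by blast
        qed
        then show ?thesis using cA c by (simp add: b_def)
      qed
      have Psi: "av (pr (T0 \<union> U)) \<tau> (\<lambda>\<sigma>. \<Sum>T\<in>pair_sets d T0. (phi f T0 T \<sigma>)\<^sup>2) \<le> K"
        if U: "U \<subseteq> {..<m} - T0" "card U \<le> 2 * L" and \<tau>: "\<tau> \<in> agr (pr T0) \<rho>" for U \<tau>
      proof -
        have "av (pr (T0 \<union> U)) \<tau> (\<lambda>\<sigma>. \<Sum>T\<in>pair_sets d T0. (phi f T0 T \<sigma>)\<^sup>2) \<le>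
          4 ^ d * (\<Sum>k\<le>d. real (card U choose k) * b k)"
          using U n less.prems d by (intro av_Psi_bound[OF T0 U(1) _ \<rho> \<tau> bnd]) auto
        also have "\<dots> \<le> K" unfolding K_def
          using U b0 by (intro mult_left_mono sum_mono mult_right_mono) (auto intro: binomial_right_mono)
        finally show ?thesis .
      qed
      have "av (pr (T0 \<union> {})) \<rho> (\<lambda>\<sigma>. (\<Sum>T\<in>pair_sets d T0. (phi f T0 T \<sigma>)\<^sup>2) ^ r) \<le> K ^ r"
        using rd \<rho> by (intro moment_bound[OF T0 K0, of "2 * L" \<rho>] Psi) (auto intro: agr_refl)
      then have mom: "av (pr T0) \<rho> (\<lambda>\<sigma>. (\<Sum>T\<in>pair_sets d T0. (phi f T0 T \<sigma>)\<^sup>2) ^ r) \<le> K ^ r" by simp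
      \<comment> \<open>Here the assumption that the bound fails is used: the terms with positive
        \<open>k\<close> sum to at most \<open>6 ^ d * Z\<close>, hence to at most
        \<open>6 ^ d * Y\<close>, and \<open>4 ^ d * (1 + 6 ^ d) \<le> 28 ^ d\<close>.\<close>
      have Kle: "K \<le> 28 ^ d * Y"
      proof -
        have "{..d} = insert 0 {1..d}" by auto
        then have "(\<Sum>k\<le>d. real ((2 * L) choose k) * b k) = Y + (\<Sum>k\<in>{1..d}. real ((2 * L) choose k) * b k)"
          by (simp add: b_def)
        also have "(\<Sum>k\<in>{1..d}. real ((2 * L) choose k) * b k) =
           e\<^sup>2 * (\<Sum>k\<in>{1..d}. real ((2 * L) choose k) * ((Q ^ k)\<^sup>2 * (C * L / real (d - k)) ^ (d - k)))"
          unfolding sum_distrib_left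
          by (intro sum.cong refl) (simp add: b_def e_def power_add power_mult_distrib mult_ac)
        also have "\<dots> \<le> e\<^sup>2 * (6 ^ d * (C * L / d) ^ d)"
          using C d by (intro mult_left_mono binomial_level_sum) auto
        also have "\<dots> = 6 ^ d * Z" by (simp add: Z_def)
        also have "\<dots> \<le> 6 ^ d * Y" using YZ by simp
        finally have "(\<Sum>k\<le>d. real ((2 * L) choose k) * b k) \<le> (1 + 6 ^ d) * Y" by (simp add: algebra_simps)
        also have "\<dots> \<le> 7 ^ d * Y"
        proof (rule mult_right_mono)
          show "(1::real) + 6 ^ d \<le> 7 ^ d"
            using d
          proof (induction d rule: dec_induct)
            case (step k)
            then have "(1::real) + 6 ^ Suc k \<le> 7 * (1 + 6 ^ k)" by simp
            also have "\<dots> \<le> 7 * 7 ^ k" using step by simp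
            finally show ?case by simp
          qed simp
        qed (use YZ Z0 in auto)
        finally have "K \<le> 4 ^ d * (7 ^ d * Y)" unfolding K_def by simp
        also have "\<dots> = 28 ^ d * Y" by (simp flip: mult.assoc power_mult_distrib)
        finally show ?thesis .
      qed
      have Y0: "0 < Y" using YZ Z0 by simp
      have avn: "0 \<le> av (pr T0) \<rho> (\<lambda>\<sigma>. (\<Sum>T\<in>pair_sets d T0. (phi f T0 T \<sigma>)\<^sup>2) ^ r)"
        by (rule av_nonneg, rule zero_le_power, rule sum_nonneg, rule zero_le_power2)
      have "Y ^ (2 * r) \<le> av (pr T0) \<rho> f ^ (2 * r - 1) *
        (real (2 * r) ^ (d * r) * av (pr T0) \<rho> (\<lambda>\<sigma>. (\<Sum>T\<in>pair_sets d T0. (phi f T0 T \<sigma>)\<^sup>2) ^ r))"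
        unfolding Y_def by (rule level_weight_moment[OF T0 \<rho> f r])
      also have "\<dots> \<le> e ^ (2 * r - 1) * (real (2 * r) ^ (d * r) * K ^ r)"
        by (intro mult_mono power_mono mult_left_mono) (use avn av0 ave mom e in auto)
      also have "\<dots> \<le> e ^ (2 * r - 1) * (real (2 * r) ^ (d * r) * (28 ^ d * Y) ^ r)"
        using e K0 Kle by (intro mult_left_mono power_mono) auto
      also have "\<dots> = e ^ (2 * r - 1) * ((28 * real (2 * r)) ^ d) ^ r * Y ^ r"
      proof -
        have P: "x ^ (d * r) * (28 ^ d * Y) ^ r = ((28 * x) ^ d) ^ r * Y ^ r" for x :: real
          unfolding power_mult power_mult_distrib by simp
        show ?thesis unfolding P by (rule mult.assoc[symmetric])
      qed
      finally have 1: "Y ^ r * Y ^ r \<le> e ^ (2 * r - 1) * ((28 * real (2 * r)) ^ d) ^ r * Y ^ r"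
        by (subst (asm) mult_2, subst (asm) power_add)
      have 2: "Y ^ r \<le> e ^ (2 * r - 1) * ((28 * real (2 * r)) ^ d) ^ r"
        by (rule mult_right_le_imp_le[OF 1]) (use Y0 in simp)
      \<comment> \<open>The lower bound on the density supplies the factor of \<open>e\<close>
        missing from \<open>e ^ (2 * r - 1)\<close>, at the price of one factor \<open>exp 1\<close>
        in the base of the power \<open>d\<close>.\<close>
      have 3: "1 \<le> e * (exp 1 ^ d) ^ r"
      proof -
        have "exp (real L) \<le> exp (real (d * r))" using rd by (simp only: exp_le_cancel_iff of_nat_le_iff)
        also have "\<dots> = (exp 1 ^ d) ^ r" by (simp add: exp_of_nat_mult[symmetric] flip: power_mult)
        finally have "exp (real L) \<le> (exp 1 ^ d) ^ r" .
        then have "exp (- real L) * exp (real L) \<le> e * (exp 1 ^ d) ^ r"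
          using \<epsilon> e by (intro mult_mono) auto
        then show ?thesis by (simp flip: exp_add)
      qed
      have "Y ^ r \<le> e ^ (2 * r - 1) * ((28 * real (2 * r)) ^ d) ^ r * (e * (exp 1 ^ d) ^ r)"
      proof -
        have "0 \<le> e ^ (2 * r - 1) * ((28 * real (2 * r)) ^ d) ^ r" using e by simp
        from mult_left_mono[OF 3 this] show ?thesis unfolding mult_1_right by (rule order_trans[OF 2])
      qed
      also have "\<dots> = (e ^ (2 * r - 1) * e) * (((28 * real (2 * r)) ^ d) ^ r * (exp 1 ^ d) ^ r)"
      proof -
        have "a * b * (c * f) = (a * c) * (b * f)" for a b c f :: real by simp
        then show ?thesis .
      qed
      also have "e ^ (2 * r - 1) * e = (e\<^sup>2) ^ r"
        using r by (simp flip: power_mult power_Suc2)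
      also have "(e\<^sup>2) ^ r * (((28 * real (2 * r)) ^ d) ^ r * (exp 1 ^ d) ^ r) =
          (e\<^sup>2 * (28 * real (2 * r) * exp 1) ^ d) ^ r"
      proof -
        have "a ^ r * ((x ^ d) ^ r * (y ^ d) ^ r) = (a * (x * y) ^ d) ^ r" for a x y :: real
          by (simp add: power_mult_distrib)
        then show ?thesis .
      qed
      finally have "Y ^ r \<le> (e\<^sup>2 * (28 * real (2 * r) * exp 1) ^ d) ^ r" .
      then have "Y \<le> e\<^sup>2 * (28 * real (2 * r) * exp 1) ^ d"
        by (rule power_mono_iff[THEN iffD1, rotated 3]) (use r Y0 in auto)
      also have "\<dots> \<le> e\<^sup>2 * (C * L / d) ^ d"
      proof (intro mult_left_mono power_mono)
        \<comment> \<open>The constant becomes 28 * 2 * 3 * 2 = 336, which the hypothesis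
          \<open>400 \<le> C\<close> covers.\<close>
        have "real d * real r \<le> 2 * real L" using rd(2) by (metis of_nat_le_iff of_nat_mult of_nat_numeral)
        then have "real r \<le> 2 * real L / real d" using d by (simp add: pos_le_divide_eq mult.commute)
        then have "56 * exp 1 * real r \<le> 56 * 3 * (2 * real L / real d)"
          using exp_le by (intro mult_mono) auto
        also have "\<dots> \<le> C * (real L / real d)" using C by (simp add: mult_right_mono divide_right_mono)
        finally show "28 * real (2 * r) * exp 1 \<le> C * real L / real d" by (simp add: mult_ac)
      qed auto
      finally show False using YZ by (simp add: Z_def)
    qed
    then show ?thesis by (simp add: Y_def Z_def e_def)
  qed
qed

end

section \<open>Right-invariant subspaces and levels\<close>

text \<open>The first-order condition at a minimum: for a small \<open>t\<close> of sign opposite to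
  \<open>a\<close>, the linear term would outweigh the quadratic one.\<close>

lemma quadratic_nonneg_imp_linear_zero:
  fixes a b :: real
  assumes "\<And>t. 0 \<le> 2 * t * a + t\<^sup>2 * b"
  shows "a = 0"
proof (rule ccontr)
  assume a: "a \<noteq> 0"
  define s where "s = 1 / (\<bar>b\<bar> + 1)"
  have s: "0 < s" "s * \<bar>b\<bar> < 1" by (auto simp: s_def field_simps)
  have "2 * (- s * a) * a + (- s * a)\<^sup>2 * b = s * a\<^sup>2 * (s * b - 2)"
    by (simp add: power2_eq_square algebra_simps)
  moreover have "s * b \<le> s * \<bar>b\<bar>" using s by (intro mult_left_mono) auto
  then have "s * b - 2 < 0" using s by linarith
  then have "s * a\<^sup>2 * (s * b - 2) < 0" using s a by (intro mult_pos_neg) auto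
  ultimately show False using assms[of "- s * a"] by linarith
qed

context alt_pairs begin

section \<open>The Euclidean space of functions on the group\<close>

definition R :: "(nat \<Rightarrow> nat) \<Rightarrow> ((nat \<Rightarrow> nat) \<Rightarrow> real) \<Rightarrow> (nat \<Rightarrow> nat) \<Rightarrow> real" where
  "R b w = (\<lambda>\<sigma>. w (\<sigma> \<circ> b))"

text \<open>Functions on the group are extended by zero to the whole type, so that vanishing norm
  implies equality with the zero function.\<close>

definition FS :: "((nat \<Rightarrow> nat) \<Rightarrow> real) set" where
  "FS = {w. \<forall>\<sigma>. \<sigma> \<notin> G \<longrightarrow> w \<sigma> = 0}"

definition ip :: "((nat \<Rightarrow> nat) \<Rightarrow> real) \<Rightarrow> ((nat \<Rightarrow> nat) \<Rightarrow> real) \<Rightarrow> real" where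
  "ip v w = (\<Sum>\<sigma>\<in>G. v \<sigma> * w \<sigma>)"

text \<open>This is the squared norm, for the counting measure.\<close>

definition nrm :: "((nat \<Rightarrow> nat) \<Rightarrow> real) \<Rightarrow> real" where
  "nrm w = ip w w"

definition lin :: "((nat \<Rightarrow> nat) \<Rightarrow> real) set \<Rightarrow> bool" where
  "lin W \<longleftrightarrow> W \<subseteq> FS \<and> (\<lambda>_. 0) \<in> W \<and> (\<forall>v\<in>W. \<forall>w\<in>W. \<forall>c. (\<lambda>\<sigma>. v \<sigma> + c * w \<sigma>) \<in> W)"

definition rinv :: "(nat \<Rightarrow> nat) set \<Rightarrow> ((nat \<Rightarrow> nat) \<Rightarrow> real) set \<Rightarrow> bool" where
  "rinv H W \<longleftrightarrow> lin W \<and> (\<forall>b\<in>H. \<forall>w\<in>W. R b w \<in> W)"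

lemma R_apply [simp]: "R b w \<sigma> = w (\<sigma> \<circ> b)"
  by (simp add: R_def)

lemma R_R: "R a (R b w) = R (a \<circ> b) w"
  by (simp add: R_def o_assoc)

lemma R_id [simp]: "R id w = w"
  by (simp add: R_def)

lemma ip_comm: "ip v w = ip w v"
  by (simp add: ip_def mult.commute)

lemma ip_lin: "ip (\<lambda>\<sigma>. u \<sigma> + c * v \<sigma>) w = ip u w + c * ip v w"
  by (simp add: ip_def sum.distrib distrib_right sum_distrib_left mult.assoc)

lemma ip_lin2: "ip w (\<lambda>\<sigma>. u \<sigma> + c * v \<sigma>) = ip w u + c * ip w v"
  using ip_lin[of u c v w] by (simp add: ip_comm)

lemma ip_diff: "ip (\<lambda>\<sigma>. u \<sigma> - v \<sigma>) w = ip u w - ip v w"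
  by (simp add: ip_def sum_subtractf left_diff_distrib)

lemma ip_sum: "ip (\<lambda>\<sigma>. \<Sum>i\<in>I. c i * v i \<sigma>) w = (\<Sum>i\<in>I. c i * ip (v i) w)"
  by (simp add: ip_def sum_distrib_right sum_distrib_left mult.assoc)
    (subst sum.swap, rule refl)

lemma ip_zero [simp]: "ip (\<lambda>_. 0) w = 0"
  by (simp add: ip_def)

lemma ip_R: "b \<in> G \<Longrightarrow> ip (R b v) (R b w) = ip v w"
  unfolding ip_def R_apply by (rule sum_R[of b "\<lambda>\<sigma>. v \<sigma> * w \<sigma>"])

lemma ip_R_adj: "b \<in> G \<Longrightarrow> ip (R b v) w = ip v (R (inv' b) w)"
  using ip_R[of b v "R (inv' b) w"] by (simp add: R_R)

lemma nrm_nonneg: "0 \<le> nrm w"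
  by (simp add: nrm_def ip_def sum_nonneg)

lemma nrm_R: "b \<in> G \<Longrightarrow> nrm (R b w) = nrm w"
  by (simp add: nrm_def ip_R)

lemma nrm_lin: "nrm (\<lambda>\<sigma>. v \<sigma> + c * w \<sigma>) = nrm v + 2 * c * ip v w + c\<^sup>2 * nrm w"
  by (simp add: nrm_def ip_lin ip_lin2 ip_comm[of w v] power2_eq_square algebra_simps)

lemma nrm_eq_0: "w \<in> FS \<Longrightarrow> nrm w = 0 \<Longrightarrow> w = (\<lambda>_. 0)"
  using sum_nonneg_eq_0_iff[of G "\<lambda>\<sigma>. w \<sigma> * w \<sigma>"] by (auto simp: nrm_def ip_def FS_def)

lemma nrm_pos: "w \<in> FS \<Longrightarrow> w \<noteq> (\<lambda>_. 0) \<Longrightarrow> 0 < nrm w"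
  using nrm_eq_0 nrm_nonneg less_eq_real_def by metis

lemma ip_square_le: "(ip v w)\<^sup>2 \<le> nrm v * nrm w"
  using Cauchy_Schwarz_ineq_sum[of v w G] by (simp add: nrm_def ip_def power2_eq_square)

lemma coord_square_le: "\<sigma> \<in> G \<Longrightarrow> (w \<sigma>)\<^sup>2 \<le> nrm w"
  unfolding nrm_def ip_def power2_eq_square[symmetric]
  by (rule member_le_sum) auto

lemma R_FS: "b \<in> G \<Longrightarrow> w \<in> FS \<Longrightarrow> R b w \<in> FS"
  by (simp add: FS_def G_comp_iff)

lemma linD:
  assumes "lin W"
  shows "W \<subseteq> FS" "(\<lambda>_. 0) \<in> W" "v \<in> W \<Longrightarrow> w \<in> W \<Longrightarrow> (\<lambda>\<sigma>. v \<sigma> + c * w \<sigma>) \<in> W"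
  using assms by (auto simp: lin_def)

lemma lin_scale: "lin W \<Longrightarrow> w \<in> W \<Longrightarrow> (\<lambda>\<sigma>. c * w \<sigma>) \<in> W"
  using linD(3)[of W "\<lambda>_. 0" w c] linD(2) by simp

lemma lin_sum:
  assumes "lin W" "finite I" "\<And>i. i \<in> I \<Longrightarrow> v i \<in> W"
  shows "(\<lambda>\<sigma>. \<Sum>i\<in>I. c i * v i \<sigma>) \<in> W"
  using assms(2,3)
proof (induction I)
  case empty
  then show ?case using linD(2)[OF assms(1)] by simp
next
  case (insert x I)
  then show ?case
    using linD(3)[OF assms(1), of "\<lambda>\<sigma>. \<Sum>i\<in>I. c i * v i \<sigma>" "v x" "c x"] by (simp add: add.commute)
qed

lemma rinvD:
  assumes "rinv H W"
  shows "lin W" "b \<in> H \<Longrightarrow> w \<in> W \<Longrightarrow> R b w \<in> W"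
  using assms by (auto simp: rinv_def)

lemma continuous_coord [continuous_intros]: "continuous_on S (\<lambda>w::(nat \<Rightarrow> nat) \<Rightarrow> real. w \<sigma>)"
  by (rule continuous_on_subset[OF continuous_on_product_coordinates]) simp

lemma closed_FS: "closed FS"
proof -
  have "FS = (\<Inter>\<sigma>\<in>- G. {w. w \<sigma> = 0})" by (auto simp: FS_def)
  also have "closed \<dots>"
    by (intro closed_INT ballI closed_Collect_eq continuous_intros)
  finally show ?thesis .
qed

text \<open>Tychonoff's theorem: the norm bound puts all coordinates into a box of radius
  \<open>\<bar>M\<bar> + 1\<close>, which exceeds the square root of \<open>M\<close>, and outside
  \<open>G\<close> the coordinates vanish.\<close>

lemma compact_bounded:
  assumes "closed K" "K \<subseteq> FS" "\<And>w. w \<in> K \<Longrightarrow> nrm w \<le> M"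
  shows "compact K"
proof -
  define B where "B = PiE UNIV (\<lambda>_::nat \<Rightarrow> nat. {- (\<bar>M\<bar> + 1)..\<bar>M\<bar> + 1 :: real})"
  have "compactin (product_topology (\<lambda>_. euclidean) UNIV) B"
    unfolding B_def by (subst compactin_PiE) simp
  then have "compact B" by (simp add: euclidean_product_topology)
  moreover have "K \<subseteq> B"
  proof
    fix w assume w: "w \<in> K"
    have "w \<sigma> \<in> {- (\<bar>M\<bar> + 1)..\<bar>M\<bar> + 1}" for \<sigma>
    proof (cases "\<sigma> \<in> G")
      case True
      have "(w \<sigma>)\<^sup>2 \<le> \<bar>M\<bar>" using coord_square_le[OF True, of w] assms(3)[OF w] by linarith
      also have "\<dots> \<le> (\<bar>M\<bar> + 1)\<^sup>2" by (simp add: power2_eq_square algebra_simps)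
      finally have "\<bar>w \<sigma>\<bar> \<le> \<bar>M\<bar> + 1" by (simp add: abs_le_square_iff[symmetric])
      then show ?thesis by auto
    next
      case False
      then show ?thesis using w assms(2) by (auto simp: FS_def)
    qed
    then show "w \<in> B" by (auto simp: B_def)
  qed
  ultimately show ?thesis using assms(1) by (metis compact_Int_closed inf.absorb_iff2)
qed

lemma continuous_nrm: "continuous_on S nrm"
  unfolding nrm_def ip_def by (intro continuous_intros)

text \<open>A nearest point exists by compactness, and the first-order condition at it is
  orthogonality.\<close>

lemma ex_projection:
  assumes W: "lin W" "closed W" and f: "f \<in> FS"
  shows "\<exists>p\<in>W. \<forall>v\<in>W. ip (\<lambda>\<sigma>. f \<sigma> - p \<sigma>) v = 0"
proof -
  \<comment> \<open>Vectors of \<open>W\<close> beyond this radius are no closer to \<open>f\<close>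
    than the zero vector, since \<open>nrm q \<le> 2 * F q + 2 * nrm f\<close>.\<close>
  define K where "K = {p \<in> W. nrm p \<le> 4 * nrm f}"
  define F where "F p = nrm (\<lambda>\<sigma>. f \<sigma> + (-1) * p \<sigma>)" for p
  have F: "F p = nrm f - 2 * ip f p + nrm p" for p
    unfolding F_def by (subst nrm_lin) simp
  have zero: "(\<lambda>_. 0) \<in> K" using linD(2)[OF W(1)] nrm_nonneg by (simp add: K_def nrm_def)
  have "closed {p. nrm p \<le> 4 * nrm f}"
    by (intro closed_Collect_le continuous_nrm continuous_intros)
  then have "closed K" unfolding K_def using W(2) by (simp add: Collect_conj_eq closed_Int)
  then have "compact K" using linD(1)[OF W(1)] by (intro compact_bounded[of _ "4 * nrm f"]) (auto simp: K_def)
  moreover have "continuous_on K F"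
    unfolding F_def nrm_def ip_def by (intro continuous_intros)
  ultimately obtain p where p: "p \<in> K" "\<And>q. q \<in> K \<Longrightarrow> F p \<le> F q"
    using continuous_attains_inf[of K F] zero by blast
  have pW: "p \<in> W" using p by (simp add: K_def)
  have min: "F p \<le> F q" if q: "q \<in> W" for q
  proof (cases "q \<in> K")
    case False
    then have "4 * nrm f < nrm q" using q by (simp add: K_def)
    moreover have "nrm q \<le> 2 * F q + 2 * nrm f"
      using F[of q] nrm_lin[of q "-2" f] nrm_nonneg[of "\<lambda>\<sigma>. q \<sigma> + -2 * f \<sigma>"] ip_comm[of f q] by simp
    moreover have "F p \<le> F (\<lambda>_. 0)" using p zero by blast
    moreover have "F (\<lambda>_. 0) = nrm f" by (simp add: F_def)
    ultimately show ?thesis using nrm_nonneg[of f] by linarith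
  qed (use p in auto)
  have "ip (\<lambda>\<sigma>. f \<sigma> - p \<sigma>) v = 0" if v: "v \<in> W" for v
  proof -
    have "0 \<le> 2 * t * (ip p v - ip f v) + t\<^sup>2 * nrm v" for t
    proof -
      have "F p \<le> F (\<lambda>\<sigma>. p \<sigma> + t * v \<sigma>)" using min linD(3)[OF W(1) pW v] by blast
      then show ?thesis unfolding F nrm_lin ip_lin2 by (simp add: algebra_simps)
    qed
    then have "ip p v - ip f v = 0" by (rule quadratic_nonneg_imp_linear_zero)
    then show ?thesis by (simp add: ip_diff)
  qed
  then show ?thesis using pW by blast
qed

text \<open>
  The minimisers of an invariant quadratic form relative to the norm form a right-invariant subspace.
  Hence the optimal constant \<open>lam\<close> can be read off from a single convenient element of \<open>W'\<close>.
\<close>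

lemma ex_extremal:
  assumes W: "rinv G W" "closed W" "w0 \<in> W" "w0 \<noteq> (\<lambda>_. 0)"
    and Q: "\<And>u v. Q u v = Q v u" "\<And>u v w c. Q (\<lambda>\<sigma>. u \<sigma> + c * v \<sigma>) w = Q u w + c * Q v w"
      "continuous_on UNIV (\<lambda>w. Q w w)" "\<And>b v w. b \<in> G \<Longrightarrow> Q (R b v) (R b w) = Q v w"
  shows "\<exists>lam W'. rinv G W' \<and> W' \<subseteq> W \<and> (\<exists>w\<in>W'. w \<noteq> (\<lambda>_. 0)) \<and>
    (\<forall>v\<in>W. lam * nrm v \<le> Q v v) \<and> (\<forall>w\<in>W'. Q w w = lam * nrm w)"
proof -
  note lW = rinvD(1)[OF W(1)]
  have Q2: "Q w (\<lambda>\<sigma>. u \<sigma> + c * v \<sigma>) = Q w u + c * Q w v" for u v w c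
    using Q(1,2) by metis
  have Q0: "Q (\<lambda>_. 0) w = 0" for w
    using Q(2)[of "\<lambda>_. 0" 1 "\<lambda>_. 0" w] by simp
  have Qs: "Q (\<lambda>\<sigma>. c * v \<sigma>) (\<lambda>\<sigma>. c * v \<sigma>) = c\<^sup>2 * Q v v" for c v
    using Q(2)[of "\<lambda>_. 0" c v] Q2[of _ "\<lambda>_. 0" c v] Q0 Q(1) by (simp add: power2_eq_square)
  have ns: "nrm (\<lambda>\<sigma>. c * v \<sigma>) = c\<^sup>2 * nrm v" for c v
    using nrm_lin[of "\<lambda>_. 0" c v] by (simp add: nrm_def)
  define S where "S = {w \<in> W. nrm w = 1}"
  have "closed {w. nrm w = 1}"
    by (intro closed_Collect_eq continuous_nrm continuous_intros)
  then have "closed S" unfolding S_def using W(2) by (simp add: Collect_conj_eq closed_Int)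
  then have cS: "compact S" using linD(1)[OF lW] by (intro compact_bounded[of _ 1]) (auto simp: S_def)
  have norm1: "(\<lambda>\<sigma>. 1 / sqrt (nrm v) * v \<sigma>) \<in> S" if "v \<in> W" "v \<noteq> (\<lambda>_. 0)" for v
  proof -
    have "0 < nrm v" using that linD(1)[OF lW] nrm_pos by blast
    then have "nrm (\<lambda>\<sigma>. 1 / sqrt (nrm v) * v \<sigma>) = 1" unfolding ns by (simp add: power_divide)
    then show ?thesis unfolding S_def using lin_scale[OF lW that(1), of "1 / sqrt (nrm v)"] by simp
  qed
  have "S \<noteq> {}" using norm1[OF W(3,4)] by blast
  moreover have "continuous_on S (\<lambda>w. Q w w)" using Q(3) continuous_on_subset by blast
  ultimately obtain w where w: "w \<in> S" "\<And>v. v \<in> S \<Longrightarrow> Q w w \<le> Q v v"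
    using continuous_attains_inf[OF cS] by blast
  define lam where "lam = Q w w"
  have low: "lam * nrm v \<le> Q v v" if v: "v \<in> W" for v
  proof (cases "v = (\<lambda>_. 0)")
    case True
    then show ?thesis using Q0 by (simp add: nrm_def)
  next
    case False
    have n0: "0 < nrm v" using v False linD(1)[OF lW] nrm_pos by blast
    have "lam \<le> Q v v / nrm v"
      using w(2)[OF norm1[OF v False]] n0 unfolding Qs lam_def by (simp add: power_divide)
    then show ?thesis using n0 by (simp add: pos_le_divide_eq)
  qed
  have wW: "w \<in> W" "nrm w = 1" using w by (auto simp: S_def)
  \<comment> \<open>Minimality is replaced by the eigenvector equation tested against
    \<open>W\<close>. It is linear in \<open>u\<close>, so it defines a subspace at once; the
    minimiser satisfies it because the first variation vanishes.\<close>
  define W' where "W' = {u \<in> W. \<forall>v\<in>W. Q u v = lam * ip u v}"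
  have "Q w v = lam * ip w v" if v: "v \<in> W" for v
  proof -
    have "0 \<le> 2 * t * (Q w v - lam * ip w v) + t\<^sup>2 * (Q v v - lam * nrm v)" for t
    proof -
      have "lam * nrm (\<lambda>\<sigma>. w \<sigma> + t * v \<sigma>) \<le> Q (\<lambda>\<sigma>. w \<sigma> + t * v \<sigma>) (\<lambda>\<sigma>. w \<sigma> + t * v \<sigma>)"
        using low linD(3)[OF lW wW(1) v] by blast
      then show ?thesis unfolding nrm_lin Q(2) Q2 using wW Q(1)[of v w]
        by (simp add: lam_def power2_eq_square algebra_simps)
    qed
    then have "Q w v - lam * ip w v = 0" by (rule quadratic_nonneg_imp_linear_zero)
    then show ?thesis by simp
  qed
  then have wW': "w \<in> W'" using wW by (simp add: W'_def)
  have "w \<noteq> (\<lambda>_. 0)" using wW(2) by (auto simp: nrm_def)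
  moreover have "lin W'"
    unfolding lin_def
  proof (intro conjI ballI allI)
    show "W' \<subseteq> FS" using linD(1)[OF lW] by (auto simp: W'_def)
    show "(\<lambda>_. 0) \<in> W'" using linD(2)[OF lW] Q0 by (simp add: W'_def)
    show "(\<lambda>\<sigma>. u \<sigma> + c * v \<sigma>) \<in> W'" if "u \<in> W'" "v \<in> W'" for u v c
      using that linD(3)[OF lW] by (simp add: W'_def Q(2) ip_lin distrib_left)
  qed
  moreover have "R b u \<in> W'" if b: "b \<in> G" and u: "u \<in> W'" for b u
  proof -
    have "Q (R b u) v = lam * ip (R b u) v" if v: "v \<in> W" for v
    proof -
      define v' where "v' = R (inv' b) v"
      have v': "v' \<in> W" "R b v' = v" using rinvD(2)[OF W(1)] v b by (auto simp: v'_def R_R)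
      have "Q (R b u) (R b v') = lam * ip (R b u) (R b v')"
        unfolding Q(4)[OF b] ip_R[OF b] using u v'(1) by (simp add: W'_def)
      then show ?thesis unfolding v'(2) .
    qed
    then show ?thesis using rinvD(2)[OF W(1) b] u by (simp add: W'_def)
  qed
  ultimately have "rinv G W'" "\<exists>w\<in>W'. w \<noteq> (\<lambda>_. 0)" using wW' by (auto simp: rinv_def)
  moreover have "W' \<subseteq> W" by (auto simp: W'_def)
  moreover have "\<forall>w\<in>W'. Q w w = lam * nrm w" by (auto simp: W'_def nrm_def)
  ultimately show ?thesis using low by blast
qed

section \<open>Levels\<close>

definition Lev_ge :: "nat \<Rightarrow> ((nat \<Rightarrow> nat) \<Rightarrow> real) set" where
  "Lev_ge d = {w \<in> FS. \<forall>D\<subseteq>{1..n}. card D = d \<longrightarrow> (\<forall>\<rho>\<in>G. (\<Sum>\<sigma>\<in>agr D \<rho>. w \<sigma>) = 0)}"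

text \<open>\<open>Lev_ge d\<close> collects the levels above \<open>d\<close>, so \<open>Lev_eq d\<close> is level \<open>Suc d\<close>.\<close>

definition Lev_eq :: "nat \<Rightarrow> ((nat \<Rightarrow> nat) \<Rightarrow> real) set" where
  "Lev_eq d = {w \<in> Lev_ge d. \<forall>v\<in>Lev_ge (Suc d). ip w v = 0}"

lemma lin_Lev_ge: "lin (Lev_ge d)"
  unfolding lin_def Lev_ge_def FS_def
  by (auto simp: sum.distrib simp flip: sum_distrib_left)

lemma rinv_Lev_ge: "rinv G (Lev_ge d)"
  unfolding rinv_def
proof (intro conjI lin_Lev_ge ballI)
  fix b w assume b: "b \<in> G" and w: "w \<in> Lev_ge d"
  have "(\<Sum>\<sigma>\<in>agr D \<rho>. R b w \<sigma>) = 0" if D: "D \<subseteq> {1..n}" "card D = d" "\<rho> \<in> G" for D \<rho>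
  proof -
    define E where "E = inv' b ` D"
    have bE: "b ` E = D" using b by (force simp: E_def image_image)
    have "E \<subseteq> {1..n}" using G_in[OF G_inv[OF b]] D by (auto simp: E_def)
    moreover have "card E = d" unfolding E_def using D G_inj[OF G_inv[OF b]]
      by (metis card_image inj_on_subset subset_UNIV)
    moreover have "\<rho> \<circ> b \<in> G" using D b by blast
    ultimately have "(\<Sum>\<sigma>\<in>agr E (\<rho> \<circ> b). w \<sigma>) = 0" using w unfolding Lev_ge_def by blast
    moreover have "(\<Sum>\<sigma>\<in>agr (b ` E) \<rho>. w (\<sigma> \<circ> b)) = (\<Sum>\<sigma>\<in>agr E (\<rho> \<circ> b). w \<sigma>)"
      using sum.reindex_bij_betw[OF bij_agr_right[OF b], of w E \<rho>] .
    ultimately show ?thesis unfolding bE by simp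
  qed
  then show "R b w \<in> Lev_ge d" using w b R_FS by (auto simp: Lev_ge_def)
qed

lemma closed_Lev_ge: "closed (Lev_ge d)"
proof -
  have "Lev_ge d = FS \<inter> (\<Inter>D\<in>{D. D \<subseteq> {1..n} \<and> card D = d}. \<Inter>\<rho>\<in>G. {w. (\<Sum>\<sigma>\<in>agr D \<rho>. w \<sigma>) = 0})"
    by (auto simp: Lev_ge_def)
  also have "closed \<dots>"
    by (intro closed_Int closed_FS closed_INT ballI closed_Collect_eq continuous_intros)
  finally show ?thesis .
qed

text \<open>A coset fixing the values on \<open>D\<close> is the disjoint union of the cosets fixing
  one more value; the hypothesis ensures that there is another point.\<close>

lemma Lev_ge_Suc:
  assumes "Suc d \<le> n"
  shows "Lev_ge (Suc d) \<subseteq> Lev_ge d"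
proof (rule subsetI)
  fix w assume w: "w \<in> Lev_ge (Suc d)"
  have "(\<Sum>\<sigma>\<in>agr D \<rho>. w \<sigma>) = 0" if D: "D \<subseteq> {1..n}" "card D = d" "\<rho> \<in> G" for D \<rho>
  proof -
    have finD: "finite D" using D finite_subset by blast
    have "D \<noteq> {1..n}" using D assms by auto
    then obtain x where x: "x \<in> {1..n}" "x \<notin> D" using D by blast
    have "card (agr (insert x D) id) * (\<Sum>\<tau>\<in>agr D \<rho>. w \<tau>) =
      (\<Sum>\<sigma>\<in>agr D \<rho>. \<Sum>\<tau>\<in>agr (insert x D) \<sigma>. w \<tau>)"
      by (rule sum_agr_tower[symmetric]) (use D in auto)
    also have "\<dots> = 0"
    proof (rule sum.neutral, rule ballI)
      fix \<sigma> assume "\<sigma> \<in> agr D \<rho>"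
      then show "(\<Sum>\<tau>\<in>agr (insert x D) \<sigma>. w \<tau>) = 0"
        using w x D finD agr_G by (auto simp: Lev_ge_def)
    qed
    finally show ?thesis using card_agr_pos[OF G_id, of "insert x D"] by auto
  qed
  then show "w \<in> Lev_ge d" using w by (auto simp: Lev_ge_def)
qed

lemma Lev_ge_antimono: "d \<le> e \<Longrightarrow> e \<le> n \<Longrightarrow> Lev_ge e \<subseteq> Lev_ge d"
proof (induction e rule: dec_induct)
  case (step k)
  then show ?case using Lev_ge_Suc[of k] by auto
qed simp

lemma rinv_Lev_eq: "rinv G (Lev_eq d)"
  unfolding rinv_def
proof (intro conjI ballI)
  show "lin (Lev_eq d)"
    using lin_Lev_ge[of d] unfolding lin_def Lev_eq_def by (auto simp: ip_lin)
  show "R b w \<in> Lev_eq d" if b: "b \<in> G" and w: "w \<in> Lev_eq d" for b w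
  proof -
    have "ip (R b w) v = 0" if "v \<in> Lev_ge (Suc d)" for v
      using w rinvD(2)[OF rinv_Lev_ge G_inv[OF b] that] by (simp add: ip_R_adj[OF b] Lev_eq_def)
    then show ?thesis using w rinvD(2)[OF rinv_Lev_ge b] by (auto simp: Lev_eq_def)
  qed
qed

lemma closed_Lev_eq: "closed (Lev_eq d)"
proof -
  have "Lev_eq d = Lev_ge d \<inter> (\<Inter>v\<in>Lev_ge (Suc d). {w. ip w v = 0})" by (auto simp: Lev_eq_def)
  also have "closed \<dots>" unfolding ip_def
    by (intro closed_Int closed_Lev_ge closed_INT ballI closed_Collect_eq continuous_intros)
  finally show ?thesis .
qed

lemma Lev_eq_FS: "Lev_eq d \<subseteq> FS"
  by (auto simp: Lev_eq_def Lev_ge_def)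

lemma sum_agr_R: "\<sigma> \<in> G \<Longrightarrow> (\<Sum>\<tau>\<in>agr D \<sigma>. w \<tau>) = (\<Sum>b\<in>agr D id. R b w \<sigma>)"
  using sum.reindex_bij_betw[OF bij_agr_left[of \<sigma> D id], of w] by simp

text \<open>A nonzero \<open>w\<close> of this level has a nonzero sum over some coset with
  \<open>Suc d\<close> prescribed values. Summing its right translates over the pointwise stabiliser
  of \<open>D\<close> stays in \<open>W\<close> and gives the function of these coset sums.\<close>

lemma ex_junta:
  assumes W: "rinv G W" "W \<subseteq> Lev_eq d" and w: "w \<in> W" "w \<noteq> (\<lambda>_. 0)"
  shows "\<exists>D u. D \<subseteq> {1..n} \<and> card D = Suc d \<and> u \<in> W \<and> u \<noteq> (\<lambda>_. 0) \<and> (\<forall>\<sigma>\<in>G. \<forall>\<tau>\<in>agr D \<sigma>. u \<tau> = u \<sigma>)"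
proof -
  have wV: "w \<in> Lev_eq d" using W w by blast
  then have "w \<in> FS" using Lev_eq_FS by blast
  have "w \<notin> Lev_ge (Suc d)"
  proof
    assume "w \<in> Lev_ge (Suc d)"
    then have "nrm w = 0" using wV by (simp add: Lev_eq_def nrm_def)
    then show False using nrm_eq_0[OF \<open>w \<in> FS\<close>] w by simp
  qed
  then obtain D \<rho> where D: "D \<subseteq> {1..n}" "card D = Suc d" "\<rho> \<in> G" "(\<Sum>\<sigma>\<in>agr D \<rho>. w \<sigma>) \<noteq> 0"
    using \<open>w \<in> FS\<close> by (auto simp: Lev_ge_def)
  define u where "u = (\<lambda>\<sigma>. \<Sum>b\<in>agr D id. 1 * R b w \<sigma>)"
  have u: "u \<sigma> = (\<Sum>\<tau>\<in>agr D \<sigma>. w \<tau>)" if "\<sigma> \<in> G" for \<sigma>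
    using sum_agr_R[OF that, of w D] by (simp add: u_def)
  have "u \<in> W" unfolding u_def
    by (rule lin_sum[OF rinvD(1)[OF W(1)], where v = "\<lambda>b. R b w" and c = "\<lambda>_. 1"])
      (use rinvD(2)[OF W(1)] w agr_G in \<open>auto simp del: R_apply\<close>)
  moreover have "u \<rho> \<noteq> 0" using u D by simp
  moreover have "u \<tau> = u \<sigma>" if "\<sigma> \<in> G" "\<tau> \<in> agr D \<sigma>" for \<sigma> \<tau>
    using u that agr_eq agr_G by metis
  ultimately show ?thesis using D by (intro exI[of _ D] exI[of _ u]) auto
qed

end

text \<open>The \<open>E x\<close> are the classes of an equivalence relation, and the double sum
  equals the sum over classes of the square of the total of \<open>u\<close>.\<close>

lemma sum_classes_square:
  fixes u :: "'a \<Rightarrow> real"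
  assumes fin: "finite X" and E: "\<And>x. x \<in> X \<Longrightarrow> E x \<subseteq> X" "\<And>x. x \<in> X \<Longrightarrow> x \<in> E x"
    "\<And>x y. x \<in> X \<Longrightarrow> y \<in> E x \<Longrightarrow> E y = E x"
  shows "0 \<le> (\<Sum>x\<in>X. u x * (\<Sum>y\<in>E x. u y))"
proof -
  define s where "s x = (\<Sum>y\<in>E x. u y)" for x
  have finE: "finite (E x)" if "x \<in> X" for x using E(1)[OF that] fin finite_subset by blast
  have sym: "y \<in> X \<and> x \<in> E y \<longleftrightarrow> y \<in> E x" if "x \<in> X" for x y
    using E that by (metis subsetD)
  have "(\<Sum>x\<in>X. s x * s x / card (E x)) = (\<Sum>x\<in>X. \<Sum>y | y \<in> X \<and> y \<in> E x. u y * s x / card (E x))"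
  proof (rule sum.cong)
    fix x assume x: "x \<in> X"
    have "{y. y \<in> X \<and> y \<in> E x} = E x" using E(1)[OF x] by auto
    then show "s x * s x / card (E x) = (\<Sum>y | y \<in> X \<and> y \<in> E x. u y * s x / card (E x))"
      by (simp add: s_def[of x] sum_distrib_right sum_divide_distrib)
  qed simp
  also have "\<dots> = (\<Sum>y\<in>X. \<Sum>x | x \<in> X \<and> y \<in> E x. u y * s x / card (E x))"
    by (rule sum.swap_restrict[OF fin fin])
  also have "\<dots> = (\<Sum>y\<in>X. u y * s y)"
  proof (rule sum.cong)
    fix y assume y: "y \<in> X"
    have eq: "{x. x \<in> X \<and> y \<in> E x} = E y" using sym[OF y] by auto
    have "(\<Sum>x\<in>E y. u y * s x / card (E x)) = (\<Sum>x\<in>E y. u y * s y / card (E y))"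
      using E(3)[OF y] by (intro sum.cong) (auto simp: s_def)
    also have "\<dots> = u y * s y"
      using finE[OF y] E(2)[OF y] by (auto simp: card_gt_0_iff)
    finally show "(\<Sum>x | x \<in> X \<and> y \<in> E x. u y * s x / card (E x)) = u y * s y" unfolding eq .
  qed simp
  finally have "(\<Sum>x\<in>X. u x * s x) = (\<Sum>x\<in>X. s x * s x / card (E x))" ..
  also have "0 \<le> \<dots>" by (intro sum_nonneg) auto
  finally show ?thesis by (simp add: s_def)
qed

section \<open>Correlation of a junta with its translates\<close>

context alt_pairs begin

text \<open>Double counting, as in \<open>sum_agr_tower\<close>, but for an arbitrary union of
  cosets; the sets used in \<open>positivity\<close> are not single cosets.\<close>

lemma sum_closed_classes:
  assumes "B \<subseteq> G" "\<And>\<tau>. \<tau> \<in> B \<Longrightarrow> agr E \<tau> \<subseteq> B"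
  shows "(\<Sum>\<sigma>\<in>B. \<Sum>\<tau>\<in>agr E \<sigma>. f \<tau>) = card (agr E id) * (\<Sum>\<tau>\<in>B. f \<tau> :: real)"
proof -
  have fin: "finite B" using assms(1) finite_G finite_subset by blast
  have eq: "agr E \<sigma> = {\<tau>. \<tau> \<in> B \<and> (\<forall>x\<in>E. \<tau> x = \<sigma> x)}" "agr E \<sigma> = {\<tau>. \<tau> \<in> B \<and> (\<forall>x\<in>E. \<sigma> x = \<tau> x)}"
    if "\<sigma> \<in> B" for \<sigma>
    using assms(1) assms(2)[OF that] that by (auto simp: agr_def)
  have "(\<Sum>\<sigma>\<in>B. \<Sum>\<tau>\<in>agr E \<sigma>. f \<tau>) = (\<Sum>\<sigma>\<in>B. \<Sum>\<tau> | \<tau> \<in> B \<and> (\<forall>x\<in>E. \<tau> x = \<sigma> x). f \<tau>)"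
    by (intro sum.cong refl eq)
  also have "\<dots> = (\<Sum>\<tau>\<in>B. \<Sum>\<sigma> | \<sigma> \<in> B \<and> (\<forall>x\<in>E. \<tau> x = \<sigma> x). f \<tau>)"
    by (rule sum.swap_restrict[OF fin fin])
  also have "\<dots> = (\<Sum>\<tau>\<in>B. \<Sum>\<sigma>\<in>agr E \<tau>. f \<tau>)"
    by (intro sum.cong refl eq(2)[symmetric])
  also have "\<dots> = (\<Sum>\<tau>\<in>B. card (agr E id) * f \<tau>)"
  proof (rule sum.cong)
    fix \<tau> assume "\<tau> \<in> B"
    then have "card (agr E \<tau>) = card (agr E id)" using assms(1) by (intro card_agr_eq) auto
    then show "(\<Sum>\<sigma>\<in>agr E \<tau>. f \<tau>) = card (agr E id) * f \<tau>" by simp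
  qed simp
  finally show ?thesis by (simp add: sum_distrib_left)
qed

text \<open>
  For fixed \<open>\<sigma>\<close>, moving a single point of \<open>D1\<close> between the values in \<open>\<sigma> ` D1\<close> and the values
  outside it changes the sign of the sum of \<open>u\<close>. So the sum over all \<open>\<tau>\<close> with \<open>\<tau> ` D1\<close> disjoint
  from \<open>\<sigma> ` D1\<close> equals, up to sign, the sum over all \<open>\<tau>\<close> with the same image, and the latter gives a
  sum of squares.
\<close>

lemma positivity:
  assumes D: "D \<subseteq> {1..n}" "D1 \<subseteq> D" and h: "h \<in> G" "\<And>x. x \<in> D - D1 \<Longrightarrow> h x = x" "h ` D1 \<inter> D = {}"
    and n: "card D + card D1 + 2 \<le> n"
    and dep: "\<And>\<sigma> \<tau>. \<sigma> \<in> G \<Longrightarrow> \<tau> \<in> agr D \<sigma> \<Longrightarrow> u \<tau> = u \<sigma>"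
    and harm: "\<And>x \<rho>. x \<in> D1 \<Longrightarrow> \<rho> \<in> G \<Longrightarrow> (\<Sum>\<sigma>\<in>agr (D - {x}) \<rho>. u \<sigma>) = 0"
  shows "0 \<le> (-1) ^ card D1 * ip u (R h u)"
proof -
  define D2 where "D2 = D - D1"
  have finD: "finite D" using D finite_subset by blast
  have fin1: "finite D1" using D finD finite_subset by blast
  define B where "B \<sigma> Q = {\<tau> \<in> agr D2 \<sigma>. \<forall>x\<in>D1. \<tau> x \<in> \<sigma> ` D1 \<longleftrightarrow> x \<in> Q}" for \<sigma> Q
  define X where "X \<sigma> Q = (\<Sum>\<tau>\<in>B \<sigma> Q. u \<tau>)" for \<sigma> Q
  define k where "k E = real (card (agr E id))" for E
  have kpos: "0 < k E" for E using card_agr_pos[OF G_id, of E] by (simp add: k_def)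
  have finB: "finite (B \<sigma> Q)" for \<sigma> Q unfolding B_def by simp
  \<comment> \<open>Dropping the condition on \<open>x\<close> merges the two cases. The merged set
    is a union of cosets with the values on \<open>D - {x}\<close> prescribed, and \<open>u\<close>
    sums to zero over each of them.\<close>
  have step: "X \<sigma> Q + X \<sigma> (insert x Q) = 0" if \<sigma>: "\<sigma> \<in> G" and x: "x \<in> D1" "x \<notin> Q" for \<sigma> Q x
  proof -
    define C where "C = {\<tau> \<in> agr D2 \<sigma>. \<forall>y\<in>D1 - {x}. \<tau> y \<in> \<sigma> ` D1 \<longleftrightarrow> y \<in> Q}"
    have "C = B \<sigma> Q \<union> B \<sigma> (insert x Q)" "B \<sigma> Q \<inter> B \<sigma> (insert x Q) = {}"
      using x by (auto simp: C_def B_def)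
    then have "X \<sigma> Q + X \<sigma> (insert x Q) = (\<Sum>\<tau>\<in>C. u \<tau>)"
      unfolding X_def using finB by (simp add: sum.union_disjoint)
    moreover have "k (D - {x}) * (\<Sum>\<tau>\<in>C. u \<tau>) = (\<Sum>\<tau>\<in>C. \<Sum>\<tau>'\<in>agr (D - {x}) \<tau>. u \<tau>')"
      unfolding k_def
    proof (rule sum_closed_classes[symmetric])
      show "C \<subseteq> G" by (auto simp: C_def agr_def)
      show "agr (D - {x}) \<tau> \<subseteq> C" if \<tau>: "\<tau> \<in> C" for \<tau>
      proof
        fix \<tau>' assume t: "\<tau>' \<in> agr (D - {x}) \<tau>"
        then have e: "\<tau>' y = \<tau> y" if "y \<in> D2 \<union> (D1 - {x})" for y
          using that D x by (auto simp: agr_def D2_def)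
        have "\<tau>' \<in> agr D2 \<sigma>" using t e \<tau> by (simp add: C_def agr_def)
        moreover have "\<tau>' y \<in> \<sigma> ` D1 \<longleftrightarrow> y \<in> Q" if "y \<in> D1 - {x}" for y
          using e[of y] that \<tau> by (simp add: C_def)
        ultimately show "\<tau>' \<in> C" by (simp add: C_def)
      qed
    qed
    moreover have "\<dots> = 0"
      using harm x by (intro sum.neutral ballI harm) (auto simp: C_def agr_def)
    ultimately show ?thesis using kpos[of "D - {x}"] by auto
  qed
  have XQ: "X \<sigma> {} = (-1) ^ card Q * X \<sigma> Q" if \<sigma>: "\<sigma> \<in> G" and Q: "Q \<subseteq> D1" for \<sigma> Q
  proof -
    have "finite Q" using Q fin1 finite_subset by blast
    then show ?thesis using Q
    proof (induction Q)
      case (insert x Q)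
      then have "X \<sigma> Q = - X \<sigma> (insert x Q)" using step[OF \<sigma>, of x Q] by auto
      then show ?case using insert by simp
    qed simp
  qed
  have k2: "k (D \<union> h ` D1) * X \<sigma> {} = k D * (\<Sum>\<tau>\<in>agr D \<sigma>. u (\<tau> \<circ> h))" if \<sigma>: "\<sigma> \<in> G" for \<sigma>
  proof -
    have inB: "agr D (\<tau> \<circ> h) \<subseteq> B \<sigma> {}" if "\<tau> \<in> agr D \<sigma>" for \<tau>
    proof
      fix \<upsilon> assume \<upsilon>: "\<upsilon> \<in> agr D (\<tau> \<circ> h)"
      have \<tau>: "\<tau> \<in> G" "\<And>x. x \<in> D \<Longrightarrow> \<tau> x = \<sigma> x" using that by (auto simp: agr_def)
      have v: "\<upsilon> \<in> G" "\<And>x. x \<in> D \<Longrightarrow> \<upsilon> x = \<tau> (h x)" using \<upsilon> by (auto simp: agr_def)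
      have "\<upsilon> x = \<sigma> x" if "x \<in> D2" for x using that v(2)[of x] h(2)[of x] \<tau>(2)[of x] by (simp add: D2_def)
      moreover have "\<upsilon> x \<notin> \<sigma> ` D1" if x: "x \<in> D1" for x
      proof
        assume "\<upsilon> x \<in> \<sigma> ` D1"
        then obtain y where y: "y \<in> D1" "\<tau> (h x) = \<sigma> y" using v(2)[of x] x D by auto
        then have "\<tau> (h x) = \<tau> y" using \<tau>(2)[of y] D by auto
        then have "h x = y" using G_inj[OF \<tau>(1)] by (simp add: inj_eq)
        then show False using y x h(3) D by auto
      qed
      ultimately show "\<upsilon> \<in> B \<sigma> {}" using v(1) by (simp add: B_def agr_def)
    qed
    \<comment> \<open>For given \<open>\<upsilon>\<close> the admissible \<open>\<tau>\<close> have
      prescribed values on \<open>D\<close> (from \<open>\<sigma>\<close>) and on \<open>h\<close>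
      D1\<open>(from\<close>\<upsilon>\<open>). These values are compatible because\<close>\<upsilon>\<open>avoids\<close>\<sigma>
      \<open>D\<close> on \<open>D1\<close>, so the \<open>\<tau>\<close> form one coset.\<close>
    have cardM: "real (card {\<tau>. \<tau> \<in> agr D \<sigma> \<and> \<upsilon> \<in> agr D (\<tau> \<circ> h)}) = k (D \<union> h ` D1)" if \<upsilon>: "\<upsilon> \<in> B \<sigma> {}" for \<upsilon>
    proof -
      have v: "\<upsilon> \<in> G" "\<And>x. x \<in> D2 \<Longrightarrow> \<upsilon> x = \<sigma> x" "\<And>x. x \<in> D1 \<Longrightarrow> \<upsilon> x \<notin> \<sigma> ` D1"
        using \<upsilon> by (auto simp: B_def agr_def)
      define g where "g x = (if x \<in> D then \<sigma> x else \<upsilon> (inv' h x))" for x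
      have gh: "g (h x) = \<upsilon> x" if "x \<in> D1" for x using that h by (auto simp: g_def)
      have cross: "\<upsilon> x \<noteq> \<sigma> y" if "x \<in> D1" "y \<in> D" for x y
      proof (cases "y \<in> D1")
        case False
        then have y2: "y \<in> D2" using that by (simp add: D2_def)
        then have "\<upsilon> x \<noteq> \<upsilon> y" using G_inj[OF v(1)] that False by (auto simp: inj_eq)
        then show ?thesis using v(2)[OF y2] by simp
      qed (use v(3)[OF that(1)] in auto)
      have "inj_on g (D \<union> h ` D1)"
      proof (rule inj_onI)
        fix x y assume xy: "x \<in> D \<union> h ` D1" "y \<in> D \<union> h ` D1" "g x = g y"
        show "x = y"
        proof (cases "x \<in> D")
          case True
          then have gx: "g x = \<sigma> x" by (simp add: g_def)
          show ?thesis
          proof (cases "y \<in> D")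
            case True
            then show ?thesis using gx xy(3) G_inj[OF \<sigma>] by (simp add: g_def inj_eq)
          next
            case False
            then obtain y' where "y' \<in> D1" "y = h y'" using xy by auto
            then show ?thesis using gx xy(3) gh cross[of y' x] True by auto
          qed
        next
          case False
          then obtain x' where x': "x' \<in> D1" "x = h x'" using xy by auto
          show ?thesis
          proof (cases "y \<in> D")
            case True
            then have "g y = \<sigma> y" by (simp add: g_def)
            then show ?thesis using x' xy(3) gh cross[of x' y] True by auto
          next
            case False
            then obtain y' where "y' \<in> D1" "y = h y'" using xy by auto
            then show ?thesis using x' xy(3) gh G_inj[OF v(1)] by (simp add: inj_eq)
          qed
        qed
      qed
      moreover have hD: "D \<union> h ` D1 \<subseteq> {1..n}" using D G_in[OF h(1)] by auto
      moreover have "g ` (D \<union> h ` D1) \<subseteq> {1..n}"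
      proof -
        have "\<sigma> x \<in> {1..n}" if "x \<in> D" for x using G_in[OF \<sigma>] that D by blast
        moreover have "\<upsilon> x \<in> {1..n}" if "x \<in> D1" for x using G_in[OF v(1)] that D by blast
        moreover have "g x = \<sigma> x" if "x \<in> D" for x using that by (simp add: g_def)
        ultimately show ?thesis using gh by fastforce
      qed
      moreover have "card (D \<union> h ` D1) + 2 \<le> n"
        using card_Un_le[of D "h ` D1"] card_image_le[OF fin1, of h] n by linarith
      ultimately obtain \<rho> where \<rho>: "\<rho> \<in> G" "\<And>x. x \<in> D \<union> h ` D1 \<Longrightarrow> \<rho> x = g x"
        using extend_to_G by metis
      have "{\<tau>. \<tau> \<in> agr D \<sigma> \<and> \<upsilon> \<in> agr D (\<tau> \<circ> h)} = agr (D \<union> h ` D1) \<rho>"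
      proof (intro equalityI subsetI)
        fix \<tau> assume "\<tau> \<in> {\<tau>. \<tau> \<in> agr D \<sigma> \<and> \<upsilon> \<in> agr D (\<tau> \<circ> h)}"
        then have t: "\<tau> \<in> G" "\<And>x. x \<in> D \<Longrightarrow> \<tau> x = \<sigma> x" "\<And>x. x \<in> D \<Longrightarrow> \<upsilon> x = \<tau> (h x)" by (auto simp: agr_def)
        have "\<tau> x = \<rho> x" if x: "x \<in> D \<union> h ` D1" for x
        proof (cases "x \<in> D")
          case True
          then show ?thesis using t(2) \<rho>(2)[OF x] by (simp add: g_def)
        next
          case False
          then obtain x' where x': "x' \<in> D1" "x = h x'" using x by auto
          then have "x' \<in> D" using D by blast
          then show ?thesis using x' t(3)[of x'] \<rho>(2)[OF x] gh by simp
        qed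
        then show "\<tau> \<in> agr (D \<union> h ` D1) \<rho>" using t(1) by (simp add: agr_def)
      next
        fix \<tau> assume "\<tau> \<in> agr (D \<union> h ` D1) \<rho>"
        then have t: "\<tau> \<in> G" "\<And>x. x \<in> D \<union> h ` D1 \<Longrightarrow> \<tau> x = g x" using \<rho>(2) by (auto simp: agr_def)
        have t1: "\<tau> x = \<sigma> x" if "x \<in> D" for x using t(2)[of x] that by (simp add: g_def)
        have "\<upsilon> x = \<tau> (h x)" if x: "x \<in> D" for x
        proof (cases "x \<in> D1")
          case True
          then show ?thesis using t(2)[of "h x"] gh by simp
        next
          case False
          then show ?thesis using x h(2)[of x] v(2)[of x] t1[OF x] by (simp add: D2_def)
        qed
        then show "\<tau> \<in> {\<tau>. \<tau> \<in> agr D \<sigma> \<and> \<upsilon> \<in> agr D (\<tau> \<circ> h)}"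
          using t(1) t1 v(1) by (simp add: agr_def)
      qed
      then show ?thesis using card_agr_eq[OF \<rho>(1) G_id] by (simp add: k_def)
    qed
    have "k (D \<union> h ` D1) * X \<sigma> {} = (\<Sum>\<upsilon>\<in>B \<sigma> {}. k (D \<union> h ` D1) * u \<upsilon>)"
      by (simp add: X_def sum_distrib_left)
    also have "\<dots> = (\<Sum>\<upsilon>\<in>B \<sigma> {}. \<Sum>\<tau> | \<tau> \<in> agr D \<sigma> \<and> \<upsilon> \<in> agr D (\<tau> \<circ> h). u \<upsilon>)"
      by (intro sum.cong refl) (simp add: cardM[symmetric])
    also have "\<dots> = (\<Sum>\<tau>\<in>agr D \<sigma>. \<Sum>\<upsilon> | \<upsilon> \<in> B \<sigma> {} \<and> \<upsilon> \<in> agr D (\<tau> \<circ> h). u \<upsilon>)"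
      by (rule sum.swap_restrict[OF finB finite_agr])
    also have "\<dots> = (\<Sum>\<tau>\<in>agr D \<sigma>. k D * u (\<tau> \<circ> h))"
    proof (rule sum.cong)
      fix \<tau> assume \<tau>: "\<tau> \<in> agr D \<sigma>"
      have th: "\<tau> \<circ> h \<in> G" using \<tau> h agr_G by blast
      have "{\<upsilon>. \<upsilon> \<in> B \<sigma> {} \<and> \<upsilon> \<in> agr D (\<tau> \<circ> h)} = agr D (\<tau> \<circ> h)" using inB[OF \<tau>] by auto
      then have "(\<Sum>\<upsilon> | \<upsilon> \<in> B \<sigma> {} \<and> \<upsilon> \<in> agr D (\<tau> \<circ> h). u \<upsilon>) = (\<Sum>\<upsilon>\<in>agr D (\<tau> \<circ> h). u (\<tau> \<circ> h))"
        using dep[OF th] by (intro sum.cong) auto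
      then show "(\<Sum>\<upsilon> | \<upsilon> \<in> B \<sigma> {} \<and> \<upsilon> \<in> agr D (\<tau> \<circ> h). u \<upsilon>) = k D * u (\<tau> \<circ> h)"
        using card_agr_eq[OF th G_id] by (simp add: k_def)
    qed simp
    finally show ?thesis by (simp add: sum_distrib_left)
  qed
  have "k D * k D * ip u (R h u) = k D * (\<Sum>\<sigma>\<in>G. \<Sum>\<tau>\<in>agr D \<sigma>. u \<tau> * u (\<tau> \<circ> h))"
    using sum_agr_tower[OF G_id empty_subsetI, of "\<lambda>\<tau>. u \<tau> * u (\<tau> \<circ> h)" D] by (simp add: ip_def k_def)
  also have "\<dots> = (\<Sum>\<sigma>\<in>G. u \<sigma> * (k D * (\<Sum>\<tau>\<in>agr D \<sigma>. u (\<tau> \<circ> h))))"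
    unfolding sum_distrib_left by (intro sum.cong refl) (simp add: dep)
  also have "\<dots> = (\<Sum>\<sigma>\<in>G. u \<sigma> * (k (D \<union> h ` D1) * ((-1) ^ card D1 * X \<sigma> D1)))"
    by (intro sum.cong refl) (simp add: k2[symmetric] XQ[of _ D1])
  also have "\<dots> = k (D \<union> h ` D1) * ((-1) ^ card D1 * (\<Sum>\<sigma>\<in>G. u \<sigma> * X \<sigma> D1))"
    unfolding sum_distrib_left by (intro sum.cong refl) simp
  finally have eq: "k D * k D * ip u (R h u) = k (D \<union> h ` D1) * ((-1) ^ card D1 * (\<Sum>\<sigma>\<in>G. u \<sigma> * X \<sigma> D1))" .
  \<comment> \<open>With \<open>Q = D1\<close> the sets \<open>B \<sigma> D1\<close> are equivalence
    classes: same values on \<open>D2\<close> and same image of \<open>D1\<close>.\<close>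
  have "0 \<le> (\<Sum>\<sigma>\<in>G. u \<sigma> * X \<sigma> D1)"
    unfolding X_def
  proof (rule sum_classes_square)
    fix \<sigma> \<tau> assume \<sigma>: "\<sigma> \<in> G" and \<tau>: "\<tau> \<in> B \<sigma> D1"
    have t: "\<tau> \<in> G" "\<And>x. x \<in> D2 \<Longrightarrow> \<tau> x = \<sigma> x" "\<tau> ` D1 \<subseteq> \<sigma> ` D1" using \<tau> by (auto simp: B_def agr_def)
    have "\<tau> ` D1 = \<sigma> ` D1"
    proof (rule card_subset_eq)
      show "card (\<tau> ` D1) = card (\<sigma> ` D1)"
        using G_inj[OF \<sigma>] G_inj[OF t(1)] by (metis card_image inj_on_subset subset_UNIV)
    qed (use t fin1 in auto)
    then show "B \<tau> D1 = B \<sigma> D1" using t(2) by (auto simp: B_def agr_def)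
  qed (auto simp: B_def agr_def)
  then have "0 \<le> (-1) ^ card D1 * (k D * k D * ip u (R h u))"
    unfolding eq using kpos[of "D \<union> h ` D1"] by (simp add: mult_ac flip: power_mult_distrib)
  then have "0 \<le> (k D * k D) * ((-1) ^ card D1 * ip u (R h u))" by (simp add: mult_ac)
  moreover have "0 < k D * k D" using kpos by simp
  ultimately show ?thesis by (simp add: zero_le_mult_iff)
qed


section \<open>Signed averaging projections and convolution\<close>

definition Pj :: "nat set \<Rightarrow> ((nat \<Rightarrow> nat) \<Rightarrow> real) \<Rightarrow> (nat \<Rightarrow> nat) \<Rightarrow> real" where
  "Pj T v = (\<lambda>\<sigma>. \<Sum>(S, b)\<in>Pow T \<times> agr (pr T) id.
     ((-1) ^ card S / (2 ^ card T * card (agr (pr T) id))) * R (sw S \<circ> b) v \<sigma>)"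

text \<open>Not normalised, like \<open>ip\<close> and \<open>nrm\<close>; this is why powers of
  \<open>card G\<close> appear in the bounds.\<close>

definition conv :: "((nat \<Rightarrow> nat) \<Rightarrow> real) \<Rightarrow> ((nat \<Rightarrow> nat) \<Rightarrow> real) \<Rightarrow> (nat \<Rightarrow> nat) \<Rightarrow> real" where
  "conv f w = (\<lambda>\<sigma>. \<Sum>a\<in>G. f a * w (inv' a \<circ> \<sigma>))"

lemma Pj_sum: "Pj T v \<sigma> = (\<Sum>S\<in>Pow T. \<Sum>b\<in>agr (pr T) id.
    ((-1) ^ card S / (2 ^ card T * card (agr (pr T) id))) * v (\<sigma> \<circ> sw S \<circ> b))"
  unfolding Pj_def by (simp add: sum.cartesian_product o_assoc)

lemma Pj_phi:
  assumes "T \<subseteq> {..<m}" "\<sigma> \<in> G"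
  shows "Pj T v \<sigma> = phi v {} T \<sigma>"
proof -
  have "av (pr T) (\<sigma> \<circ> sw S) v = (\<Sum>b\<in>agr (pr T) id. v (\<sigma> \<circ> sw S \<circ> b)) / card (agr (pr T) id)"
    if "S \<in> Pow T" for S
  proof -
    have g: "\<sigma> \<circ> sw S \<in> G" using that assms sw_G by blast
    then show ?thesis unfolding av_def
      using sum_agr_R[OF g, of v "pr T"] card_agr_eq[OF g G_id, of "pr T"] by simp
  qed
  then show ?thesis unfolding Pj_sum phi_def
    by (simp add: sum_distrib_left sum_divide_distrib mult_ac)
qed

text \<open>\<open>Pj T\<close> is the action of a group algebra element by right translations,
  which is why it is defined through \<open>R\<close> although it agrees with \<open>phi\<close> on
  the group.\<close>

lemma Pj_in:
  assumes W: "rinv G W" "w \<in> W" and T: "T \<subseteq> {..<m}"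
  shows "Pj T w \<in> W"
proof -
  have "finite T" using T finite_subset by blast
  then have fin: "finite (Pow T \<times> agr (pr T) id)" by simp
  have "(\<lambda>\<sigma>. \<Sum>i\<in>Pow T \<times> agr (pr T) id. ((-1) ^ card (fst i) / (2 ^ card T * card (agr (pr T) id))) *
      R (sw (fst i) \<circ> snd i) w \<sigma>) \<in> W"
  proof (rule lin_sum[OF rinvD(1)[OF W(1)] fin, where v = "\<lambda>i. R (sw (fst i) \<circ> snd i) w"])
    fix i assume i: "i \<in> Pow T \<times> agr (pr T) id"
    then have "sw (fst i) \<in> G" "snd i \<in> G" using T sw_G agr_G by auto
    then show "R (sw (fst i) \<circ> snd i) w \<in> W" using rinvD(2)[OF W(1) _ W(2)] by blast
  qed
  then show ?thesis unfolding Pj_def case_prod_unfold .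
qed

text \<open>The swap normalises the pointwise stabiliser of \<open>pr T\<close>, so conjugating
  \<open>inv' b\<close> by it is a bijection of the stabiliser that carries one sum to the
  other.\<close>

lemma sum_agr_sw_inv:
  assumes T: "T \<subseteq> {..<m}" "S \<subseteq> T"
  shows "(\<Sum>b\<in>agr (pr T) id. F (inv' b \<circ> sw S)) = (\<Sum>b\<in>agr (pr T) id. F (sw S \<circ> b) :: real)"
proof (rule sum.reindex_bij_witness[where i = "\<lambda>b. sw S \<circ> inv' b \<circ> sw S" and j = "\<lambda>b. sw S \<circ> inv' b \<circ> sw S"])
  have S: "S \<subseteq> {..<m}" using T by blast
  have sG: "sw S \<in> G" using sw_G[OF S] .
  have ss: "sw S \<circ> sw S = id" using sw_invol[OF S] .
  have sinv: "inv' (sw S) = sw S" using ss G_inv_o'(1)[OF sG, of "sw S"] by simp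
  have *: "sw S \<circ> inv' b \<circ> sw S \<in> agr (pr T) id" "sw S \<circ> inv' (sw S \<circ> inv' b \<circ> sw S) \<circ> sw S = b"
    "sw S \<circ> (sw S \<circ> inv' b \<circ> sw S) = inv' b \<circ> sw S"
    if b: "b \<in> agr (pr T) id" for b
  proof -
    have bG: "b \<in> G" "\<And>x. x \<in> pr T \<Longrightarrow> b x = x" using b by (auto simp: agr_def)
    have binv: "inv' b x = x" if "x \<in> pr T" for x using bG(2)[OF that] G_inv_apply(1)[OF bG(1), of x] by simp
    have ssx: "sw S (sw S x) = x" for x using fun_cong[OF ss, of x] by simp
    show "sw S \<circ> inv' b \<circ> sw S \<in> agr (pr T) id"
      using binv sw_mem[OF S T(1)] ssx sG bG by (auto simp: agr_def)
    have "inv' (sw S \<circ> inv' b \<circ> sw S) = sw S \<circ> b \<circ> sw S"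
      using sG bG G_inv[OF bG(1)] by (simp add: G_inv_comp G_comp sinv o_assoc)
    then show "sw S \<circ> inv' (sw S \<circ> inv' b \<circ> sw S) \<circ> sw S = b" using ssx by (auto simp: fun_eq_iff)
    show "sw S \<circ> (sw S \<circ> inv' b \<circ> sw S) = inv' b \<circ> sw S" using ssx by (auto simp: fun_eq_iff)
  qed
  fix b assume b: "b \<in> agr (pr T) id"
  show "sw S \<circ> inv' b \<circ> sw S \<in> agr (pr T) id" "sw S \<circ> inv' (sw S \<circ> inv' b \<circ> sw S) \<circ> sw S = b"
    using *[OF b] by auto
  show "sw S \<circ> inv' b \<circ> sw S \<in> agr (pr T) id" "sw S \<circ> inv' (sw S \<circ> inv' b \<circ> sw S) \<circ> sw S = b"
    using *[OF b] by auto
  show "F (sw S \<circ> (sw S \<circ> inv' b \<circ> sw S)) = F (inv' b \<circ> sw S)" using *(3)[OF b] by simp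
qed

text \<open>The adjoint of a right translation is translation by the inverse, and by
  \<open>sum_agr_sw_inv\<close> the group algebra element behind \<open>Pj T\<close> is invariant
  under inversion.\<close>

lemma Pj_adj:
  assumes T: "T \<subseteq> {..<m}"
  shows "ip (Pj T v) w = ip v (Pj T w)"
proof -
  define c where "c S = (-1 :: real) ^ card S / (2 ^ card T * card (agr (pr T) id))" for S :: "nat set"
  have "ip (Pj T v) w = (\<Sum>\<sigma>\<in>G. \<Sum>S\<in>Pow T. \<Sum>b\<in>agr (pr T) id. c S * (v (\<sigma> \<circ> (sw S \<circ> b)) * w \<sigma>))"
    unfolding ip_def Pj_sum c_def[symmetric]
    by (simp only: sum_distrib_right mult.assoc o_assoc)
  also have "\<dots> = (\<Sum>S\<in>Pow T. \<Sum>b\<in>agr (pr T) id. c S * ip (R (sw S \<circ> b) v) w)"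
    unfolding ip_def sum_distrib_left R_apply
    by (subst sum.swap, rule sum.cong[OF refl], subst sum.swap) simp
  also have "\<dots> = (\<Sum>S\<in>Pow T. \<Sum>b\<in>agr (pr T) id. c S * ip v (R (inv' b \<circ> sw S) w))"
  proof (intro sum.cong refl)
    fix S b assume S: "S \<in> Pow T" and b: "b \<in> agr (pr T) id"
    have Sm: "S \<subseteq> {..<m}" using S T by blast
    have sG: "sw S \<in> G" using sw_G[OF Sm] .
    have "inv' (sw S) = sw S" using sw_invol[OF Sm] G_inv_o'(1)[OF sG, of "sw S"] by simp
    then have "inv' (sw S \<circ> b) = inv' b \<circ> sw S" using G_inv_comp[OF sG agr_G[OF b]] by simp
    then show "c S * ip (R (sw S \<circ> b) v) w = c S * ip v (R (inv' b \<circ> sw S) w)"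
      using ip_R_adj[OF G_comp[OF sG agr_G[OF b]]] by simp
  qed
  also have "\<dots> = (\<Sum>S\<in>Pow T. \<Sum>b\<in>agr (pr T) id. c S * ip v (R (sw S \<circ> b) w))"
  proof (rule sum.cong)
    fix S assume "S \<in> Pow T"
    then show "(\<Sum>b\<in>agr (pr T) id. c S * ip v (R (inv' b \<circ> sw S) w)) =
      (\<Sum>b\<in>agr (pr T) id. c S * ip v (R (sw S \<circ> b) w))"
      using sum_agr_sw_inv[OF T, of S "\<lambda>g. c S * ip v (R g w)"] by simp
  qed simp
  also have "\<dots> = (\<Sum>\<sigma>\<in>G. \<Sum>S\<in>Pow T. \<Sum>b\<in>agr (pr T) id. c S * (v \<sigma> * w (\<sigma> \<circ> (sw S \<circ> b))))"
    unfolding ip_def sum_distrib_left R_apply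
    by (subst (2) sum.swap, rule sum.cong[OF refl], subst sum.swap) simp
  also have "\<dots> = ip v (Pj T w)"
    unfolding ip_def Pj_sum c_def[symmetric] sum_distrib_left
    by (intro sum.cong refl) (simp add: o_assoc)
  finally show ?thesis .
qed

lemma ip_cong2: "(\<And>\<sigma>. \<sigma> \<in> G \<Longrightarrow> w \<sigma> = w' \<sigma>) \<Longrightarrow> ip v w = ip v w'"
  by (simp add: ip_def)

text \<open>\<open>Pj T v\<close> depends only on the values on \<open>pr T\<close> and has the sign
  symmetry of \<open>T\<close> already. With \<open>Pj_adj\<close> this makes \<open>Pj T\<close> an
  orthogonal projection.\<close>

lemma Pj_idem:
  assumes T: "T \<subseteq> {..<m}" and \<sigma>: "\<sigma> \<in> G"
  shows "Pj T (Pj T v) \<sigma> = Pj T v \<sigma>"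
proof -
  have fin: "finite T" using T finite_subset by blast
  define w where "w = Pj T v"
  have w: "w \<tau> = phi v {} T \<tau>" if "\<tau> \<in> G" for \<tau> unfolding w_def using Pj_phi[OF T that] .
  have "av (pr ({} \<union> T)) (\<sigma> \<circ> sw S) w = (-1) ^ card S * w \<sigma>" if S: "S \<in> Pow T" for S
  proof -
    have Sm: "S \<subseteq> {..<m}" using S T by blast
    have g: "\<sigma> \<circ> sw S \<in> G" using \<sigma> sw_G[OF Sm] by blast
    have "av (pr ({} \<union> T)) (\<sigma> \<circ> sw S) w = w (\<sigma> \<circ> sw S)"
    proof (rule av_const[OF g])
      fix \<tau> assume \<tau>: "\<tau> \<in> agr (pr ({} \<union> T)) (\<sigma> \<circ> sw S)"
      then have "phi v {} T \<tau> = phi v {} T (\<sigma> \<circ> sw S)"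
        by (intro phi_cong[OF _ T]) (auto simp: agr_def)
      then show "w \<tau> = w (\<sigma> \<circ> sw S)" using w g agr_G[OF \<tau>] by simp
    qed
    moreover have "phi v {} T (\<sigma> \<circ> sw S) = (-1) ^ card (S \<inter> T) * phi v {} T \<sigma>"
      using phi_sw[of "{}" T S \<sigma> v] T Sm \<sigma> by simp
    moreover have "S \<inter> T = S" using S by auto
    ultimately show ?thesis using w g \<sigma> by simp
  qed
  then have "phi w {} T \<sigma> = (\<Sum>S\<in>Pow T. (-1) ^ card S * ((-1) ^ card S * w \<sigma>)) / 2 ^ card T"
    unfolding phi_def by simp
  also have "\<dots> = (\<Sum>S\<in>Pow T. w \<sigma>) / 2 ^ card T"
    by (simp flip: mult.assoc power_mult_distrib)
  also have "\<dots> = w \<sigma>" using fin by (simp add: card_Pow)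
  finally show ?thesis using Pj_phi[OF T \<sigma>, of w] by (simp add: w_def)
qed

lemma nrm_Pj:
  assumes T: "T \<subseteq> {..<m}"
  shows "nrm (Pj T v) = ip v (Pj T v)"
  unfolding nrm_def Pj_adj[OF T] using Pj_idem[OF T] by (intro ip_cong2) auto

text \<open>One point of \<open>D\<close> lies in each pair of \<open>T\<close>, so
  \<open>nrm (Pj T u)\<close> is the mean over \<open>S\<close> of the signed correlations of
  \<open>u\<close> with its translate by \<open>sw S\<close>. All are nonnegative by
  \<open>positivity\<close>, and the empty \<open>S\<close> contributes
  \<open>nrm u\<close>.\<close>

lemma Pj_junta:
  assumes T: "T \<subseteq> {..<m}" and D: "D \<subseteq> pr T" "card D = card T" "inj_on (\<lambda>x. (x - 1) div 2) D"
    and n: "2 * card T + 2 \<le> n"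
    and dep: "\<And>\<sigma> \<tau>. \<sigma> \<in> G \<Longrightarrow> \<tau> \<in> agr D \<sigma> \<Longrightarrow> u \<tau> = u \<sigma>"
    and harm: "\<And>x \<rho>. x \<in> D \<Longrightarrow> \<rho> \<in> G \<Longrightarrow> (\<Sum>\<sigma>\<in>agr (D - {x}) \<rho>. u \<sigma>) = 0"
  shows "nrm u / 2 ^ card T \<le> nrm (Pj T u)"
proof -
  have fin: "finite T" using T finite_subset by blast
  have finD: "finite D" using D finite_subset[OF _ finite_pr[OF T]] by blast
  have "Pj T u \<sigma> = (\<Sum>S\<in>Pow T. (-1) ^ card S * u (\<sigma> \<circ> sw S)) / 2 ^ card T" if \<sigma>: "\<sigma> \<in> G" for \<sigma>
  proof -
    have "av (pr ({} \<union> T)) (\<sigma> \<circ> sw S) u = u (\<sigma> \<circ> sw S)" if S: "S \<in> Pow T" for S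
    proof -
      have g: "\<sigma> \<circ> sw S \<in> G" using S T \<sigma> sw_G by blast
      show ?thesis
        by (rule av_const[OF g], rule dep[OF g]) (use D in \<open>auto simp: agr_def\<close>)
    qed
    then show ?thesis using Pj_phi[OF T \<sigma>, of u] by (simp add: phi_def)
  qed
  then have "nrm (Pj T u) = ip u (\<lambda>\<sigma>. (\<Sum>S\<in>Pow T. (-1) ^ card S * u (\<sigma> \<circ> sw S)) / 2 ^ card T)"
    unfolding nrm_Pj[OF T] by (intro ip_cong2) auto
  also have "\<dots> = (\<Sum>S\<in>Pow T. (-1) ^ card S * ip u (R (sw S) u)) / 2 ^ card T"
    unfolding ip_def R_apply sum_distrib_left
    by (subst sum.swap) (simp add: sum_divide_distrib sum_distrib_left mult_ac)
  also have "\<dots> \<ge> nrm u / 2 ^ card T"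
  proof (rule divide_right_mono)
    have "(\<Sum>S\<in>{{}}. (-1) ^ card S * ip u (R (sw S) u)) \<le> (\<Sum>S\<in>Pow T. (-1) ^ card S * ip u (R (sw S) u))"
    proof (rule sum_mono2)
      fix S assume "S \<in> Pow T - {{}}"
      then have S: "S \<subseteq> T" "S \<subseteq> {..<m}" using T by auto
      define D1 where "D1 = D \<inter> pr S"
      have img: "(\<lambda>x. (x - 1) div 2) ` D = T"
      proof (rule card_subset_eq[OF fin])
        show "(\<lambda>x. (x - 1) div 2) ` D \<subseteq> T" using D by (auto simp: pr_def)
        show "card ((\<lambda>x. (x - 1) div 2) ` D) = card T" using D by (simp add: card_image)
      qed
      have "(\<lambda>x. (x - 1) div 2) ` D1 = S"
      proof (intro equalityI subsetI)
        fix t assume t: "t \<in> S"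
        then obtain x where x: "x \<in> D" "(x - 1) div 2 = t" using img S by blast
        moreover have "1 \<le> x" using x D by (auto simp: pr_def)
        ultimately show "t \<in> (\<lambda>x. (x - 1) div 2) ` D1" using t by (auto simp: D1_def pr_def)
      qed (auto simp: D1_def pr_def)
      moreover have "inj_on (\<lambda>x. (x - 1) div 2) D1" using D(3) by (rule inj_on_subset) (simp add: D1_def)
      ultimately have c1: "card D1 = card S" using card_image by metis
      have "0 \<le> (-1) ^ card D1 * ip u (R (sw S) u)"
      proof (rule positivity[OF _ _ sw_G[OF S(2)]])
        show "D \<subseteq> {1..n}" using D pr_subset[OF T] by blast
        show "D1 \<subseteq> D" by (simp add: D1_def)
        show "sw S x = x" if "x \<in> D - D1" for x
          using that D pr_bound[OF T, of x] by (auto simp: D1_def sw_def transpose_def)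
        show "sw S ` D1 \<inter> D = {}"
        proof (rule ccontr)
          assume "sw S ` D1 \<inter> D \<noteq> {}"
          then obtain x where x: "x \<in> D1" "sw S x \<in> D" by blast
          then have xp: "x \<in> pr S" "1 \<le> x" "x \<in> D" by (auto simp: D1_def pr_def)
          then have s: "sw S x = (if odd x then x + 1 else x - 1)" by (simp add: sw_in)
          have "(sw S x - 1) div 2 = (x - 1) div 2" "sw S x \<noteq> x"
            unfolding s using xp(2) by (auto, presburger+)
          then show False using inj_onD[OF D(3), of "sw S x" x] x xp by blast
        qed
        show "card D + card D1 + 2 \<le> n" using D n c1 card_mono[OF fin S(1)] by simp
        show "\<And>x \<rho>. x \<in> D1 \<Longrightarrow> \<rho> \<in> G \<Longrightarrow> sum u (agr (D - {x}) \<rho>) = 0"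
          using harm by (simp add: D1_def)
      qed (use dep in auto)
      then show "0 \<le> (-1) ^ card S * ip u (R (sw S) u)" using c1 by simp
    qed (use fin in auto)
    then show "nrm u \<le> (\<Sum>S\<in>Pow T. (-1) ^ card S * ip u (R (sw S) u))" by (simp add: nrm_def)
  qed simp
  finally show ?thesis .
qed


section \<open>Convolution on low levels\<close>

lemma comp_left_iff: "a \<in> G \<Longrightarrow> a \<circ> \<sigma> \<in> G \<longleftrightarrow> \<sigma> \<in> G"
  by (metis G_comp G_inv G_inv_o'(1))

lemma conv_FS: "w \<in> FS \<Longrightarrow> conv f w \<in> FS"
  by (auto simp: FS_def conv_def comp_left_iff G_inv)

lemma conv_R: "conv f (R b w) = R b (conv f w)"
  by (simp add: conv_def R_def o_assoc)

lemma conv_lin: "conv f (\<lambda>\<sigma>. v \<sigma> + c * w \<sigma>) = (\<lambda>\<sigma>. conv f v \<sigma> + c * conv f w \<sigma>)"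
  by (simp add: conv_def sum.distrib distrib_left sum_distrib_left mult.left_commute)

lemma conv_adj: "ip (conv f w) v = ip w (conv (\<lambda>a. f (inv' a)) v)"
proof -
  have "ip (conv f w) v = (\<Sum>a\<in>G. f a * (\<Sum>\<sigma>\<in>G. w (inv' a \<circ> \<sigma>) * v \<sigma>))"
    unfolding ip_def conv_def sum_distrib_right sum_distrib_left
    by (subst sum.swap) (simp add: mult.assoc)
  also have "\<dots> = (\<Sum>a\<in>G. f a * (\<Sum>\<sigma>\<in>G. w \<sigma> * v (a \<circ> \<sigma>)))"
  proof (rule sum.cong[OF refl])
    fix a assume a: "a \<in> G"
    show "f a * (\<Sum>\<sigma>\<in>G. w (inv' a \<circ> \<sigma>) * v \<sigma>) = f a * (\<Sum>\<sigma>\<in>G. w \<sigma> * v (a \<circ> \<sigma>))"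
      using sum_L[OF a, of "\<lambda>\<sigma>. w (inv' a \<circ> \<sigma>) * v \<sigma>"] a by simp
  qed
  also have "\<dots> = (\<Sum>a\<in>G. f (inv' a) * (\<Sum>\<sigma>\<in>G. w \<sigma> * v (inv' a \<circ> \<sigma>)))"
    using sum_inv[of "\<lambda>a. f a * (\<Sum>\<sigma>\<in>G. w \<sigma> * v (a \<circ> \<sigma>))"] by simp
  also have "\<dots> = ip w (conv (\<lambda>a. f (inv' a)) v)"
    unfolding ip_def conv_def sum_distrib_left
    by (subst sum.swap) (simp add: mult.left_commute)
  finally show ?thesis .
qed

text \<open>Convolution combines left translates, and left translation permutes the cosets in the
  definition of the levels.\<close>

lemma conv_Lev_ge:
  assumes w: "w \<in> Lev_ge d"
  shows "conv f w \<in> Lev_ge d"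
proof -
  have "(\<Sum>\<sigma>\<in>agr D \<rho>. conv f w \<sigma>) = 0" if D: "D \<subseteq> {1..n}" "card D = d" "\<rho> \<in> G" for D \<rho>
  proof -
    have "(\<Sum>\<sigma>\<in>agr D \<rho>. conv f w \<sigma>) = (\<Sum>a\<in>G. f a * (\<Sum>\<sigma>\<in>agr D \<rho>. w (inv' a \<circ> \<sigma>)))"
      unfolding conv_def sum_distrib_left by (subst sum.swap) simp
    also have "\<dots> = (\<Sum>a\<in>G. f a * (\<Sum>\<sigma>\<in>agr D (inv' a \<circ> \<rho>). w \<sigma>))"
      by (intro sum.cong refl arg_cong2[where f = "(*)"] sum.reindex_bij_betw bij_agr_left G_inv)
    also have "\<dots> = 0"
    proof (rule sum.neutral, rule ballI)
      fix a assume "a \<in> G"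
      then have "inv' a \<circ> \<rho> \<in> G" using D by blast
      then have "(\<Sum>\<sigma>\<in>agr D (inv' a \<circ> \<rho>). w \<sigma>) = 0" using w D unfolding Lev_ge_def by blast
      then show "f a * (\<Sum>\<sigma>\<in>agr D (inv' a \<circ> \<rho>). w \<sigma>) = 0" by simp
    qed
    finally show ?thesis .
  qed
  then show ?thesis using w conv_FS by (auto simp: Lev_ge_def)
qed

lemma conv_Lev_eq: "w \<in> Lev_eq d \<Longrightarrow> conv f w \<in> Lev_eq d"
  using conv_Lev_ge by (auto simp: Lev_eq_def conv_adj)

text \<open>\<open>Pj_junta\<close> after relabelling: \<open>\<pi>\<close> carries \<open>D\<close>
  to one point in each pair of \<open>T\<close>. The zero sums it requires are those over
  \<open>d\<close> prescribed values, available on this level.\<close>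

lemma Lev_eq_junta_Pj:
  assumes u: "u \<in> Lev_eq d" and D: "D \<subseteq> {1..n}" "card D = Suc d"
    and dep: "\<forall>\<sigma>\<in>G. \<forall>\<tau>\<in>agr D \<sigma>. u \<tau> = u \<sigma>"
    and p: "\<pi> \<in> G" and T: "T \<subseteq> {..<m}" "card T = Suc d"
    and tr: "\<pi> ` D \<subseteq> pr T" "inj_on (\<lambda>x. (x - 1) div 2) (\<pi> ` D)" and n: "2 * Suc d + 2 \<le> n"
  shows "nrm u / 2 ^ Suc d \<le> nrm (Pj T (R \<pi> u))"
proof -
  have finD: "finite D" using D finite_subset by blast
  have cD: "card (\<pi> ` D) = Suc d"
    using card_image[OF inj_on_subset[OF G_inj[OF p] subset_UNIV], of D] D by simp
  have Ru: "R \<pi> u \<in> Lev_eq d" using rinvD(2)[OF rinv_Lev_eq p u] .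
  have "nrm (R \<pi> u) / 2 ^ card T \<le> nrm (Pj T (R \<pi> u))"
  proof (rule Pj_junta[OF T(1) tr(1) _ tr(2)])
    show "card (\<pi> ` D) = card T" using cD T by simp
    show "2 * card T + 2 \<le> n" using n T by simp
    show "R \<pi> u \<tau> = R \<pi> u \<sigma>" if "\<sigma> \<in> G" "\<tau> \<in> agr (\<pi> ` D) \<sigma>" for \<sigma> \<tau>
    proof -
      have "\<tau> \<circ> \<pi> \<in> agr D (\<sigma> \<circ> \<pi>)" "\<sigma> \<circ> \<pi> \<in> G" using that p by (auto simp: agr_def)
      then show ?thesis using dep by auto
    qed
    show "(\<Sum>\<sigma>\<in>agr (\<pi> ` D - {x}) \<rho>. R \<pi> u \<sigma>) = 0" if "x \<in> \<pi> ` D" "\<rho> \<in> G" for x \<rho>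
    proof -
      have "\<pi> ` D - {x} \<subseteq> {1..n}" using tr pr_subset[OF T(1)] by auto
      moreover have "card (\<pi> ` D - {x}) = d" using cD that finD by simp
      ultimately show ?thesis using Ru that(2) unfolding Lev_eq_def Lev_ge_def by blast
    qed
  qed
  then show ?thesis using nrm_R[OF p] T by simp
qed

text \<open>Convolution as an integral operator with kernel
  \<open>f (\<sigma> \<circ> inv' b)\<close>, the form needed for the Hilbert-Schmidt and Bessel
  estimates.\<close>

lemma conv_ip:
  assumes \<sigma>: "\<sigma> \<in> G"
  shows "conv f p \<sigma> = ip (\<lambda>b. f (\<sigma> \<circ> inv' b)) p"
proof -
  have "conv f p \<sigma> = (\<Sum>a\<in>G. f (\<sigma> \<circ> inv' (inv' a \<circ> \<sigma>)) * p (inv' a \<circ> \<sigma>))"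
    unfolding conv_def
  proof (intro sum.cong refl)
    fix a assume a: "a \<in> G"
    then have "\<sigma> \<circ> inv' (inv' a \<circ> \<sigma>) = a" using \<sigma> by (simp add: G_inv_comp G_inv)
    then show "f a * p (inv' a \<circ> \<sigma>) = f (\<sigma> \<circ> inv' (inv' a \<circ> \<sigma>)) * p (inv' a \<circ> \<sigma>)" by simp
  qed
  also have "\<dots> = (\<Sum>a\<in>G. f (\<sigma> \<circ> inv' (a \<circ> \<sigma>)) * p (a \<circ> \<sigma>))"
    by (rule sum_inv[of "\<lambda>a. f (\<sigma> \<circ> inv' (a \<circ> \<sigma>)) * p (a \<circ> \<sigma>)"])
  also have "\<dots> = (\<Sum>b\<in>G. f (\<sigma> \<circ> inv' b) * p b)"
    by (rule sum_R[OF \<sigma>, of "\<lambda>b. f (\<sigma> \<circ> inv' b) * p b"])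
  finally show ?thesis by (simp add: ip_def)
qed

text \<open>A Hilbert-Schmidt bound: as \<open>p\<close> lies in the range of \<open>Pj T\<close>,
  the kernel may be projected as well, and Cauchy-Schwarz in each row leaves the squared norm of the
  projected kernel.\<close>

lemma conv_Pj_bound:
  assumes T: "T \<subseteq> {..<m}" and p: "p \<in> FS" "\<And>\<sigma>. \<sigma> \<in> G \<Longrightarrow> Pj T p \<sigma> = p \<sigma>"
  shows "nrm (conv f p) \<le> (\<Sum>\<pi>\<in>G. nrm (Pj T (R \<pi> f))) * nrm p"
proof -
  define F where "F \<sigma> = (\<lambda>b. f (\<sigma> \<circ> inv' b))" for \<sigma> :: "nat \<Rightarrow> nat"
  define c where "c S = (-1 :: real) ^ card S / (2 ^ card T * card (agr (pr T) id))" for S :: "nat set"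
  have 1: "conv f p \<sigma> = ip (Pj T (F \<sigma>)) p" if \<sigma>: "\<sigma> \<in> G" for \<sigma>
  proof -
    have "conv f p \<sigma> = ip (F \<sigma>) (Pj T p)"
      unfolding conv_ip[OF \<sigma>] F_def using p(2) by (intro ip_cong2) auto
    then show ?thesis by (simp add: Pj_adj[OF T])
  qed
  \<comment> \<open>Projecting the kernel in the variable \<open>b\<close> is the same as projecting
    a translate of \<open>f\<close> in \<open>\<sigma>\<close>, again by invariance under
    inversion.\<close>
  have 2: "Pj T (F \<sigma>) b = Pj T (R (inv' b) f) \<sigma>" if \<sigma>: "\<sigma> \<in> G" and b: "b \<in> G" for \<sigma> b
  proof -
    have "Pj T (F \<sigma>) b = (\<Sum>S\<in>Pow T. \<Sum>x\<in>agr (pr T) id. c S * f (\<sigma> \<circ> (inv' x \<circ> sw S) \<circ> inv' b))"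
      unfolding Pj_sum c_def[symmetric]
    proof (intro sum.cong refl)
      fix S x assume S: "S \<in> Pow T" and x: "x \<in> agr (pr T) id"
      have Sm: "S \<subseteq> {..<m}" using S T by blast
      have sG: "sw S \<in> G" using sw_G[OF Sm] .
      have "inv' (sw S) = sw S" using sw_invol[OF Sm] G_inv_o'(1)[OF sG, of "sw S"] by simp
      then have "inv' (b \<circ> sw S \<circ> x) = inv' x \<circ> sw S \<circ> inv' b"
        using b sG agr_G[OF x] by (simp add: G_inv_comp G_comp o_assoc)
      then show "c S * F \<sigma> (b \<circ> sw S \<circ> x) = c S * f (\<sigma> \<circ> (inv' x \<circ> sw S) \<circ> inv' b)"
        by (simp add: F_def o_assoc)
    qed
    also have "\<dots> = (\<Sum>S\<in>Pow T. \<Sum>x\<in>agr (pr T) id. c S * f (\<sigma> \<circ> (sw S \<circ> x) \<circ> inv' b))"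
    proof (rule sum.cong)
      fix S assume "S \<in> Pow T"
      then show "(\<Sum>x\<in>agr (pr T) id. c S * f (\<sigma> \<circ> (inv' x \<circ> sw S) \<circ> inv' b)) =
        (\<Sum>x\<in>agr (pr T) id. c S * f (\<sigma> \<circ> (sw S \<circ> x) \<circ> inv' b))"
        using sum_agr_sw_inv[OF T, of S "\<lambda>g. c S * f (\<sigma> \<circ> g \<circ> inv' b)"] by simp
    qed simp
    also have "\<dots> = Pj T (R (inv' b) f) \<sigma>"
      unfolding Pj_sum c_def[symmetric] by (simp add: o_assoc)
    finally show ?thesis .
  qed
  have "nrm (conv f p) = (\<Sum>\<sigma>\<in>G. (ip (Pj T (F \<sigma>)) p)\<^sup>2)"
    unfolding nrm_def ip_def[of "conv f p"] power2_eq_square using 1 by (intro sum.cong) auto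
  also have "\<dots> \<le> (\<Sum>\<sigma>\<in>G. nrm (Pj T (F \<sigma>)) * nrm p)"
    by (intro sum_mono ip_square_le)
  also have "\<dots> = (\<Sum>\<sigma>\<in>G. \<Sum>b\<in>G. Pj T (R (inv' b) f) \<sigma> * Pj T (R (inv' b) f) \<sigma>) * nrm p"
    unfolding sum_distrib_right[symmetric] nrm_def[of "Pj T _"] ip_def[of "Pj T _"]
    using 2 by (intro arg_cong2[where f = "(*)"] sum.cong refl) auto
  also have "(\<Sum>\<sigma>\<in>G. \<Sum>b\<in>G. Pj T (R (inv' b) f) \<sigma> * Pj T (R (inv' b) f) \<sigma>) = (\<Sum>b\<in>G. nrm (Pj T (R (inv' b) f)))"
    unfolding nrm_def ip_def by (rule sum.swap)
  also have "\<dots> = (\<Sum>\<pi>\<in>G. nrm (Pj T (R \<pi> f)))" by (rule sum_inv)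
  finally show ?thesis .
qed

text \<open>The extremal subspace contains a junta; moved onto one point of each pair of
  \<open>T\<close> and projected, it becomes a nonzero extremal vector in the range of
  \<open>Pj T\<close>. Hence the bound from a single \<open>T\<close> controls the whole level, for
  every \<open>T\<close> separately.\<close>

lemma low_level_conv:
  assumes T: "T \<subseteq> {..<m}" "card T = Suc d" and n: "2 * Suc d + 2 \<le> n" and w: "w \<in> Lev_eq d"
  shows "nrm (conv f w) \<le> (\<Sum>\<pi>\<in>G. nrm (Pj T (R \<pi> f))) * nrm w"
proof (cases "w = (\<lambda>_. 0)")
  case True
  have "conv f w = (\<lambda>_. 0)" using True by (simp add: conv_def)
  then show ?thesis using True by (simp add: nrm_def)
next
  case False
  \<comment> \<open>The sign turns the largest ratio into the minimum provided by
    \<open>ex_extremal\<close>.\<close>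
  define Q where "Q v w = - ip (conv f v) (conv f w)" for v w
  have "\<exists>lam W'. rinv G W' \<and> W' \<subseteq> Lev_eq d \<and> (\<exists>w\<in>W'. w \<noteq> (\<lambda>_. 0)) \<and>
    (\<forall>v\<in>Lev_eq d. lam * nrm v \<le> Q v v) \<and> (\<forall>w\<in>W'. Q w w = lam * nrm w)"
  proof (rule ex_extremal[where Q = Q, OF rinv_Lev_eq closed_Lev_eq w False])
    show "continuous_on UNIV (\<lambda>w. Q w w)"
      unfolding Q_def ip_def conv_def by (intro continuous_intros)
    show "Q (\<lambda>\<sigma>. u \<sigma> + c * v \<sigma>) w = Q u w + c * Q v w" for u v w c
      by (simp add: Q_def conv_lin ip_lin)
  qed (auto simp: Q_def ip_comm conv_R ip_R)
  then obtain lam W' where W': "rinv G W'" "W' \<subseteq> Lev_eq d" "\<exists>w\<in>W'. w \<noteq> (\<lambda>_. 0)"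
    and lam: "\<And>v. v \<in> Lev_eq d \<Longrightarrow> lam * nrm v \<le> Q v v" "\<And>w. w \<in> W' \<Longrightarrow> Q w w = lam * nrm w" by blast
  obtain D u where D: "D \<subseteq> {1..n}" "card D = Suc d" and u: "u \<in> W'" "u \<noteq> (\<lambda>_. 0)"
    and dep: "\<forall>\<sigma>\<in>G. \<forall>\<tau>\<in>agr D \<sigma>. u \<tau> = u \<sigma>"
    using ex_junta[OF W'(1,2)] W'(3) by metis
  have finD: "finite D" "finite T" using D T finite_subset by blast+
  obtain g0 where g0: "bij_betw g0 D T" using finD D T finite_same_card_bij by metis
  \<comment> \<open>Every point is sent to the odd member of its pair, so the image of
    \<open>D\<close> meets each pair of \<open>T\<close> exactly once.\<close>
  define g where "g x = 2 * g0 x + 1" for x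
  have gp: "(g x - 1) div 2 = g0 x" for x by (simp add: g_def)
  have gT: "g x \<in> pr T" if "x \<in> D" for x using that g0 by (auto simp: pr_def g_def bij_betw_def)
  have ing: "inj_on g D" using g0 by (auto simp: g_def bij_betw_def inj_on_def)
  obtain \<pi> where \<pi>: "\<pi> \<in> G" "\<And>x. x \<in> D \<Longrightarrow> \<pi> x = g x"
  proof (rule extend_to_G[OF D(1) _ ing])
    show "card D + 2 \<le> n" using D n by simp
    show "g ` D \<subseteq> {1..n}" using gT pr_subset[OF T(1)] by blast
  qed blast
  have tr: "\<pi> ` D \<subseteq> pr T" using \<pi> gT by auto
  have tr2: "inj_on (\<lambda>x. (x - 1) div 2) (\<pi> ` D)"
    using g0 \<pi>(2) by (auto simp: inj_on_def gp bij_betw_def simp del: One_nat_def)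
  have uV: "u \<in> Lev_eq d" using u W' by blast
  define p where "p = Pj T (R \<pi> u)"
  have pW: "p \<in> W'" unfolding p_def by (intro Pj_in[OF W'(1) _ T(1)] rinvD(2)[OF W'(1) \<pi>(1) u(1)])
  have "0 < nrm u" using nrm_pos u uV Lev_eq_FS by blast
  moreover have "nrm u / 2 ^ Suc d \<le> nrm p"
    unfolding p_def by (rule Lev_eq_junta_Pj[OF uV D dep \<pi>(1) T tr tr2 n])
  ultimately have p0: "0 < nrm p" by (smt (verit) divide_pos_pos zero_less_power)
  have "nrm (conv f p) \<le> (\<Sum>\<pi>\<in>G. nrm (Pj T (R \<pi> f))) * nrm p"
  proof (rule conv_Pj_bound[OF T(1)])
    show "p \<in> FS" using pW W' Lev_eq_FS by blast
    show "Pj T p \<sigma> = p \<sigma>" if "\<sigma> \<in> G" for \<sigma> unfolding p_def by (rule Pj_idem[OF T(1) that])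
  qed
  then have "- lam * nrm p \<le> (\<Sum>\<pi>\<in>G. nrm (Pj T (R \<pi> f))) * nrm p"
    using lam(2)[OF pW] by (simp add: Q_def nrm_def)
  then have l: "- lam \<le> (\<Sum>\<pi>\<in>G. nrm (Pj T (R \<pi> f)))" using p0 by (rule mult_right_le_imp_le)
  have "nrm (conv f w) \<le> - lam * nrm w" using lam(1)[OF w] by (simp add: Q_def nrm_def)
  also have "\<dots> \<le> (\<Sum>\<pi>\<in>G. nrm (Pj T (R \<pi> f))) * nrm w" using l nrm_nonneg by (rule mult_right_mono)
  finally show ?thesis .
qed

end

lemma same_pair:
  fixes a b :: nat
  assumes "1 \<le> a" "1 \<le> b" "a \<noteq> b" "(a - 1) div 2 = (b - 1) div 2"
  shows "b = (if odd a then a + 1 else a - 1)"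
proof -
  define q where "q = (a - 1) div 2"
  have "a - 1 = 2 * q + (a - 1) mod 2" by (simp add: q_def)
  moreover have "b - 1 = 2 * q + (b - 1) mod 2" unfolding q_def assms(4) by simp
  moreover have "(a - 1) mod 2 < 2" "(b - 1) mod 2 < 2" by simp_all
  ultimately have "a = 2 * q + 1 \<or> a = 2 * q + 2" "b = 2 * q + 1 \<or> b = 2 * q + 2"
    using assms(1,2) by linarith+
  then show ?thesis using assms(3) by auto
qed

section \<open>The norm of a level against its paired weights\<close>

context alt_pairs begin

text \<open>Summing the paired weight over all relabellings \<open>\<pi>\<close> removes the
  dependence on the chosen pairing and makes the form right-invariant, as \<open>ex_extremal\<close>
  requires.\<close>

definition level_form :: "nat \<Rightarrow> ((nat \<Rightarrow> nat) \<Rightarrow> real) \<Rightarrow> ((nat \<Rightarrow> nat) \<Rightarrow> real) \<Rightarrow> real" where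
  "level_form e v w = (\<Sum>\<pi>\<in>G. \<Sum>T\<in>pair_sets e {}. ip (Pj T (R \<pi> v)) (Pj T (R \<pi> w)))"

definition transversals :: "nat set \<Rightarrow> (nat \<Rightarrow> nat) set" where
  "transversals D = {\<pi> \<in> G. \<pi> ` D \<subseteq> pr {..<m} \<and> inj_on (\<lambda>x. (x - 1) div 2) (\<pi> ` D)}"

lemma card_G: "2 * card G = fact n"
  using card_agr[of "{}" id] nm by simp

lemma card_point:
  assumes "x \<in> {1..n}" "a \<in> {1..n}" "4 \<le> n"
  shows "n * card {\<pi> \<in> G. \<pi> x = a} = card G"
proof -
  obtain \<rho> where \<rho>: "\<rho> \<in> G" "\<And>y. y \<in> {x} \<Longrightarrow> \<rho> y = a"
    by (rule extend_to_G[of "{x}" "\<lambda>_. a"]) (use assms in auto)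
  have "{\<pi> \<in> G. \<pi> x = a} = agr {x} \<rho>" using \<rho> by (auto simp: agr_def)
  moreover have "2 * card (agr {x} \<rho>) = fact (n - 1)"
    using card_agr[OF _ _ \<rho>(1), of "{x}"] assms by simp
  moreover have "n * fact (n - 1) = fact n"
    using assms by (subst (2) fact_reduce) auto
  ultimately have "2 * (n * card {\<pi> \<in> G. \<pi> x = a}) = 2 * card G"
    using card_G by (metis mult.left_commute)
  then show ?thesis by simp
qed

lemma card_two_points:
  assumes "x \<in> {1..n}" "a \<in> {1..n}" "y \<in> {1..n}" "b \<in> {1..n}" "x \<noteq> y" "a \<noteq> b" "4 \<le> n"
  shows "n * ((n - 1) * card {\<pi> \<in> G. \<pi> x = a \<and> \<pi> y = b}) = card G"
proof -
  obtain \<rho> where \<rho>: "\<rho> \<in> G" "\<And>z. z \<in> {x, y} \<Longrightarrow> \<rho> z = (if z = x then a else b)"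
    by (rule extend_to_G[of "{x, y}" "\<lambda>z. if z = x then a else b"]) (use assms in auto)
  have "{\<pi> \<in> G. \<pi> x = a \<and> \<pi> y = b} = agr {x, y} \<rho>"
    using \<rho>(2)[of x] \<rho>(2)[of y] assms by (auto simp: agr_def)
  moreover have "2 * card (agr {x, y} \<rho>) = fact (n - 2)"
    using card_agr[OF _ _ \<rho>(1), of "{x, y}"] assms by (simp add: numeral_2_eq_2)
  moreover have "n * ((n - 1) * fact (n - 2)) = fact n"
  proof -
    obtain k where "n = Suc (Suc k)" using assms by (metis Suc_diff_le add_2_eq_Suc le_Suc_ex numeral_Bit0 one_add_one add.assoc)
    then show ?thesis by simp
  qed
  ultimately have "2 * (n * ((n - 1) * card {\<pi> \<in> G. \<pi> x = a \<and> \<pi> y = b})) = 2 * card G"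
    using card_G by (metis mult.left_commute)
  then show ?thesis by simp
qed

text \<open>A union bound. A point of \<open>D\<close> hits one of the at most 3 unpaired points
  with probability at most 3e/n, and two points of \<open>D\<close> share a pair with probability at
  most e^2/(n-1); each is at most 1/4.\<close>

lemma card_transversals:
  assumes D: "D \<subseteq> {1..n}" "card D = e" and e: "1 \<le> e" "12 * e\<^sup>2 + 1 \<le> n" and m: "n \<le> 2 * m + 3"
  shows "real (card G) \<le> 2 * real (card (transversals D))"
proof -
  have finD: "finite D" using D finite_subset by blast
  have e2: "1 \<le> e\<^sup>2" "e \<le> e\<^sup>2" using e by (auto simp: power2_eq_square)
  have n4: "4 \<le> n" using e e2 by linarith
  define N where "N = {1..n} - pr {..<m}"
  have pm: "pr {..<m} \<subseteq> {1..n}" by (rule pr_subset) simp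
  have cN: "card N \<le> 3"
    unfolding N_def using card_Diff_subset[OF finite_pr pm] card_pr[of "{..<m}"] m by simp
  define f where "f a = (if odd a then a + 1 else a - 1 :: nat)" for a
  define X where "X x a = {\<pi> \<in> G. \<pi> x = a}" for x a
  define Y where "Y x y a = {\<pi> \<in> G. \<pi> x = a \<and> \<pi> y = f a}" for x y a
  define bad where "bad = (\<Union>x\<in>D. \<Union>a\<in>N. X x a) \<union> (\<Union>x\<in>D. \<Union>y\<in>D - {x}. \<Union>a\<in>pr {..<m}. Y x y a)"
  have GB: "G - transversals D \<subseteq> bad"
  proof
    fix \<pi> assume \<pi>: "\<pi> \<in> G - transversals D"
    then have \<pi>G: "\<pi> \<in> G" by simp
    show "\<pi> \<in> bad"
    proof (cases "\<pi> ` D \<subseteq> pr {..<m}")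
      case False
      then obtain x where x: "x \<in> D" "\<pi> x \<notin> pr {..<m}" by blast
      then have "\<pi> x \<in> N" using G_in[OF \<pi>G, of x] D by (auto simp: N_def)
      then show ?thesis using x \<pi>G by (auto simp: bad_def X_def)
    next
      case True
      then have "\<not> inj_on (\<lambda>x. (x - 1) div 2) (\<pi> ` D)" using \<pi> by (simp add: transversals_def)
      then obtain x y where xy: "x \<in> D" "y \<in> D" "\<pi> x \<noteq> \<pi> y" "(\<pi> x - 1) div 2 = (\<pi> y - 1) div 2"
        by (auto simp: inj_on_def)
      have "1 \<le> \<pi> x" "1 \<le> \<pi> y" using True xy by (auto simp: pr_def)
      then have "\<pi> y = f (\<pi> x)" using xy(3,4) unfolding f_def by (intro same_pair)
      then have "\<pi> \<in> Y x y (\<pi> x)" using \<pi>G by (simp add: Y_def)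
      moreover have "\<pi> x \<in> pr {..<m}" "y \<in> D - {x}" using xy True by auto
      ultimately show ?thesis using xy(1) unfolding bad_def by blast
    qed
  qed
  have n0: "0 < real n" "0 < real n - 1" using n4 by auto
  have cX: "real (card (X x a)) = real (card G) / n" if "x \<in> D" "a \<in> N" for x a
  proof -
    have "n * card (X x a) = card G" unfolding X_def
      by (rule card_point) (use that D n4 in \<open>auto simp: N_def\<close>)
    then have "real n * real (card (X x a)) = real (card G)" by (metis of_nat_mult)
    then show ?thesis using n0 by (simp add: field_simps)
  qed
  have cY: "real (card (Y x y a)) = real (card G) / n / (real n - 1)" if "x \<in> D" "y \<in> D - {x}" "a \<in> pr {..<m}" for x y a
  proof -
    have "a \<noteq> f a" "f a \<in> pr {..<m}" using that(3) flip_pr[OF that(3)] by (auto simp: f_def pr_def)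
    then have "n * ((n - 1) * card (Y x y a)) = card G" unfolding Y_def
      by (intro card_two_points) (use that D n4 pm in auto)
    then have "real n * ((real n - 1) * real (card (Y x y a))) = real (card G)"
    proof -
      have "real (n - 1) = real n - 1" using n4 by (simp add: of_nat_diff)
      then show ?thesis using arg_cong[OF \<open>n * ((n - 1) * card (Y x y a)) = card G\<close>, of real] by simp
    qed
    then show ?thesis using n0 by (simp add: field_simps)
  qed
  have "card bad \<le> card (\<Union>x\<in>D. \<Union>a\<in>N. X x a) + card (\<Union>x\<in>D. \<Union>y\<in>D - {x}. \<Union>a\<in>pr {..<m}. Y x y a)"
    unfolding bad_def by (rule card_Un_le)
  moreover have "real (card (\<Union>x\<in>D. \<Union>a\<in>N. X x a)) \<le> real (card G) / 4"
  proof -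
    have "card (\<Union>x\<in>D. \<Union>a\<in>N. X x a) \<le> (\<Sum>x\<in>D. \<Sum>a\<in>N. card (X x a))"
      by (rule order_trans[OF card_UN_le[OF finD]]) (intro sum_mono card_UN_le, simp add: N_def)
    then have "real (card (\<Union>x\<in>D. \<Union>a\<in>N. X x a)) \<le> (\<Sum>x\<in>D. \<Sum>a\<in>N. real (card (X x a)))"
      by (metis (mono_tags, lifting) of_nat_le_iff of_nat_sum sum.cong)
    also have "\<dots> = real e * (real (card N) * (real (card G) / n))" using cX D by simp
    also have "\<dots> \<le> real e * (3 * (real (card G) / n))"
      using cN by (intro mult_left_mono mult_right_mono) auto
    also have "\<dots> \<le> real (card G) / 4"
    proof -
      have "12 * e \<le> n" using e e2 by linarith
      then have "12 * real e \<le> real n" by (metis of_nat_le_iff of_nat_mult of_nat_numeral)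
      then have "12 * real e * real (card G) \<le> real n * real (card G)" by (intro mult_right_mono) auto
      then show ?thesis using n0 by (simp add: field_simps)
    qed
    finally show ?thesis .
  qed
  moreover have "real (card (\<Union>x\<in>D. \<Union>y\<in>D - {x}. \<Union>a\<in>pr {..<m}. Y x y a)) \<le> real (card G) / 4"
  proof -
    have "card (\<Union>x\<in>D. \<Union>y\<in>D - {x}. \<Union>a\<in>pr {..<m}. Y x y a) \<le> (\<Sum>x\<in>D. \<Sum>y\<in>D - {x}. \<Sum>a\<in>pr {..<m}. card (Y x y a))"
      by (rule order_trans[OF card_UN_le[OF finD]], rule sum_mono,
          rule order_trans[OF card_UN_le], use finD in simp, rule sum_mono, rule card_UN_le, simp)
    then have "real (card (\<Union>x\<in>D. \<Union>y\<in>D - {x}. \<Union>a\<in>pr {..<m}. Y x y a)) \<le>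
        real (\<Sum>x\<in>D. \<Sum>y\<in>D - {x}. \<Sum>a\<in>pr {..<m}. card (Y x y a))" by (rule of_nat_mono)
    also have "\<dots> = (\<Sum>x\<in>D. \<Sum>y\<in>D - {x}. \<Sum>a\<in>pr {..<m}. real (card (Y x y a)))" by simp
    also have "\<dots> = (\<Sum>x\<in>D. \<Sum>y\<in>D - {x}. real (card (pr {..<m})) * (real (card G) / n / (real n - 1)))"
      using cY by simp
    also have "\<dots> \<le> (\<Sum>x\<in>D. \<Sum>y\<in>D. real (card (pr {..<m})) * (real (card G) / n / (real n - 1)))"
      using finD n0 by (intro sum_mono sum_mono2) auto
    also have "\<dots> = real e * (real e * (real (card (pr {..<m})) * (real (card G) / n / (real n - 1))))"
      using D by simp
    also have "\<dots> \<le> real e * (real e * (real n * (real (card G) / n / (real n - 1))))"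
    proof (intro mult_left_mono mult_right_mono)
      show "real (card (pr {..<m})) \<le> real n" using card_pr[of "{..<m}"] nm by simp
    qed (use n0 in auto)
    also have "\<dots> = (real e)\<^sup>2 * real (card G) / (real n - 1)" using n0 by (simp add: power2_eq_square)
    also have "\<dots> \<le> real (card G) / 4"
    proof -
      have "real (12 * e\<^sup>2 + 1) \<le> real n" using e(2) by (rule of_nat_mono)
      then have "1 + 12 * (real e)\<^sup>2 \<le> real n" by simp
      then have "4 * (real e)\<^sup>2 \<le> real n - 1" using zero_le_power2[of "real e"] by linarith
      then have "4 * (real e)\<^sup>2 * real (card G) \<le> (real n - 1) * real (card G)" by (intro mult_right_mono) auto
      then show ?thesis using n0 by (simp add: field_simps)
    qed
    finally show ?thesis .
  qed
  ultimately have cb: "real (card bad) \<le> real (card G) / 2" by linarith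
  have finb: "finite bad" unfolding bad_def X_def Y_def by (rule finite_subset[OF _ finite_G]) auto
  have "card G \<le> card (transversals D) + card bad"
  proof -
    have "G \<subseteq> transversals D \<union> bad" using GB by blast
    moreover have "finite (transversals D \<union> bad)" using finb by (auto simp: transversals_def)
    ultimately show ?thesis using card_mono card_Un_le le_trans by metis
  qed
  then show ?thesis using cb by linarith
qed

lemma level_form_sym: "level_form e v w = level_form e w v"
  by (simp add: level_form_def ip_comm)

lemma Pj_lin: "Pj T (\<lambda>\<sigma>. v \<sigma> + c * w \<sigma>) = (\<lambda>\<sigma>. Pj T v \<sigma> + c * Pj T w \<sigma>)"
  by (rule ext) (simp add: Pj_sum sum.distrib distrib_left sum_distrib_left mult.left_commute add_divide_distrib)

lemma R_lin: "R b (\<lambda>\<sigma>. v \<sigma> + c * w \<sigma>) = (\<lambda>\<sigma>. R b v \<sigma> + c * R b w \<sigma>)"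
  by (simp add: R_def)

lemma level_form_lin: "level_form e (\<lambda>\<sigma>. u \<sigma> + c * v \<sigma>) w = level_form e u w + c * level_form e v w"
  unfolding level_form_def R_lin Pj_lin ip_lin by (simp add: sum.distrib sum_distrib_left)

lemma level_form_R:
  assumes "b \<in> G"
  shows "level_form e (R b v) (R b w) = level_form e v w"
  unfolding level_form_def R_R by (rule sum_R[OF assms])

lemma level_form_nonneg: "0 \<le> level_form e v v"
  unfolding level_form_def by (intro sum_nonneg) (simp add: nrm_def[symmetric] nrm_nonneg)

lemma level_form_adj:
  assumes W: "rinv G W" "w \<in> W" and o: "\<And>x. x \<in> W \<Longrightarrow> ip v x = 0"
  shows "level_form e v w = 0"
proof -
  have "ip (Pj T (R \<pi> v)) (Pj T (R \<pi> w)) = 0" if \<pi>: "\<pi> \<in> G" and T: "T \<in> pair_sets e {}" for \<pi> T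
  proof -
    have Tm: "T \<subseteq> {..<m}" using pair_setsD(1)[OF T] .
    define x where "x = R (inv' \<pi>) (Pj T (Pj T (R \<pi> w)))"
    have "x \<in> W" unfolding x_def
      using \<pi> W by (intro rinvD(2)[OF W(1)] Pj_in[OF W(1) _ Tm] G_inv) auto
    moreover have "ip (Pj T (R \<pi> v)) (Pj T (R \<pi> w)) = ip v x"
      unfolding x_def Pj_adj[OF Tm] ip_R_adj[OF \<pi>] ..
    ultimately show ?thesis using o by simp
  qed
  then show ?thesis by (simp add: level_form_def)
qed

text \<open>Pythagoras for \<open>level_form\<close>: the projections keep \<open>w\<close> inside
  the invariant subspace, so the cross term with \<open>g - w\<close> vanishes.\<close>

lemma level_form_projection:
  assumes W: "rinv G W" "w \<in> W" and o: "\<And>x. x \<in> W \<Longrightarrow> ip (\<lambda>\<sigma>. g \<sigma> - w \<sigma>) x = 0"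
  shows "level_form e w w \<le> level_form e g g"
proof -
  define v where "v = (\<lambda>\<sigma>. g \<sigma> - w \<sigma>)"
  have g: "g = (\<lambda>\<sigma>. v \<sigma> + 1 * w \<sigma>)" by (simp add: v_def)
  have 0: "level_form e v w = 0" unfolding v_def by (rule level_form_adj[OF W o])
  have "level_form e g g = level_form e v (\<lambda>\<sigma>. v \<sigma> + 1 * w \<sigma>) + 1 * level_form e w (\<lambda>\<sigma>. v \<sigma> + 1 * w \<sigma>)"
    unfolding g by (rule level_form_lin)
  also have "\<dots> = level_form e v v + level_form e w w"
    unfolding level_form_sym[of e _ "\<lambda>\<sigma>. v \<sigma> + 1 * w \<sigma>"] level_form_lin using 0 level_form_sym[of e v w] by simp
  finally show ?thesis using level_form_nonneg[of e v] by simp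
qed

text \<open>By extremality it suffices to test a junta \<open>u\<close>. At least half of all
  relabellings spread its points over different pairs, and each of those yields a \<open>T\<close>
  on which the projection keeps a fraction \<open>1 / 2 ^ e\<close> of the squared norm.\<close>

lemma low_level_norm:
  assumes w: "w \<in> Lev_eq d" and n: "12 * (Suc d)\<^sup>2 + 1 \<le> n" "n \<le> 2 * m + 3" and e: "e = Suc d"
  shows "real (card G) * nrm w \<le> 2 * 2 ^ e * level_form e w w"
proof (cases "w = (\<lambda>_. 0)")
  case True
  then show ?thesis using level_form_nonneg[of e w] by (simp add: nrm_def)
next
  case False
  have "\<exists>lam W'. rinv G W' \<and> W' \<subseteq> Lev_eq d \<and> (\<exists>w\<in>W'. w \<noteq> (\<lambda>_. 0)) \<and>
    (\<forall>v\<in>Lev_eq d. lam * nrm v \<le> level_form e v v) \<and> (\<forall>w\<in>W'. level_form e w w = lam * nrm w)"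
  proof (rule ex_extremal[where Q = "level_form e", OF rinv_Lev_eq closed_Lev_eq w False level_form_sym level_form_lin _ level_form_R])
    show "continuous_on UNIV (\<lambda>w. level_form e w w)"
      unfolding level_form_def ip_def Pj_sum R_apply by (intro continuous_intros)
  qed
  then obtain lam W' where W': "rinv G W'" "W' \<subseteq> Lev_eq d" "\<exists>w\<in>W'. w \<noteq> (\<lambda>_. 0)"
    and lam: "\<And>v. v \<in> Lev_eq d \<Longrightarrow> lam * nrm v \<le> level_form e v v" "\<And>w. w \<in> W' \<Longrightarrow> level_form e w w = lam * nrm w" by blast
  obtain D u where D: "D \<subseteq> {1..n}" "card D = Suc d" and u: "u \<in> W'" "u \<noteq> (\<lambda>_. 0)"
    and dep: "\<forall>\<sigma>\<in>G. \<forall>\<tau>\<in>agr D \<sigma>. u \<tau> = u \<sigma>"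
    using ex_junta[OF W'(1,2)] W'(3) by metis
  have uV: "u \<in> Lev_eq d" using u W' by blast
  have u0: "0 < nrm u" using nrm_pos u uV Lev_eq_FS by blast
  have "Suc d \<le> (Suc d)\<^sup>2" unfolding power2_eq_square by simp
  then have "12 * Suc d + 1 \<le> 12 * (Suc d)\<^sup>2 + 1" by (intro add_mono mult_le_mono2 order_refl)
  then have "12 * Suc d + 1 \<le> n" using n(1) by (rule order_trans)
  then have n2: "2 * Suc d + 2 \<le> n" by simp
  have each: "nrm u / 2 ^ e \<le> (\<Sum>T\<in>pair_sets e {}. ip (Pj T (R \<pi> u)) (Pj T (R \<pi> u)))" if \<pi>: "\<pi> \<in> transversals D" for \<pi>
  proof -
    have p: "\<pi> \<in> G" "\<pi> ` D \<subseteq> pr {..<m}" "inj_on (\<lambda>x. (x - 1) div 2) (\<pi> ` D)" using \<pi> by (auto simp: transversals_def)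
    define T where "T = (\<lambda>x. (x - 1) div 2) ` \<pi> ` D"
    have Tm: "T \<subseteq> {..<m}" using p(2) unfolding T_def pr_def by blast
    have cT: "card T = Suc d"
      unfolding T_def using card_image[OF p(3)] card_image[OF inj_on_subset[OF G_inj[OF p(1)] subset_UNIV], of D] D by simp
    have tr: "\<pi> ` D \<subseteq> pr T" using p(2) by (auto simp: T_def pr_def)
    have "T \<in> pair_sets e {}" using Tm cT e by (simp add: pair_sets_def)
    have "nrm u / 2 ^ e \<le> nrm (Pj T (R \<pi> u))"
      unfolding e by (rule Lev_eq_junta_Pj[OF uV D dep p(1) Tm cT tr p(3) n2])
    also have "\<dots> \<le> (\<Sum>T\<in>pair_sets e {}. nrm (Pj T (R \<pi> u)))"
      by (rule member_le_sum[OF \<open>T \<in> pair_sets e {}\<close>]) (auto simp: nrm_nonneg)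
    finally show ?thesis by (simp add: nrm_def)
  qed
  have "real (card (transversals D)) * (nrm u / 2 ^ e) = (\<Sum>\<pi>\<in>transversals D. nrm u / 2 ^ e)" by simp
  also have "\<dots> \<le> (\<Sum>\<pi>\<in>transversals D. \<Sum>T\<in>pair_sets e {}. ip (Pj T (R \<pi> u)) (Pj T (R \<pi> u)))" by (rule sum_mono[OF each])
  also have "\<dots> \<le> level_form e u u" unfolding level_form_def
  proof (rule sum_mono2)
    show "transversals D \<subseteq> G" by (auto simp: transversals_def)
    show "0 \<le> (\<Sum>T\<in>pair_sets e {}. ip (Pj T (R \<pi> u)) (Pj T (R \<pi> u)))" for \<pi>
      by (intro sum_nonneg) (simp add: nrm_def[symmetric] nrm_nonneg)
  qed simp
  also have "\<dots> = lam * nrm u" by (rule lam(2)[OF u(1)])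
  finally have "(real (card (transversals D)) / 2 ^ e) * nrm u \<le> lam * nrm u" by simp
  then have l: "real (card (transversals D)) / 2 ^ e \<le> lam" using u0 by (rule mult_right_le_imp_le)
  have "real (card G) \<le> 2 * real (card (transversals D))"
    by (rule card_transversals[OF D]) (use n in auto)
  then have "real (card G) * nrm w \<le> 2 * real (card (transversals D)) * nrm w"
    using nrm_nonneg by (rule mult_right_mono)
  also have "\<dots> = 2 * 2 ^ e * ((real (card (transversals D)) / 2 ^ e) * nrm w)" by simp
  also have "\<dots> \<le> 2 * 2 ^ e * (lam * nrm w)"
    using l nrm_nonneg by (intro mult_left_mono mult_right_mono) auto
  also have "\<dots> \<le> 2 * 2 ^ e * level_form e w w" using lam(1)[OF w] by (intro mult_left_mono) auto
  finally show ?thesis .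
qed


section \<open>Convolution on high levels\<close>

lemma double_transposition_G:
  assumes "a \<in> {1..n}" "b \<in> {1..n}" "c \<in> {1..n}" "d \<in> {1..n}" "a \<noteq> b" "c \<noteq> d"
  shows "transpose a b \<circ> transpose c d \<in> G"
proof -
  have "evenperm (transpose a b \<circ> transpose c d)"
    using assms by (simp add: evenperm_comp permutation_swap_id evenperm_swap)
  then show ?thesis using assms by (auto simp: G_def intro!: permutes_compose permutes_swap_id)
qed

text \<open>Double transpositions of four distinct points generate the alternating group on at least
  five points: two transpositions sharing a point are completed by a further disjoint one, inserted
  twice. On four points they generate only the Klein group.\<close>

lemma double_transpositions_generate:
  fixes Y :: "nat set" and v :: "(nat \<Rightarrow> nat) \<Rightarrow> real"
  assumes Y: "finite Y" "5 \<le> card Y"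
    and inv: "\<And>a b c d \<sigma>. a \<in> Y \<Longrightarrow> b \<in> Y \<Longrightarrow> c \<in> Y \<Longrightarrow> d \<in> Y \<Longrightarrow> distinct [a, b, c, d] \<Longrightarrow>
      v (\<sigma> \<circ> (transpose a b \<circ> transpose c d)) = v \<sigma>"
    and p: "p permutes Y" "evenperm p"
  shows "v (\<sigma> \<circ> p) = v \<sigma>"
proof -
  define I where "I q \<longleftrightarrow> (\<forall>\<sigma>. v (\<sigma> \<circ> q) = v \<sigma>)" for q :: "nat \<Rightarrow> nat"
  have comp: "I (q \<circ> q')" if "I q" "I q'" for q q'
    using that unfolding I_def by (metis o_assoc)
  have ex2: "\<exists>e f. e \<in> Y \<and> f \<in> Y \<and> e \<noteq> f \<and> e \<notin> Z \<and> f \<notin> Z" if "finite Z" "card Z \<le> 3" for Z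
  proof -
    have "2 \<le> card (Y - Z)" using diff_card_le_card_Diff[OF that(1), of Y] that Y by linarith
    then obtain T where T: "T \<subseteq> Y - Z" "card T = 2" using obtain_subset_with_card_n by metis
    then obtain e f where "T = {e, f}" "e \<noteq> f" using card_2_iff by metis
    then show ?thesis using T by blast
  qed
  have disj: "I (transpose a b \<circ> transpose c d)" if "a \<in> Y" "b \<in> Y" "c \<in> Y" "d \<in> Y" "distinct [a, b, c, d]" for a b c d
    using inv[OF that] by (simp add: I_def)
  have share: "I (transpose a b \<circ> transpose a d)" if "a \<in> Y" "b \<in> Y" "d \<in> Y" "a \<noteq> b" "a \<noteq> d" for a b d
  proof -
    have "card {a, b, d} \<le> 3" by (simp add: card_insert_if)
    then obtain e f where ef: "e \<in> Y" "f \<in> Y" "e \<noteq> f" "e \<notin> {a, b, d}" "f \<notin> {a, b, d}"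
      using ex2[of "{a, b, d}"] by auto
    have "I ((transpose a b \<circ> transpose e f) \<circ> (transpose e f \<circ> transpose a d))"
      using ef that by (intro comp disj) auto
    moreover have "(transpose a b \<circ> transpose e f) \<circ> (transpose e f \<circ> transpose a d) = transpose a b \<circ> transpose a d"
      by (simp add: fun_eq_iff)
    ultimately show ?thesis by simp
  qed
  have two: "I (transpose a b \<circ> transpose c d)" if "a \<in> Y" "b \<in> Y" "c \<in> Y" "d \<in> Y" "a \<noteq> b" "c \<noteq> d" for a b c d
  proof -
    have "a = c \<or> a = d \<or> b = c \<or> b = d \<or> distinct [a, b, c, d]" using that by auto
    then consider "a = c" | "a = d" | "b = c" | "b = d" | "distinct [a, b, c, d]" by blast
    then show ?thesis
    proof cases
      case 1
      then show ?thesis using share[of a b d] that by simp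
    next
      case 2
      then show ?thesis using share[of a b c] that by (simp add: transpose_commute)
    next
      case 3
      then show ?thesis using share[of b a d] that by (simp add: transpose_commute)
    next
      case 4
      then show ?thesis using share[of b a c] that by (simp add: transpose_commute)
    qed (rule disj[OF that(1-4)])
  qed
  obtain y z where yz: "y \<in> Y" "z \<in> Y" "y \<noteq> z" using ex2[of "{}"] by auto
  \<comment> \<open>A fixed transposition is carried along to make odd permutations even, so that
    the induction can add one transposition at a time.\<close>
  have "(evenperm p \<longrightarrow> I p) \<and> (\<not> evenperm p \<longrightarrow> I (transpose y z \<circ> p))"
    using p(1) Y(1)
  proof (induction p rule: permutes_induct)
    case id
    then show ?case by (simp add: I_def comp_def)
  next
    case (swap a b p)
    have pp: "permutation p" using swap Y(1) permutation_permutes by blast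
    show ?case
    proof (cases "a = b")
      case True
      then show ?thesis using swap by simp
    next
      case False
      then have ev: "evenperm (transpose a b \<circ> p) \<longleftrightarrow> \<not> evenperm p"
        by (simp add: evenperm_comp permutation_swap_id pp evenperm_swap)
      show ?thesis
      proof (cases "evenperm p")
        case True
        then have "I ((transpose y z \<circ> transpose a b) \<circ> p)"
          using swap yz False by (intro comp two) auto
        then show ?thesis using ev True by (simp add: comp_def)
      next
        case nev: False
        then have "I (transpose y z \<circ> p)" using swap by (simp add: comp_def)
        then have "I ((transpose a b \<circ> transpose y z) \<circ> (transpose y z \<circ> p))"
          by (rule comp[rotated]) (use swap yz False in \<open>auto intro: two\<close>)
        moreover have "(transpose a b \<circ> transpose y z) \<circ> (transpose y z \<circ> p) = transpose a b \<circ> p"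
          by (simp add: fun_eq_iff)
        ultimately show ?thesis using ev nev by (simp add: comp_def)
      qed
    qed
  qed
  then show ?thesis using p(2) by (simp add: I_def)
qed

text \<open>Otherwise \<open>w\<close> would be invariant under the alternating group on the
  complement of \<open>D\<close>, hence constant on the cosets fixing \<open>D\<close>; since it
  sums to zero over them, it would vanish.\<close>

lemma ex_moved_by_double_transposition:
  assumes D: "D \<subseteq> {1..n}" "card D + 5 \<le> n" and W: "W \<subseteq> Lev_ge (card D)" "w \<in> W" "w \<noteq> (\<lambda>_. 0)"
  shows "\<exists>a b c d. {a, b, c, d} \<subseteq> {1..n} - D \<and> distinct [a, b, c, d] \<and> R (transpose a b \<circ> transpose c d) w \<noteq> w"
proof (rule ccontr)
  assume neg: "\<not> ?thesis"
  define Y where "Y = {1..n} - D"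
  have finD: "finite D" using D finite_subset by blast
  have cY: "finite Y" "5 \<le> card Y" unfolding Y_def using D finD by (auto simp: card_Diff_subset)
  have inv: "w (\<sigma> \<circ> p) = w \<sigma>" if "p permutes Y" "evenperm p" for \<sigma> p
  proof (rule double_transpositions_generate[OF cY _ that])
    fix a b c d \<sigma> assume *: "a \<in> Y" "b \<in> Y" "c \<in> Y" "d \<in> Y" "distinct [a, b, c, d]"
    then have "R (transpose a b \<circ> transpose c d) w = w" using neg unfolding Y_def by blast
    then show "w (\<sigma> \<circ> (transpose a b \<circ> transpose c d)) = w \<sigma>" by (metis R_apply)
  qed
  have wF: "w \<in> FS" "w \<in> Lev_ge (card D)" using W by (auto simp: Lev_ge_def)
  have "w \<sigma> = 0" if \<sigma>: "\<sigma> \<in> G" for \<sigma>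
  proof -
    have "w \<tau> = w \<sigma>" if \<tau>: "\<tau> \<in> agr D \<sigma>" for \<tau>
    proof -
      define p where "p = inv' \<sigma> \<circ> \<tau>"
      have tG: "\<tau> \<in> G" using agr_G[OF \<tau>] .
      have pG: "p \<in> G" unfolding p_def using \<sigma> tG by blast
      have "p x = x" if "x \<in> D" for x using \<tau> that \<sigma> by (simp add: p_def agr_def)
      then have "p permutes Y"
        unfolding Y_def by (intro permutes_superset[OF G_permutes[OF pG]]) auto
      then have "w (\<sigma> \<circ> p) = w \<sigma>" using inv pG by (simp add: G_def)
      then show ?thesis using \<sigma> by (simp add: p_def)
    qed
    then have "(\<Sum>\<tau>\<in>agr D \<sigma>. w \<tau>) = card (agr D \<sigma>) * w \<sigma>" by simp
    moreover have "(\<Sum>\<tau>\<in>agr D \<sigma>. w \<tau>) = 0" using wF(2) D \<sigma> unfolding Lev_ge_def by blast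
    ultimately show ?thesis using card_agr_pos[OF \<sigma>, of D] by auto
  qed
  then have "w = (\<lambda>_. 0)" using wF(1) by (auto simp: FS_def)
  then show False using W by simp
qed

text \<open>In the last identity a three-cycle conjugates one involution of the Klein group into
  another; it later exchanges eigenspaces of different signs.\<close>

lemma klein_identities:
  assumes "distinct [a, b, c, d]"
  shows "(transpose a b \<circ> transpose c d) \<circ> (transpose a b \<circ> transpose c d) = id"
    "(transpose a c \<circ> transpose b d) \<circ> (transpose a c \<circ> transpose b d) = id"
    "(transpose a b \<circ> transpose c d) \<circ> (transpose a c \<circ> transpose b d) =
      (transpose a c \<circ> transpose b d) \<circ> (transpose a b \<circ> transpose c d)"
    "(transpose a b \<circ> transpose c d) \<circ> (transpose a c \<circ> transpose b d) = transpose a d \<circ> transpose b c"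
    "(transpose a b \<circ> transpose c d) \<circ> (transpose c d \<circ> transpose b c) =
      (transpose c d \<circ> transpose b c) \<circ> (transpose a c \<circ> transpose b d)"
proof -
  have ne: "a \<noteq> b" "a \<noteq> c" "a \<noteq> d" "b \<noteq> c" "b \<noteq> d" "c \<noteq> d"
    "b \<noteq> a" "c \<noteq> a" "d \<noteq> a" "c \<noteq> b" "d \<noteq> b" "d \<noteq> c" using assms by auto
  have ext: "p = q" if "p a = q a" "p b = q b" "p c = q c" "p d = q d"
    "\<And>z. z \<noteq> a \<Longrightarrow> z \<noteq> b \<Longrightarrow> z \<noteq> c \<Longrightarrow> z \<noteq> d \<Longrightarrow> p z = q z" for p q :: "'a \<Rightarrow> 'a"
    using that by (metis ext)
  show "(transpose a b \<circ> transpose c d) \<circ> (transpose a b \<circ> transpose c d) = id"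
    "(transpose a c \<circ> transpose b d) \<circ> (transpose a c \<circ> transpose b d) = id"
    "(transpose a b \<circ> transpose c d) \<circ> (transpose a c \<circ> transpose b d) =
      (transpose a c \<circ> transpose b d) \<circ> (transpose a b \<circ> transpose c d)"
    "(transpose a b \<circ> transpose c d) \<circ> (transpose a c \<circ> transpose b d) = transpose a d \<circ> transpose b c"
    "(transpose a b \<circ> transpose c d) \<circ> (transpose c d \<circ> transpose b c) =
      (transpose c d \<circ> transpose b c) \<circ> (transpose a c \<circ> transpose b d)"
    by (rule ext; simp add: ne)+
qed

text \<open>Antisymmetrising a vector that \<open>x\<close> moves gives the eigenvalue -1 of
  \<open>x\<close>; symmetrising under \<open>y\<close> then gives the second condition, unless the
  result is zero.\<close>

lemma ex_klein_eigenvector: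
  assumes D: "D \<subseteq> {1..n}" "card D + 5 \<le> n" and W: "rinv (agr D id) W" "W \<subseteq> Lev_ge (card D)" "w \<in> W" "w \<noteq> (\<lambda>_. 0)"
  shows "\<exists>a b c d v. {a, b, c, d} \<subseteq> {1..n} - D \<and> distinct [a, b, c, d] \<and> v \<in> W \<and> v \<noteq> (\<lambda>_. 0) \<and>
    R (transpose a b \<circ> transpose c d) v = (\<lambda>\<sigma>. - v \<sigma>) \<and> R (transpose a c \<circ> transpose b d) v = v"
proof -
  obtain a b c d where abcd: "{a, b, c, d} \<subseteq> {1..n} - D" "distinct [a, b, c, d]"
    and moved: "R (transpose a b \<circ> transpose c d) w \<noteq> w"
    using ex_moved_by_double_transposition[OF D W(2-4)] by metis
  define x y where "x = transpose a b \<circ> transpose c d" and "y = transpose a c \<circ> transpose b d"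
  have in_n: "a \<in> {1..n}" "b \<in> {1..n}" "c \<in> {1..n}" "d \<in> {1..n}" using abcd(1) by auto
  have ne: "a \<noteq> b" "c \<noteq> d" "a \<noteq> c" "b \<noteq> d" using abcd(2) by auto
  have notD: "z \<noteq> a \<and> z \<noteq> b \<and> z \<noteq> c \<and> z \<noteq> d" if "z \<in> D" for z using abcd(1) that by blast
  have xD: "x \<in> agr D id" "y \<in> agr D id"
    using double_transposition_G[OF in_n(1,2,3,4) ne(1,2)] double_transposition_G[OF in_n(1,3,2,4) ne(3,4)] notD
    by (simp_all add: agr_def x_def y_def)
  note kl = klein_identities[OF abcd(2), folded x_def y_def]
  have xx: "x \<circ> x = id" "y \<circ> y = id" and xy: "x \<circ> y = y \<circ> x" "x \<circ> y = transpose a d \<circ> transpose b c"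
    and x2: "x = transpose a b \<circ> transpose d c"
    by (rule kl)+ (simp add: x_def transpose_commute)
  have lW: "lin W" using rinvD(1)[OF W(1)] .
  define w1 where "w1 = (\<lambda>\<sigma>. w \<sigma> + (-1) * R x w \<sigma>)"
  have w1: "w1 \<in> W" unfolding w1_def by (rule linD(3)[OF lW W(3) rinvD(2)[OF W(1) xD(1) W(3)]])
  have w1x: "R x w1 = (\<lambda>\<sigma>. - w1 \<sigma>)"
    unfolding w1_def R_lin R_R xx by (simp add: R_def o_assoc[symmetric] xx)
  have w10: "w1 \<noteq> (\<lambda>_. 0)"
  proof
    assume "w1 = (\<lambda>_. 0)"
    then have "R x w = w" by (auto simp: w1_def fun_eq_iff dest: spec)
    then show False using moved by (simp add: x_def)
  qed
  define w2 where "w2 = (\<lambda>\<sigma>. w1 \<sigma> + 1 * R y w1 \<sigma>)"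
  show ?thesis
  proof (cases "w2 = (\<lambda>_. 0)")
    case False
    have "w2 \<in> W" unfolding w2_def by (rule linD(3)[OF lW w1 rinvD(2)[OF W(1) xD(2) w1]])
    moreover have "R x w2 = (\<lambda>\<sigma>. - w2 \<sigma>)"
    proof -
      have "R x (R y w1) = R y (R x w1)" by (simp only: R_R xy)
      then show ?thesis unfolding w2_def R_lin w1x by (simp add: R_def)
    qed
    moreover have "R y w2 = w2"
      unfolding w2_def R_lin R_R xx by (simp add: add.commute)
    ultimately show ?thesis using abcd False unfolding x_def y_def by blast
  next
    \<comment> \<open>Now both \<open>x\<close> and \<open>y\<close> act as -1, so their product
      acts as 1. Exchanging the names of \<open>c\<close> and \<open>d\<close> keeps
      \<open>x\<close> and turns \<open>y\<close> into this product.\<close>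
    case True
    then have "R y w1 = (\<lambda>\<sigma>. - w1 \<sigma>)" unfolding w2_def by (auto simp: fun_eq_iff dest: spec) (smt (verit))
    then have "R (x \<circ> y) w1 = R x (\<lambda>\<sigma>. - w1 \<sigma>)" by (simp add: R_R[symmetric])
    also have "\<dots> = w1" using w1x by (simp add: R_def fun_eq_iff)
    finally have "R (transpose a d \<circ> transpose b c) w1 = w1" unfolding xy(2) .
    moreover have "R (transpose a b \<circ> transpose d c) w1 = (\<lambda>\<sigma>. - w1 \<sigma>)" using w1x x2 by simp
    moreover have "{a, b, d, c} \<subseteq> {1..n} - D" "distinct [a, b, d, c]" using abcd by auto
    ultimately show ?thesis using w1 w10 by blast
  qed
qed

text \<open>Each step doubles the family. The vectors with \<open>x\<close> acting as -1 and
  \<open>y\<close> as 1 form a space invariant under the stabiliser of four more points; the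
  translate by the three-cycle \<open>g\<close> of a family inside it has \<open>x\<close> acting as
  1. The numerical hypotheses keep at most \<open>e\<close> points fixed before each step and five
  free ones.\<close>

lemma ex_orthogonal_family:
  assumes "D \<subseteq> {1..n}" "card D + 4 * j + 1 \<le> n" "rinv (agr D id) W" "W \<subseteq> Lev_ge e" "card D + 4 * j \<le> e + 4" "e \<le> n"
    "w \<in> W" "w \<noteq> (\<lambda>_. 0)"
  shows "\<exists>F. finite F \<and> card F = 2 ^ j \<and> F \<subseteq> W \<and> (\<forall>v\<in>F. v \<noteq> (\<lambda>_. 0)) \<and> (\<forall>u\<in>F. \<forall>v\<in>F. u \<noteq> v \<longrightarrow> ip u v = 0)"
  using assms
proof (induction j arbitrary: D W w)
  case 0
  then show ?case by (intro exI[of _ "{w}"]) auto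
next
  case (Suc j)
  have finD: "finite D" using Suc.prems finite_subset by blast
  have "W \<subseteq> Lev_ge (card D)" using Lev_ge_antimono[of "card D" e] Suc.prems by auto
  then obtain a b c d v where abcd: "{a, b, c, d} \<subseteq> {1..n} - D" "distinct [a, b, c, d]" and v: "v \<in> W" "v \<noteq> (\<lambda>_. 0)"
    "R (transpose a b \<circ> transpose c d) v = (\<lambda>\<sigma>. - v \<sigma>)" "R (transpose a c \<circ> transpose b d) v = v"
  proof -
    have "card D + 5 \<le> n" using Suc.prems(2) by simp
    from ex_klein_eigenvector[OF Suc.prems(1) this Suc.prems(3) \<open>W \<subseteq> Lev_ge (card D)\<close> Suc.prems(7,8)]
    show ?thesis using that by blast
  qed
  define x y g where "x = transpose a b \<circ> transpose c d" and "y = transpose a c \<circ> transpose b d"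
    and "g = transpose c d \<circ> transpose b c"
  have in_n: "a \<in> {1..n}" "b \<in> {1..n}" "c \<in> {1..n}" "d \<in> {1..n}" using abcd(1) by auto
  have ne: "a \<noteq> b" "c \<noteq> d" "b \<noteq> c" using abcd(2) by auto
  have notD: "z \<noteq> a \<and> z \<noteq> b \<and> z \<noteq> c \<and> z \<noteq> d" if "z \<in> D" for z using abcd(1) that by blast
  have xG: "x \<in> G" "g \<in> G" unfolding x_def g_def
    using double_transposition_G[OF in_n(1,2,3,4) ne(1,2)] double_transposition_G[OF in_n(3,4,2,3) ne(2,3)] by auto
  have gD: "g \<in> agr D id" using notD xG by (simp add: agr_def g_def)
  have xg: "x \<circ> g = g \<circ> y" unfolding x_def y_def g_def by (rule klein_identities(5)[OF abcd(2)])
  define D' where "D' = D \<union> {a, b, c, d}"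
  have "card (D \<union> {a, b, c, d}) = card D + card {a, b, c, d}" using abcd finD by (intro card_Un_disjoint) auto
  then have cD': "card D' = card D + 4" using abcd by (simp add: D'_def)
  define W' where "W' = {w \<in> W. R x w = (\<lambda>\<sigma>. - w \<sigma>) \<and> R y w = w}"
  have lW: "lin W" using rinvD(1) Suc.prems by blast
  have "rinv (agr D' id) W'"
    unfolding rinv_def
  proof (intro conjI ballI)
    show "lin W'" unfolding lin_def
    proof (intro conjI ballI allI)
      show "W' \<subseteq> FS" using linD(1)[OF lW] by (auto simp: W'_def)
      show "(\<lambda>_. 0) \<in> W'" using linD(2)[OF lW] by (simp add: W'_def R_def)
      show "(\<lambda>\<sigma>. u \<sigma> + k * v \<sigma>) \<in> W'" if "u \<in> W'" "v \<in> W'" for u v k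
        using that linD(3)[OF lW] by (auto simp: W'_def R_lin)
    qed
    show "R p w \<in> W'" if p: "p \<in> agr D' id" and w: "w \<in> W'" for p w
    proof -
      have pG: "p \<in> G" using agr_G[OF p] .
      have fx: "p z = z" if "z \<in> {a, b, c, d}" for z using p that by (auto simp: agr_def D'_def)
      have nf: "p z \<notin> {a, b, c, d}" if "z \<notin> {a, b, c, d}" for z
        using that fx G_inj[OF pG] by (metis injD)
      have comm: "x \<circ> p = p \<circ> x" "y \<circ> p = p \<circ> y"
      proof -
        have "x (p z) = p (x z) \<and> y (p z) = p (y z)" for z
        proof (cases "z \<in> {a, b, c, d}")
          case True
          have "x z \<in> {a, b, c, d}" "y z \<in> {a, b, c, d}"
            using True by (simp_all add: x_def y_def transpose_def, blast+)
          then show ?thesis using fx True by auto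
        next
          case False
          then show ?thesis using nf[OF False] by (simp add: x_def y_def)
        qed
        then show "x \<circ> p = p \<circ> x" "y \<circ> p = p \<circ> y" by (simp_all add: fun_eq_iff)
      qed
      have "p \<in> agr D id" using p by (auto simp: agr_def D'_def)
      then have "R p w \<in> W" using w rinvD(2)[OF Suc.prems(3)] unfolding W'_def by blast
      moreover have "R x w = (\<lambda>\<sigma>. - w \<sigma>)" "R y w = w" using w unfolding W'_def by blast+
      then have "R x (R p w) = R p (\<lambda>\<sigma>. - w \<sigma>)" "R y (R p w) = R p w" by (metis R_R comm)+
      then have "R x (R p w) = (\<lambda>\<sigma>. - R p w \<sigma>)" "R y (R p w) = R p w"
        unfolding R_def by blast+
      ultimately show ?thesis unfolding W'_def by blast
    qed
  qed
  note rW' = this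
  have vW': "v \<in> W'" using v by (simp add: W'_def x_def y_def)
  have W'L: "W' \<subseteq> Lev_ge e" using Suc.prems by (auto simp: W'_def)
  have D'n: "D' \<subseteq> {1..n}" using Suc.prems abcd by (auto simp: D'_def)
  have bounds: "card D' + 4 * j + 1 \<le> n" "card D' + 4 * j \<le> e + 4" using cD' Suc.prems(2,5) by simp_all
  from Suc.IH[OF D'n bounds(1) rW' W'L bounds(2) Suc.prems(6) vW' v(2)]
  obtain F where FF: "finite F \<and> card F = 2 ^ j \<and> F \<subseteq> W' \<and> (\<forall>v\<in>F. v \<noteq> (\<lambda>_. 0)) \<and>
    (\<forall>u\<in>F. \<forall>v\<in>F. u \<noteq> v \<longrightarrow> ip u v = 0)" ..
  then have F: "finite F" "card F = 2 ^ j" "F \<subseteq> W'" "\<And>v. v \<in> F \<Longrightarrow> v \<noteq> (\<lambda>_. 0)"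
    "\<And>u v. u \<in> F \<Longrightarrow> v \<in> F \<Longrightarrow> u \<noteq> v \<Longrightarrow> ip u v = 0"
    by simp_all
  have "R (inv' g) (R g u) = u" for u unfolding R_R G_inv_o(1)[OF xG(2)] by (rule R_id)
  then have injR: "inj_on (R g) F" by (metis inj_onI)
  \<comment> \<open>Eigenvectors of the isometry \<open>R x\<close> with the eigenvalues -1 and
    1.\<close>
  have cross: "ip u (R g v) = 0" if "u \<in> F" "v \<in> F" for u v
  proof -
    have "R x (R g v) = R g (R y v)" by (simp only: R_R xg)
    then have "R x (R g v) = R g v" using that F(3) by (auto simp: W'_def)
    moreover have "R x u = (\<lambda>\<sigma>. - u \<sigma>)" using that F(3) by (auto simp: W'_def)
    ultimately have "ip u (R g v) = ip (\<lambda>\<sigma>. - u \<sigma>) (R g v)" using ip_R[OF xG(1), of u "R g v"] by simp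
    also have "\<dots> = - ip u (R g v)" by (simp add: ip_def sum_negf)
    finally show ?thesis by simp
  qed
  have FFS: "u \<in> FS" if "u \<in> F" for u using that F(3) linD(1)[OF lW] by (auto simp: W'_def)
  have disj: "F \<inter> R g ` F = {}"
  proof (rule ccontr)
    assume "F \<inter> R g ` F \<noteq> {}"
    then obtain u v where "u \<in> F" "v \<in> F" "u = R g v" by blast
    then have "nrm u = 0" using cross[of u v] by (simp add: nrm_def)
    then show False using nrm_eq_0[OF FFS[OF \<open>u \<in> F\<close>]] F(4)[OF \<open>u \<in> F\<close>] by simp
  qed
  show ?case
  proof (intro exI[of _ "F \<union> R g ` F"] conjI ballI impI)
    show "finite (F \<union> R g ` F)" using F by simp
    show "card (F \<union> R g ` F) = 2 ^ Suc j"
      using F(1,2) disj card_image[OF injR] by (simp add: card_Un_disjoint)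
    show "F \<union> R g ` F \<subseteq> W" using F(3) rinvD(2)[OF Suc.prems(3) gD] by (auto simp: W'_def)
    show "u \<noteq> (\<lambda>_. 0)" if uu: "u \<in> F \<union> R g ` F" for u
    proof
      assume u0: "u = (\<lambda>_. 0)"
      then have "u \<notin> F" using F(4) by blast
      then obtain u' where u': "u' \<in> F" "u = R g u'" using uu by blast
      then have "nrm u' = nrm (\<lambda>_. 0)" using nrm_R[OF xG(2), of u'] u0 by metis
      then have "nrm u' = 0" by (simp add: nrm_def)
      then show False using nrm_eq_0[OF FFS[OF u'(1)]] F(4)[OF u'(1)] by simp
    qed
    show "ip u v = 0" if uv: "u \<in> F \<union> R g ` F" "v \<in> F \<union> R g ` F" "u \<noteq> v" for u v
    proof -
      consider "u \<in> F" "v \<in> F" | "u \<in> F" "v \<in> R g ` F" | "u \<in> R g ` F" "v \<in> F" | "u \<in> R g ` F" "v \<in> R g ` F"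
        using uv by blast
      then show ?thesis
      proof cases
        case 1
        then show ?thesis using F(5) uv by simp
      next
        case 2
        then show ?thesis using cross by auto
      next
        case 3
        then show ?thesis using cross ip_comm[of u v] by auto
      next
        case 4
        then obtain u' v' where "u' \<in> F" "v' \<in> F" "u = R g u'" "v = R g v'" by blast
        then show ?thesis using F(5)[of u' v'] uv ip_R[OF xG(2)] by auto
      qed
    qed
  qed
qed

lemma bessel:
  assumes F: "finite F" "F \<subseteq> FS" "\<And>v. v \<in> F \<Longrightarrow> v \<noteq> (\<lambda>_. 0)"
    "\<And>u v. u \<in> F \<Longrightarrow> v \<in> F \<Longrightarrow> u \<noteq> v \<Longrightarrow> ip u v = 0"
  shows "(\<Sum>v\<in>F. (ip h v)\<^sup>2 / nrm v) \<le> nrm h"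
proof -
  have pos: "0 < nrm v" if "v \<in> F" for v using nrm_pos F that by blast
  define s where "s = (\<lambda>\<sigma>. \<Sum>v\<in>F. ip h v / nrm v * v \<sigma>)"
  define S where "S = (\<Sum>v\<in>F. (ip h v)\<^sup>2 / nrm v)"
  have sv: "ip s v = ip h v" if v: "v \<in> F" for v
  proof -
    have "ip s v = (\<Sum>u\<in>F. ip h u / nrm u * ip u v)" unfolding s_def by (rule ip_sum)
    also have "\<dots> = (\<Sum>u\<in>F. if u = v then ip h v else 0)"
      using F(4) pos v by (intro sum.cong refl) (auto simp: nrm_def[symmetric] dest: less_imp_neq[OF pos])
    finally show ?thesis using v F(1) by simp
  qed
  have "ip s w = (\<Sum>v\<in>F. ip h v / nrm v * ip v w)" for w unfolding s_def by (rule ip_sum)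
  moreover have "ip v s = ip h v" "ip v h = ip h v" if "v \<in> F" for v
    using sv[OF that] by (simp_all add: ip_comm)
  ultimately have "ip s s = S" "ip s h = S" by (simp_all add: S_def power2_eq_square)
  then have "nrm (\<lambda>\<sigma>. h \<sigma> + (-1) * s \<sigma>) = nrm h - S"
    unfolding nrm_lin using ip_comm[of h s] by (simp add: nrm_def)
  then show ?thesis using nrm_nonneg[of "\<lambda>\<sigma>. h \<sigma> + (-1) * s \<sigma>"] by (simp add: S_def)
qed

text \<open>On the extremal subspace every vector has the same ratio, so a family of
  \<open>2 ^ j\<close> orthogonal vectors multiplies it by \<open>2 ^ j\<close>; Bessel's inequality
  in each row of the kernel bounds the total by the Hilbert-Schmidt norm
  \<open>card G * nrm f\<close>.\<close>

lemma high_level_conv: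
  assumes w: "w \<in> Lev_ge e" and j: "4 * j \<le> e + 4" "4 * j + 1 \<le> n" "e \<le> n"
  shows "2 ^ j * nrm (conv f w) \<le> real (card G) * nrm f * nrm w"
proof (cases "w = (\<lambda>_. 0)")
  case True
  have "conv f w = (\<lambda>_. 0)" using True by (simp add: conv_def)
  then show ?thesis using True by (simp add: nrm_def)
next
  case False
  define Q where "Q v w = - ip (conv f v) (conv f w)" for v w
  have "\<exists>lam W'. rinv G W' \<and> W' \<subseteq> Lev_ge e \<and> (\<exists>w\<in>W'. w \<noteq> (\<lambda>_. 0)) \<and>
    (\<forall>v\<in>Lev_ge e. lam * nrm v \<le> Q v v) \<and> (\<forall>w\<in>W'. Q w w = lam * nrm w)"
  proof (rule ex_extremal[where Q = Q, OF rinv_Lev_ge closed_Lev_ge w False])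
    show "continuous_on UNIV (\<lambda>w. Q w w)"
      unfolding Q_def ip_def conv_def by (intro continuous_intros)
    show "Q (\<lambda>\<sigma>. u \<sigma> + c * v \<sigma>) w = Q u w + c * Q v w" for u v w c
      by (simp add: Q_def conv_lin ip_lin)
  qed (auto simp: Q_def ip_comm conv_R ip_R)
  then obtain lam W' w' where W': "rinv G W'" "W' \<subseteq> Lev_ge e" "w' \<in> W'" "w' \<noteq> (\<lambda>_. 0)"
    and lam: "\<And>v. v \<in> Lev_ge e \<Longrightarrow> lam * nrm v \<le> Q v v" "\<And>w. w \<in> W' \<Longrightarrow> Q w w = lam * nrm w" by blast
  obtain F where F: "finite F" "card F = 2 ^ j" "F \<subseteq> W'" "\<And>v. v \<in> F \<Longrightarrow> v \<noteq> (\<lambda>_. 0)"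
    "\<And>u v. u \<in> F \<Longrightarrow> v \<in> F \<Longrightarrow> u \<noteq> v \<Longrightarrow> ip u v = 0"
    using ex_orthogonal_family[of "{}" j W' e w'] W' j by auto
  have FFS: "F \<subseteq> FS" using F(3) linD(1)[OF rinvD(1)[OF W'(1)]] by blast
  have pos: "0 < nrm v" if "v \<in> F" for v using nrm_pos F FFS that by blast
  define h where "h \<sigma> = (\<lambda>b. f (\<sigma> \<circ> inv' b))" for \<sigma> :: "nat \<Rightarrow> nat"
  have "real (card F) * (- lam) = (\<Sum>v\<in>F. nrm (conv f v) / nrm v)"
  proof -
    have "nrm (conv f v) / nrm v = - lam" if "v \<in> F" for v
      using lam(2)[of v] F(3) that pos[OF that] by (auto simp: Q_def nrm_def field_simps)
    then show ?thesis by simp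
  qed
  also have "\<dots> = (\<Sum>v\<in>F. \<Sum>\<sigma>\<in>G. (ip (h \<sigma>) v)\<^sup>2 / nrm v)"
  proof (rule sum.cong)
    fix v
    have "nrm (conv f v) = (\<Sum>\<sigma>\<in>G. (ip (h \<sigma>) v)\<^sup>2)"
      unfolding nrm_def ip_def[of "conv f v"] power2_eq_square h_def
      using conv_ip by (intro sum.cong) auto
    then show "nrm (conv f v) / nrm v = (\<Sum>\<sigma>\<in>G. (ip (h \<sigma>) v)\<^sup>2 / nrm v)" by (simp add: sum_divide_distrib)
  qed simp
  also have "\<dots> = (\<Sum>\<sigma>\<in>G. \<Sum>v\<in>F. (ip (h \<sigma>) v)\<^sup>2 / nrm v)" by (rule sum.swap)
  also have "\<dots> \<le> (\<Sum>\<sigma>\<in>G. nrm (h \<sigma>))" by (intro sum_mono bessel F FFS)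
  also have "\<dots> = (\<Sum>\<sigma>\<in>G. nrm f)"
  proof (rule sum.cong)
    fix \<sigma> assume \<sigma>: "\<sigma> \<in> G"
    have "nrm (h \<sigma>) = (\<Sum>b\<in>G. f (\<sigma> \<circ> b) * f (\<sigma> \<circ> b))"
      unfolding nrm_def ip_def h_def by (rule sum_inv[of "\<lambda>b. f (\<sigma> \<circ> b) * f (\<sigma> \<circ> b)"])
    also have "\<dots> = nrm f" unfolding nrm_def ip_def by (rule sum_L[OF \<sigma>, of "\<lambda>b. f b * f b"])
    finally show "nrm (h \<sigma>) = nrm f" .
  qed simp
  also have "\<dots> = real (card G) * nrm f" by simp
  finally have l: "2 ^ j * (- lam) \<le> real (card G) * nrm f" using F(2) by simp
  have "nrm (conv f w) \<le> - lam * nrm w" using lam(1)[OF w] by (simp add: Q_def nrm_def)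
  then have "2 ^ j * nrm (conv f w) \<le> 2 ^ j * (- lam * nrm w)" by (intro mult_left_mono) auto
  also have "\<dots> = (2 ^ j * (- lam)) * nrm w" by simp
  also have "\<dots> \<le> real (card G) * nrm f * nrm w" using l nrm_nonneg by (rule mult_right_mono)
  finally show ?thesis .
qed

end

section \<open>Products of global sets\<close>

text \<open>
  Conditioning on a pair costs a factor $100^{2 \cdot 2} = 10^8$, and the level inequality needs twice the
  square of that factor.
\<close>

definition level_const :: real where "level_const = 2 * 10 ^ 16"

context alt_pairs begin

text \<open>Globalness with the squares taken out: the squared norm of an indicator is its density,
  so the constant per point is 100^2.\<close>

definition spread :: "((nat \<Rightarrow> nat) \<Rightarrow> real) \<Rightarrow> real \<Rightarrow> bool" where
  "spread f \<epsilon> \<longleftrightarrow> (\<forall>\<sigma>\<in>G. 0 \<le> f \<sigma> \<and> f \<sigma> \<le> 1) \<and>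
    (\<forall>D \<rho>. D \<subseteq> {1..n} \<longrightarrow> card D + 2 \<le> n \<longrightarrow> \<rho> \<in> G \<longrightarrow> av D \<rho> f \<le> 10000 ^ card D * \<epsilon>)"

lemma spread_R:
  assumes f: "spread f \<epsilon>" and \<pi>: "\<pi> \<in> G"
  shows "spread (R \<pi> f) \<epsilon>"
  unfolding spread_def
proof (intro conjI ballI allI impI)
  fix \<sigma> assume "\<sigma> \<in> G"
  then have "\<sigma> \<circ> \<pi> \<in> G" using \<pi> by blast
  then show "0 \<le> R \<pi> f \<sigma>" "R \<pi> f \<sigma> \<le> 1" using f by (auto simp: spread_def)
next
  fix D \<rho> assume D: "D \<subseteq> {1..n}" "card D + 2 \<le> n" "\<rho> \<in> G"
  define E where "E = inv' \<pi> ` D"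
  have pE: "\<pi> ` E = D" using \<pi> by (force simp: E_def image_image)
  have "E \<subseteq> {1..n}" using G_in[OF G_inv[OF \<pi>]] D by (auto simp: E_def)
  moreover have cE: "card E = card D" unfolding E_def
    by (rule card_image[OF inj_on_subset[OF G_inj[OF G_inv[OF \<pi>]] subset_UNIV]])
  moreover have "\<rho> \<circ> \<pi> \<in> G" using D \<pi> by blast
  ultimately have "av E (\<rho> \<circ> \<pi>) f \<le> 10000 ^ card E * \<epsilon>" using f D unfolding spread_def by metis
  then show "av D \<rho> (R \<pi> f) \<le> 10000 ^ card D * \<epsilon>"
    using av_right[OF \<pi>, of E \<rho> f] unfolding pE cE R_def by simp
qed

lemma spread_reflect:
  assumes f: "spread f \<epsilon>" and x: "x \<in> G"
  shows "spread (\<lambda>\<sigma>. f (inv' \<sigma> \<circ> x)) \<epsilon>"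
  unfolding spread_def
proof (intro conjI ballI allI impI)
  fix \<sigma> assume "\<sigma> \<in> G"
  then have "inv' \<sigma> \<circ> x \<in> G" using x by blast
  then show "0 \<le> f (inv' \<sigma> \<circ> x)" "f (inv' \<sigma> \<circ> x) \<le> 1" using f by (auto simp: spread_def)
next
  fix D \<rho> assume D: "D \<subseteq> {1..n}" "card D + 2 \<le> n" "\<rho> \<in> G"
  define E where "E = inv' x ` \<rho> ` D"
  have "\<rho> y \<in> {1..n}" if "y \<in> D" for y using G_in[OF D(3)] D that by blast
  then have En: "E \<subseteq> {1..n}" using G_in[OF G_inv[OF x]] by (auto simp: E_def)
  have cE: "card E = card D" unfolding E_def
    using card_image[OF inj_on_subset[OF G_inj[OF G_inv[OF x]] subset_UNIV], of "\<rho> ` D"]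
      card_image[OF inj_on_subset[OF G_inj[OF D(3)] subset_UNIV], of D] by simp
  have g: "inv' \<rho> \<circ> x \<in> G" using D x by blast
  have bij: "bij_betw (\<lambda>\<sigma>. inv' \<sigma> \<circ> x) (agr D \<rho>) (agr E (inv' \<rho> \<circ> x))"
  proof (rule bij_betwI[where g = "\<lambda>\<tau>. x \<circ> inv' \<tau>"])
    show "(\<lambda>\<sigma>. inv' \<sigma> \<circ> x) \<in> agr D \<rho> \<rightarrow> agr E (inv' \<rho> \<circ> x)"
    proof
      fix \<sigma> assume s: "\<sigma> \<in> agr D \<rho>"
      have sG: "\<sigma> \<in> G" using agr_G[OF s] .
      have "inv' \<sigma> (\<rho> y) = y" if "y \<in> D" for y
        using s that G_inv_apply(1)[OF sG, of y] by (simp add: agr_def)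
      then show "inv' \<sigma> \<circ> x \<in> agr E (inv' \<rho> \<circ> x)" using sG x D by (auto simp: agr_def E_def)
    qed
    show "(\<lambda>\<tau>. x \<circ> inv' \<tau>) \<in> agr E (inv' \<rho> \<circ> x) \<rightarrow> agr D \<rho>"
    proof
      fix \<tau> assume t: "\<tau> \<in> agr E (inv' \<rho> \<circ> x)"
      have tG: "\<tau> \<in> G" using agr_G[OF t] .
      have "x (inv' \<tau> y) = \<rho> y" if "y \<in> D" for y
      proof -
        have "\<tau> (inv' x (\<rho> y)) = y" using t that x D by (auto simp: agr_def E_def)
        then have "inv' \<tau> y = inv' x (\<rho> y)" using G_inv_apply(1)[OF tG] by metis
        then show ?thesis using x by simp
      qed
      then show "x \<circ> inv' \<tau> \<in> agr D \<rho>" using tG x by (auto simp: agr_def)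
    qed
    show "x \<circ> inv' (inv' \<sigma> \<circ> x) = \<sigma>" if "\<sigma> \<in> agr D \<rho>" for \<sigma>
      using agr_G[OF that] x by (simp add: G_inv_comp G_inv)
    show "inv' (x \<circ> inv' \<tau>) \<circ> x = \<tau>" if "\<tau> \<in> agr E (inv' \<rho> \<circ> x)" for \<tau>
      using agr_G[OF that] x by (simp add: G_inv_comp G_inv)
  qed
  have "av D \<rho> (\<lambda>\<sigma>. f (inv' \<sigma> \<circ> x)) = av E (inv' \<rho> \<circ> x) f"
    unfolding av_def using sum.reindex_bij_betw[OF bij, of f] bij_betw_same_card[OF bij] by simp
  also have "\<dots> \<le> 10000 ^ card E * \<epsilon>" using f En cE D(2) g unfolding spread_def by metis
  finally show "av D \<rho> (\<lambda>\<sigma>. f (inv' \<sigma> \<circ> x)) \<le> 10000 ^ card D * \<epsilon>" unfolding cE .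
qed

lemma level_form_le:
  assumes f: "spread f \<epsilon>" and L: "exp (- real L) \<le> \<epsilon>" "16 * L \<le> n" "e \<le> L"
  shows "level_form e f f \<le> (real (card G))\<^sup>2 * (\<epsilon>\<^sup>2 * (level_const * L / e) ^ e)"
proof -
  have level_weight: "level_weight (R \<pi> f) e {} id \<le> (100000000 ^ card ({} :: nat set) * \<epsilon>)\<^sup>2 * (level_const * L / e) ^ e" if \<pi>: "\<pi> \<in> G" for \<pi>
  proof (rule level_inequality)
    have g: "spread (R \<pi> f) \<epsilon>" by (rule spread_R[OF f \<pi>])
    show "0 \<le> R \<pi> f \<sigma> \<and> R \<pi> f \<sigma> \<le> 1" if "\<sigma> \<in> G" for \<sigma> using g that unfolding spread_def by blast
    show "av (pr T) \<rho> (R \<pi> f) \<le> 100000000 ^ card T * \<epsilon>"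
      if T: "T \<subseteq> {..<m}" "card T \<le> L" "\<rho> \<in> G" for T \<rho>
    proof -
      have "finite T" using T finite_subset by blast
      then have c: "card (pr T) = 2 * card T" by (rule card_pr)
      have "av (pr T) \<rho> (R \<pi> f) \<le> 10000 ^ card (pr T) * \<epsilon>"
        using g pr_subset[OF T(1)] card_pr_le[OF T(1)] T(3) unfolding spread_def by blast
      then show ?thesis unfolding c by (simp add: power_mult)
    qed
  qed (use L in \<open>auto simp: level_const_def\<close>)
  have "level_form e f f = (\<Sum>\<pi>\<in>G. \<Sum>T\<in>pair_sets e {}. \<Sum>\<sigma>\<in>G. (phi (R \<pi> f) {} T \<sigma>)\<^sup>2)"
    unfolding level_form_def ip_def
    by (intro sum.cong refl) (simp add: Pj_phi[OF pair_setsD(1)] power2_eq_square)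
  also have "\<dots> = (\<Sum>\<pi>\<in>G. real (card G) * level_weight (R \<pi> f) e {} id)"
    unfolding level_weight_def av_def using card_G_pos G_nonempty by (simp add: sum_divide_distrib[symmetric])
  also have "\<dots> \<le> (\<Sum>\<pi>\<in>G. real (card G) * (\<epsilon>\<^sup>2 * (level_const * L / e) ^ e))"
    using level_weight by (intro sum_mono mult_left_mono) auto
  also have "\<dots> = (real (card G))\<^sup>2 * (\<epsilon>\<^sup>2 * (level_const * L / e) ^ e)" by (simp add: power2_eq_square)
  finally show ?thesis .
qed

section \<open>Splitting the triple product by levels\<close>

lemma ex_projections:
  assumes g: "g0 \<in> Lev_ge 0" "\<And>v. v \<in> Lev_ge 0 \<Longrightarrow> ip (\<lambda>\<sigma>. g \<sigma> - g0 \<sigma>) v = 0" "g \<in> FS"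
  shows "\<exists>p. p 0 = g0 \<and> (\<forall>d. p d \<in> Lev_ge d \<and> (\<forall>v\<in>Lev_ge d. ip (\<lambda>\<sigma>. g \<sigma> - p d \<sigma>) v = 0))"
proof -
  have "\<forall>d. \<exists>p\<in>Lev_ge d. \<forall>v\<in>Lev_ge d. ip (\<lambda>\<sigma>. g \<sigma> - p \<sigma>) v = 0"
    using ex_projection[OF lin_Lev_ge closed_Lev_ge g(3)] by blast
  then obtain q where q: "\<And>d. q d \<in> Lev_ge d" "\<And>d v. v \<in> Lev_ge d \<Longrightarrow> ip (\<lambda>\<sigma>. g \<sigma> - q d \<sigma>) v = 0" by metis
  define p where "p d = (if d = 0 then g0 else q d)" for d
  show ?thesis by (intro exI[of _ p]) (use g q in \<open>auto simp: p_def\<close>)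
qed

lemma nrm_projection_le:
  assumes "p \<in> Lev_ge d" "\<And>v. v \<in> Lev_ge d \<Longrightarrow> ip (\<lambda>\<sigma>. g \<sigma> - p \<sigma>) v = 0"
  shows "nrm p \<le> nrm g"
proof -
  define r where "r = (\<lambda>\<sigma>. g \<sigma> - p \<sigma>)"
  have g: "g = (\<lambda>\<sigma>. r \<sigma> + 1 * p \<sigma>)" by (simp add: r_def)
  have "nrm g = nrm r + 2 * 1 * ip r p + 1\<^sup>2 * nrm p" unfolding g by (rule nrm_lin)
  moreover have "ip r p = 0" unfolding r_def using assms by blast
  ultimately show ?thesis using nrm_nonneg[of r] by simp
qed

lemma level_part:
  assumes d: "Suc d \<le> n"
    and p: "\<And>d. p d \<in> Lev_ge d" "\<And>d v. v \<in> Lev_ge d \<Longrightarrow> ip (\<lambda>\<sigma>. g \<sigma> - p d \<sigma>) v = 0"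
  shows "(\<lambda>\<sigma>. p d \<sigma> - p (Suc d) \<sigma>) \<in> Lev_eq d"
    "\<And>x. x \<in> Lev_eq d \<Longrightarrow> ip (\<lambda>\<sigma>. g \<sigma> - (p d \<sigma> - p (Suc d) \<sigma>)) x = 0"
proof -
  have sub: "Lev_ge (Suc d) \<subseteq> Lev_ge d" by (rule Lev_ge_Suc[OF d])
  have "(\<lambda>\<sigma>. p d \<sigma> + (-1) * p (Suc d) \<sigma>) \<in> Lev_ge d"
    using p(1)[of d] p(1)[of "Suc d"] sub by (intro linD(3)[OF lin_Lev_ge]) auto
  moreover have "ip (\<lambda>\<sigma>. p d \<sigma> - p (Suc d) \<sigma>) v = 0" if "v \<in> Lev_ge (Suc d)" for v
    using p(2)[of v d] p(2)[of v "Suc d"] that sub by (auto simp: ip_diff)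
  ultimately show "(\<lambda>\<sigma>. p d \<sigma> - p (Suc d) \<sigma>) \<in> Lev_eq d" by (simp add: Lev_eq_def)
  fix x assume x: "x \<in> Lev_eq d"
  then have "ip x (p (Suc d)) = 0" "x \<in> Lev_ge d" using p(1) by (auto simp: Lev_eq_def)
  then show "ip (\<lambda>\<sigma>. g \<sigma> - (p d \<sigma> - p (Suc d) \<sigma>)) x = 0"
    using p(2)[of x d] by (simp add: ip_diff ip_comm)
qed

text \<open>Each step splits off one level from both arguments; the cross terms vanish because
  convolution preserves \<open>Lev_ge\<close> and \<open>Lev_eq\<close>.\<close>

lemma telescope:
  assumes L: "L \<le> n"
    and p: "\<And>d. p d \<in> Lev_ge d" "\<And>d v. v \<in> Lev_ge d \<Longrightarrow> ip (\<lambda>\<sigma>. g \<sigma> - p d \<sigma>) v = 0"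
    and q: "\<And>d. q d \<in> Lev_ge d" "\<And>d v. v \<in> Lev_ge d \<Longrightarrow> ip (\<lambda>\<sigma>. h \<sigma> - q d \<sigma>) v = 0"
  shows "ip (conv f (p 0)) (q 0) =
    (\<Sum>d<L. ip (conv f (\<lambda>\<sigma>. p d \<sigma> - p (Suc d) \<sigma>)) (\<lambda>\<sigma>. q d \<sigma> - q (Suc d) \<sigma>)) + ip (conv f (p L)) (q L)"
  using L
proof (induction L)
  case (Suc L)
  define u v where "u = (\<lambda>\<sigma>. p L \<sigma> - p (Suc L) \<sigma>)" and "v = (\<lambda>\<sigma>. q L \<sigma> - q (Suc L) \<sigma>)"
  have u: "u \<in> Lev_eq L" unfolding u_def by (rule level_part(1)[OF Suc.prems p])
  have v: "v \<in> Lev_eq L" unfolding v_def by (rule level_part(1)[OF Suc.prems q])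
  have pL: "p L = (\<lambda>\<sigma>. u \<sigma> + 1 * p (Suc L) \<sigma>)" and qL: "q L = (\<lambda>\<sigma>. v \<sigma> + 1 * q (Suc L) \<sigma>)"
    by (simp_all add: u_def v_def)
  have "ip (conv f u) (q (Suc L)) = 0" using conv_Lev_eq[OF u] q(1)[of "Suc L"] by (simp add: Lev_eq_def)
  moreover have "ip v (conv f (p (Suc L))) = 0"
    using v conv_Lev_ge[OF p(1)[of "Suc L"]] unfolding Lev_eq_def by blast
  then have "ip (conv f (p (Suc L))) v = 0" by (subst ip_comm)
  ultimately have "ip (conv f (p L)) (q L) = ip (conv f u) v + ip (conv f (p (Suc L))) (q (Suc L))"
    unfolding pL qL conv_lin ip_lin ip_lin2 by simp
  then show ?case using Suc by (simp add: u_def v_def)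
qed simp

text \<open>By Cauchy-Schwarz the squared term is at most \<open>nrm (conv f u) * nrm v\<close>.
  Each of the three functions contributes one factor \<open>lam\<close>, and dividing by the number
  of choices of \<open>e\<close> pairs leaves the \<open>e\<close>-th power of a small
  number.\<close>

lemma level_term_le:
  assumes f: "spread f \<epsilon>" and g: "spread g \<epsilon>" and h: "spread h \<epsilon>"
    and L: "exp (- real L) \<le> \<epsilon>" "16 * L \<le> n" "Suc d \<le> L" "12 * L\<^sup>2 + 1 \<le> n" "n \<le> 2 * m + 3" "256 * level_const ^ 3 * real L ^ 3 \<le> real m"
    and u: "u \<in> Lev_eq d" "\<And>x. x \<in> Lev_eq d \<Longrightarrow> ip (\<lambda>\<sigma>. g \<sigma> - u \<sigma>) x = 0"
    and v: "v \<in> Lev_eq d" "\<And>x. x \<in> Lev_eq d \<Longrightarrow> ip (\<lambda>\<sigma>. h \<sigma> - v \<sigma>) x = 0"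
  shows "\<bar>ip (conv f u) v\<bar> \<le> (real (card G))\<^sup>2 * \<epsilon> ^ 3 * (2 / 8 ^ Suc d)"
proof -
  define e where "e = Suc d"
  define N where "N = real (card G)"
  define lam where "lam = \<epsilon>\<^sup>2 * (level_const * L / e) ^ e"
  define b where "b = real (m choose e)"
  have N: "0 < N" using card_G_pos by (simp add: N_def)
  have eps: "0 < \<epsilon>" using L(1) exp_gt_zero[of "- real L"] by linarith
  have eL: "1 \<le> e" "e \<le> L" using L by (auto simp: e_def)
  have lam0: "0 \<le> lam" by (simp add: lam_def level_const_def)
  have "e\<^sup>2 \<le> L\<^sup>2" using eL by (intro power_mono) auto
  then have n12: "12 * (Suc d)\<^sup>2 + 1 \<le> n" using L(4) unfolding e_def by linarith
  have em: "e \<le> m"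
  proof -
    have "real L ^ 1 \<le> real L ^ 3" using eL by (intro power_increasing) auto
    also have "\<dots> \<le> 256 * level_const ^ 3 * real L ^ 3" by (simp add: level_const_def)
    finally show ?thesis using L(6) eL by simp
  qed
  have b1: "(real m / e) ^ e \<le> b" unfolding b_def by (rule binomial_ge_n_over_k_pow_k[OF em])
  have b0: "0 < b" using em by (simp add: b_def)
  have nu: "nrm w \<le> 2 * 2 ^ e * N * lam" if gw: "spread g' \<epsilon>" and w: "w \<in> Lev_eq d" "\<And>x. x \<in> Lev_eq d \<Longrightarrow> ip (\<lambda>\<sigma>. g' \<sigma> - w \<sigma>) x = 0" for g' w
  proof -
    have "N * nrm w \<le> 2 * 2 ^ e * level_form e w w"
      unfolding N_def by (rule low_level_norm[OF w(1) n12 L(5) e_def])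
    also have "\<dots> \<le> 2 * 2 ^ e * level_form e g' g'"
      using level_form_projection[OF rinv_Lev_eq w(1,2), of e] by (intro mult_left_mono) auto
    also have "\<dots> \<le> 2 * 2 ^ e * (N\<^sup>2 * lam)"
      unfolding N_def lam_def using eL by (intro mult_left_mono level_form_le[OF gw L(1,2)]) auto
    finally have "N * nrm w \<le> N * (2 * 2 ^ e * N * lam)" by (simp add: power2_eq_square mult_ac)
    then show ?thesis using N by simp
  qed
  \<comment> \<open>The bound of \<open>low_level_conv\<close> holds for every \<open>T\<close>;
    summing over all of them gains the factor \<open>b\<close> against the single invariant quantity
    \<open>level_form e f f\<close>.\<close>
  have cu: "b * nrm (conv f u) \<le> N\<^sup>2 * lam * nrm u"
  proof -
    have "nrm (conv f u) \<le> (\<Sum>\<pi>\<in>G. nrm (Pj T (R \<pi> f))) * nrm u" if "T \<in> pair_sets e {}" for T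
    proof (rule low_level_conv[OF pair_setsD(1)[OF that] _ _ u(1)])
      show "card T = Suc d" using pair_setsD(3)[OF that] by (simp add: e_def)
      show "2 * Suc d + 2 \<le> n" using em nm by (simp add: e_def)
    qed
    then have "(\<Sum>T\<in>pair_sets e {}. nrm (conv f u)) \<le> (\<Sum>T\<in>pair_sets e {}. (\<Sum>\<pi>\<in>G. nrm (Pj T (R \<pi> f))) * nrm u)"
      by (rule sum_mono)
    also have "\<dots> = level_form e f f * nrm u"
      unfolding sum_distrib_right[symmetric] level_form_def nrm_def[symmetric]
      by (subst sum.swap) (rule refl)
    also have "\<dots> \<le> N\<^sup>2 * lam * nrm u"
      unfolding N_def lam_def using eL by (intro mult_right_mono level_form_le[OF f L(1,2)] nrm_nonneg) auto
    finally have "real (card (pair_sets e {})) * nrm (conv f u) \<le> N\<^sup>2 * lam * nrm u" by simp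
    moreover have "card (pair_sets e {}) = m choose e"
      unfolding pair_sets_def using n_subsets[of "{..<m}" e] by simp
    ultimately show ?thesis by (simp add: b_def)
  qed
  have "b * (ip (conv f u) v)\<^sup>2 \<le> b * (nrm (conv f u) * nrm v)"
    using b0 by (intro mult_left_mono ip_square_le) auto
  also have "\<dots> = (b * nrm (conv f u)) * nrm v" by simp
  also have "\<dots> \<le> (N\<^sup>2 * lam * nrm u) * nrm v" using cu nrm_nonneg by (rule mult_right_mono)
  also have "\<dots> \<le> (N\<^sup>2 * lam * (2 * 2 ^ e * N * lam)) * (2 * 2 ^ e * N * lam)"
    using nu[OF g u] nu[OF h v] N lam0 nrm_nonneg by (intro mult_mono mult_left_mono) (auto intro!: mult_nonneg_nonneg)
  also have "\<dots> = 4 * (2 ^ e)\<^sup>2 * (N\<^sup>2)\<^sup>2 * lam ^ 3" by (simp add: power2_eq_square power3_eq_cube)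
  also have "\<dots> \<le> b * (N\<^sup>2 * \<epsilon> ^ 3 * (2 / 8 ^ e))\<^sup>2"
  proof -
    have l3: "lam ^ 3 = (\<epsilon> ^ 3)\<^sup>2 * ((level_const * L / e) ^ 3) ^ e"
      by (simp add: lam_def power_mult_distrib flip: power_mult) (simp add: mult.commute)
    \<comment> \<open>The factor 4 here collects the losses \<open>2 ^ e\<close> from both norms,
      and 64 is the square of the ratio 8 wanted for the geometric series; hence the constant 256 in
      the hypothesis on \<open>m\<close>.\<close>
    have base: "4 * (level_const * L / e) ^ 3 \<le> (real m / e) / 64"
    proof -
      have "1 \<le> (real e)\<^sup>2" using eL by simp
      then have "256 * level_const ^ 3 * real L ^ 3 * 1 \<le> real m * (real e)\<^sup>2"
        using L(6) by (intro mult_mono) auto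
      then have "256 * (level_const * L) ^ 3 \<le> real m * (real e)\<^sup>2" by (simp add: power_mult_distrib)
      then have "256 * (level_const * L) ^ 3 / real e ^ 3 \<le> real m * (real e)\<^sup>2 / real e ^ 3"
        by (rule divide_right_mono) simp
      also have "\<dots> = real m / e" using eL by (simp add: power2_eq_square power3_eq_cube)
      finally show ?thesis by (simp add: power_divide)
    qed
    have "4 * (2 ^ e)\<^sup>2 * (N\<^sup>2)\<^sup>2 * lam ^ 3 = 4 * (N\<^sup>2)\<^sup>2 * (\<epsilon> ^ 3)\<^sup>2 * (4 * (level_const * L / e) ^ 3) ^ e"
    proof -
      have "(2 ^ e)\<^sup>2 = (4 :: real) ^ e" by (simp add: power2_eq_square flip: power_mult_distrib)
      then show ?thesis unfolding l3 power_mult_distrib by simp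
    qed
    also have "\<dots> \<le> 4 * (N\<^sup>2)\<^sup>2 * (\<epsilon> ^ 3)\<^sup>2 * ((real m / e) / 64) ^ e"
      using base by (intro mult_left_mono power_mono) (auto simp: level_const_def)
    also have "\<dots> = (N\<^sup>2 * \<epsilon> ^ 3 * (2 / 8 ^ e))\<^sup>2 * (real m / e) ^ e"
    proof -
      have "(8 ^ e)\<^sup>2 = (64 :: real) ^ e" by (simp add: power2_eq_square flip: power_mult_distrib)
      then have "(2 / 8 ^ e)\<^sup>2 = 4 / (64 :: real) ^ e" by (simp add: power_divide)
      then show ?thesis unfolding power_mult_distrib power_divide[of "real m / e"] by simp
    qed
    also have "\<dots> \<le> (N\<^sup>2 * \<epsilon> ^ 3 * (2 / 8 ^ e))\<^sup>2 * b" using b1 by (intro mult_left_mono) auto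
    finally show ?thesis by (simp only: mult.commute)
  qed
  finally have "(ip (conv f u) v)\<^sup>2 \<le> (N\<^sup>2 * \<epsilon> ^ 3 * (2 / 8 ^ e))\<^sup>2" using b0 by simp
  then have "\<bar>ip (conv f u) v\<bar> \<le> \<bar>N\<^sup>2 * \<epsilon> ^ 3 * (2 / 8 ^ e)\<bar>" by (simp only: abs_le_square_iff)
  also have "\<dots> = N\<^sup>2 * \<epsilon> ^ 3 * (2 / 8 ^ e)" using N eps by simp
  finally show ?thesis by (simp add: N_def e_def)
qed

lemma sum_geometric_bound: "(\<Sum>d<L. 2 / 8 ^ Suc d) \<le> (1 / 3 :: real)"
proof -
  have "(\<Sum>d<L. 2 / 8 ^ Suc d) + 2 / 7 / 8 ^ L = (2 / 7 :: real)"
  proof (induction L)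
    case (Suc L)
    have "2 / 8 ^ Suc L + 2 / 7 / 8 ^ Suc L = (2 / 7 / 8 ^ L :: real)" by (simp add: field_simps)
    then show ?case using Suc unfolding sum.lessThan_Suc by linarith
  qed simp
  moreover have "0 \<le> (2 / 7 / 8 ^ L :: real)" by simp
  ultimately show ?thesis by linarith
qed

text \<open>The means contribute \<open>\<alpha> ^ 3 * N\<^sup>2\<close>. The low levels sum to at
  most a third of it and the rest is less than half of it, so no cancellation to zero is
  possible.\<close>

lemma conv_triple_pos:
  assumes f: "spread f \<alpha>" "f \<in> FS" and g: "spread g \<alpha>" "g \<in> FS" and h: "spread h \<alpha>" "h \<in> FS"
    and sums: "sum f G = \<alpha> * card G" "sum g G = \<alpha> * card G" "sum h G = \<alpha> * card G"
    and nrms: "nrm f = \<alpha> * card G" "nrm g = \<alpha> * card G" "nrm h = \<alpha> * card G"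
    and L: "exp (- (real L / 100)) \<le> \<alpha>" "24 \<le> L" "12 * L\<^sup>2 + 1 \<le> n" "n \<le> 2 * m + 3" "256 * level_const ^ 3 * real L ^ 3 \<le> real m"
  shows "ip (conv f g) h \<noteq> 0"
proof
  assume zero: "ip (conv f g) h = 0"
  define N where "N = real (card G)"
  have N: "0 < N" using card_G_pos by (simp add: N_def)
  have al: "0 < \<alpha>" using L(1) exp_gt_zero[of "- (real L / 100)"] by linarith
  have L1: "exp (- real L) \<le> \<alpha>"
  proof -
    have "exp (- real L) \<le> exp (- (real L / 100))" by simp
    then show ?thesis using L(1) by linarith
  qed
  have L2: "24 * L \<le> L\<^sup>2" unfolding power2_eq_square using L(2) by simp
  have nL: "16 * L \<le> n" "L \<le> n" using L2 L(3) by linarith+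
  define c where "c = (\<lambda>\<sigma>. if \<sigma> \<in> G then 1 else 0 :: real)"
  \<comment> \<open>Subtracting the mean is the projection onto \<open>Lev_ge 0\<close>.\<close>
  define z where "z w = (\<lambda>\<sigma>. w \<sigma> + (- \<alpha>) * c \<sigma>)" for w :: "(nat \<Rightarrow> nat) \<Rightarrow> real"
  have ipc: "ip c v = sum v G" for v by (simp add: ip_def c_def)
  have Lev_ge0: "v \<in> Lev_ge 0 \<longleftrightarrow> v \<in> FS \<and> sum v G = 0" for v
  proof
    assume "v \<in> Lev_ge 0"
    then have "v \<in> FS" "\<forall>\<rho>\<in>G. sum v (agr {} \<rho>) = 0" unfolding Lev_ge_def by force+
    then show "v \<in> FS \<and> sum v G = 0" using G_id by auto
  next
    assume v: "v \<in> FS \<and> sum v G = 0"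
    have "sum v (agr D \<rho>) = 0" if "D \<subseteq> {1..n}" "card D = 0" for D \<rho>
    proof -
      have "D = {}" using that finite_subset[OF that(1)] by simp
      then show ?thesis using v by simp
    qed
    then show "v \<in> Lev_ge 0" using v unfolding Lev_ge_def by blast
  qed
  have zL: "z w \<in> Lev_ge 0" "\<And>v. v \<in> Lev_ge 0 \<Longrightarrow> ip (\<lambda>\<sigma>. w \<sigma> - z w \<sigma>) v = 0" if w: "w \<in> FS" "sum w G = \<alpha> * card G" for w
  proof -
    have "sum (z w) G = 0" using w by (simp add: z_def c_def sum_subtractf)
    then show "z w \<in> Lev_ge 0" using w by (auto simp: Lev_ge0 z_def c_def FS_def)
    show "ip (\<lambda>\<sigma>. w \<sigma> - z w \<sigma>) v = 0" if "v \<in> Lev_ge 0" for v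
    proof -
      have "ip (\<lambda>\<sigma>. w \<sigma> - z w \<sigma>) v = \<alpha> * ip c v"
        by (simp add: z_def ip_def sum_distrib_left mult.assoc)
      then show ?thesis using that by (simp add: ipc Lev_ge0)
    qed
  qed
  obtain p where p: "p 0 = z g" "\<And>d. p d \<in> Lev_ge d" "\<And>d v. v \<in> Lev_ge d \<Longrightarrow> ip (\<lambda>\<sigma>. g \<sigma> - p d \<sigma>) v = 0"
    using ex_projections[OF zL[OF g(2) sums(2)] g(2)] by blast
  obtain q where q: "q 0 = z h" "\<And>d. q d \<in> Lev_ge d" "\<And>d v. v \<in> Lev_ge d \<Longrightarrow> ip (\<lambda>\<sigma>. h \<sigma> - q d \<sigma>) v = 0"
    using ex_projections[OF zL[OF h(2) sums(3)] h(2)] by blast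
  have main: "ip (conv f g) h = \<alpha> ^ 3 * N\<^sup>2 + ip (conv f (p 0)) (q 0)"
  proof -
    have cc: "conv f c \<sigma> = \<alpha> * N" if "\<sigma> \<in> G" for \<sigma>
      using that sums(1) comp_left_iff[OF G_inv] by (simp add: conv_def c_def N_def)
    have gz: "g = (\<lambda>\<sigma>. z g \<sigma> + \<alpha> * c \<sigma>)" and hz: "h = (\<lambda>\<sigma>. z h \<sigma> + \<alpha> * c \<sigma>)"
      by (simp_all add: z_def)
    have "ip (conv f c) (z h) = (\<Sum>\<sigma>\<in>G. \<alpha> * N * z h \<sigma>)" unfolding ip_def using cc by (intro sum.cong) auto
    then have 1: "ip (conv f c) (z h) = 0"
      using zL(1)[OF h(2) sums(3)] by (simp add: Lev_ge0 flip: sum_distrib_left)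
    have 2: "ip (conv f (z g)) c = 0"
      using conv_Lev_ge[OF zL(1)[OF g(2) sums(2)], of f] by (simp add: Lev_ge0 ipc ip_comm[of _ c])
    have "ip (conv f c) c = (\<Sum>\<sigma>\<in>G. \<alpha> * N)" unfolding ip_def using cc by (intro sum.cong) (auto simp: c_def)
    then have 3: "ip (conv f c) c = \<alpha> * N\<^sup>2" by (simp add: N_def power2_eq_square)
    have "ip (conv f g) h = ip (conv f (\<lambda>\<sigma>. z g \<sigma> + \<alpha> * c \<sigma>)) (\<lambda>\<sigma>. z h \<sigma> + \<alpha> * c \<sigma>)"
      using gz hz by simp
    also have "\<dots> = ip (conv f (z g)) (z h) + \<alpha> * (\<alpha> * (\<alpha> * N\<^sup>2))"
      unfolding conv_lin ip_lin ip_lin2 1 2 3 by simp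
    finally show ?thesis unfolding p q by (simp add: power3_eq_cube)
  qed
  define S where "S = (\<Sum>d<L. ip (conv f (\<lambda>\<sigma>. p d \<sigma> - p (Suc d) \<sigma>)) (\<lambda>\<sigma>. q d \<sigma> - q (Suc d) \<sigma>))"
  define H where "H = ip (conv f (p L)) (q L)"
  have tel: "ip (conv f (p 0)) (q 0) = S + H"
    unfolding S_def H_def by (rule telescope[OF nL(2) p(2,3) q(2,3)])
  have "\<bar>S\<bar> \<le> (\<Sum>d<L. \<bar>ip (conv f (\<lambda>\<sigma>. p d \<sigma> - p (Suc d) \<sigma>)) (\<lambda>\<sigma>. q d \<sigma> - q (Suc d) \<sigma>)\<bar>)"
    unfolding S_def by (rule sum_abs)
  also have "\<dots> \<le> (\<Sum>d<L. N\<^sup>2 * \<alpha> ^ 3 * (2 / 8 ^ Suc d))"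
  proof (rule sum_mono)
    fix d assume d: "d \<in> {..<L}"
    then have dn: "Suc d \<le> n" "Suc d \<le> L" using nL by auto
    show "\<bar>ip (conv f (\<lambda>\<sigma>. p d \<sigma> - p (Suc d) \<sigma>)) (\<lambda>\<sigma>. q d \<sigma> - q (Suc d) \<sigma>)\<bar> \<le> N\<^sup>2 * \<alpha> ^ 3 * (2 / 8 ^ Suc d)"
      unfolding N_def
      by (rule level_term_le[OF f(1) g(1) h(1) L1 nL(1) dn(2) L(3,4,5) level_part[OF dn(1) p(2,3)] level_part[OF dn(1) q(2,3)]])
  qed
  also have "\<dots> = N\<^sup>2 * \<alpha> ^ 3 * (\<Sum>d<L. 2 / 8 ^ Suc d)" by (simp only: sum_distrib_left)
  also have "\<dots> \<le> N\<^sup>2 * \<alpha> ^ 3 * (1 / 3)"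
    using al by (intro mult_left_mono sum_geometric_bound) auto
  finally have S: "\<bar>S\<bar> \<le> N\<^sup>2 * \<alpha> ^ 3 * (1 / 3)" .
  define j where "j = L div 4 + 1"
  have j: "4 * j \<le> L + 4" "L \<le> 4 * j" "4 * j + 1 \<le> n" 
  proof -
    define k r where "k = L div 4" and "r = L mod 4"
    have "L = 4 * k + r" "r < 4" "j = k + 1" by (simp_all add: k_def r_def j_def)
    then show "4 * j \<le> L + 4" "L \<le> 4 * j" "4 * j + 1 \<le> n" using nL L(2) by linarith+
  qed
  have "2 ^ j * H\<^sup>2 \<le> 2 ^ j * (nrm (conv f (p L)) * nrm (q L))"
    unfolding H_def by (intro mult_left_mono ip_square_le) auto
  also have "\<dots> = (2 ^ j * nrm (conv f (p L))) * nrm (q L)" by simp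
  also have "\<dots> \<le> (N * nrm f * nrm (p L)) * nrm (q L)"
    unfolding N_def by (intro mult_right_mono high_level_conv[OF p(2) j(1,3) nL(2)] nrm_nonneg)
  also have "\<dots> \<le> (N * nrm f * nrm g) * nrm h"
    using N nrm_nonneg nrm_projection_le[OF p(2,3)] nrm_projection_le[OF q(2,3)]
    by (intro mult_mono mult_left_mono) (auto intro!: mult_nonneg_nonneg)
  also have "\<dots> = (N\<^sup>2)\<^sup>2 * \<alpha> ^ 3" unfolding nrms N_def[symmetric] by (simp add: power2_eq_square power3_eq_cube)
  finally have H1: "2 ^ j * H\<^sup>2 \<le> (N\<^sup>2)\<^sup>2 * \<alpha> ^ 3" .
  \<comment> \<open>As 2 is at least exp(1/2) and \<open>j\<close> at least L/4, the product is at
    least exp(L/8 - 3L/100) = exp(0.095 L). For \<open>L\<close> at least 24 the exponent exceeds 2,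
    and exp 2 is at least 4.\<close>
  have big: "4 < 2 ^ j * \<alpha> ^ 3"
  proof -
    have "exp (1/2 :: real) \<le> 2"
    proof (rule power2_le_imp_le)
      have "(exp (1/2 :: real))\<^sup>2 = exp 1" by (simp add: power2_eq_square flip: exp_add)
      then show "(exp (1/2 :: real))\<^sup>2 \<le> 2\<^sup>2" using exp_le by simp
    qed simp
    then have "exp (1/2) ^ j \<le> (2 :: real) ^ j" by (intro power_mono) auto
    moreover have "exp (1/2) ^ j = exp (real j * (1/2 :: real))" by (rule exp_of_nat_mult[symmetric])
    moreover have "exp (real L / 8) \<le> exp (real j * (1/2))" using j(2) by simp
    ultimately have 1: "exp (real L / 8) \<le> 2 ^ j" by linarith
    have "exp (- (real L / 100)) ^ 3 \<le> \<alpha> ^ 3" using L(1) by (intro power_mono) auto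
    then have 2: "exp (3 * (- (real L / 100))) \<le> \<alpha> ^ 3" using exp_of_nat_mult[of 3 "- (real L / 100)"] by simp
    have "(4::real) = 2 * 2" by simp
    also have "\<dots> \<le> exp 1 * exp 1" using exp_ge_add_one_self[of "1::real"] by (intro mult_mono) auto
    also have "\<dots> = exp (2 :: real)" by (simp flip: exp_add)
    also have "\<dots> < exp (real L / 8 + 3 * (- (real L / 100)))" using L(2) by simp
    also have "\<dots> = exp (real L / 8) * exp (3 * (- (real L / 100)))" by (rule exp_add)
    also have "\<dots> \<le> 2 ^ j * \<alpha> ^ 3" using 1 2 by (intro mult_mono) auto
    finally show ?thesis .
  qed
  have "4 * H\<^sup>2 < (N\<^sup>2 * \<alpha> ^ 3)\<^sup>2"
  proof -
    have a3: "0 < \<alpha> ^ 3" using al by simp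
    have "\<alpha> ^ 3 * (2 ^ j * H\<^sup>2) \<le> \<alpha> ^ 3 * ((N\<^sup>2)\<^sup>2 * \<alpha> ^ 3)" using H1 a3 by (intro mult_left_mono) auto
    then have 1: "(2 ^ j * \<alpha> ^ 3) * H\<^sup>2 \<le> (N\<^sup>2 * \<alpha> ^ 3)\<^sup>2" by (simp add: power2_eq_square mult_ac)
    show ?thesis
    proof (cases "H = 0")
      case True
      then show ?thesis using N al by simp
    next
      case False
      then have "4 * H\<^sup>2 < (2 ^ j * \<alpha> ^ 3) * H\<^sup>2" using big by (intro mult_strict_right_mono) auto
      then show ?thesis using 1 by linarith
    qed
  qed
  then have "(2 * H)\<^sup>2 < (N\<^sup>2 * \<alpha> ^ 3)\<^sup>2" by (simp add: power_mult_distrib)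
  then have "\<bar>2 * H\<bar> < \<bar>N\<^sup>2 * \<alpha> ^ 3\<bar>"
    using abs_le_square_iff[of "N\<^sup>2 * \<alpha> ^ 3" "2 * H"] by linarith
  then have "\<bar>2 * H\<bar> < N\<^sup>2 * \<alpha> ^ 3" using al by simp
  moreover have "N\<^sup>2 * \<alpha> ^ 3 + S + H = 0" using zero main tel by (simp add: mult.commute)
  moreover have "0 < N\<^sup>2 * \<alpha> ^ 3" using N al by simp
  moreover have "- (N\<^sup>2 * \<alpha> ^ 3 * (1 / 3)) \<le> S" "- \<bar>2 * H\<bar> \<le> 2 * H" using S by linarith+
  ultimately show False by linarith
qed


section \<open>Indicators of global sets\<close>

lemma carrier_alt: "carrier (alt_group n) = G"
  by (auto simp: alt_group_carrier G_def)

lemma l2_norm_indicator: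
  assumes "finite U"
  shows "(l2_norm U (indicator A))\<^sup>2 = real (card (A \<inter> U)) / real (card U)"
proof -
  have "(\<Sum>x\<in>U. \<bar>indicator A x :: real\<bar>\<^sup>2) = (\<Sum>x\<in>U. if x \<in> A then 1 else 0)"
    by (intro sum.cong) (auto simp: indicator_def)
  also have "\<dots> = real (card (U \<inter> A))" using assms by (simp add: sum.If_cases)
  finally show ?thesis by (simp add: l2_norm_def Int_commute)
qed

text \<open>Globalness is measured in the full symmetric group, \<open>spread\<close> in the
  alternating group. Passing between them halves the density on the whole group, and on the umvirate
  by at most the same factor, so the two effects cancel.\<close>

lemma spread_indicator:
  assumes A: "A \<subseteq> G" and glo: "is_global n 100 A" and \<alpha>: "\<alpha> = real (card A) / real (card G)"
  shows "spread (indicator A) \<alpha>"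
  unfolding spread_def
proof (intro conjI ballI allI impI)
  fix D \<rho> assume D: "D \<subseteq> {1..n}" "card D + 2 \<le> n" and \<rho>: "\<rho> \<in> G"
  have finD: "finite D" using D finite_subset by blast
  define I where "I = sorted_list_of_set D"
  define J where "J = map \<rho> I"
  define U where "U = umvirate n I J"
  define P where "P = carrier (sym_group n)"
  have P: "P = {p. p permutes {1..n}}" by (auto simp: P_def sym_group_carrier)
  have finP: "finite P" unfolding P by (simp add: finite_permutations)
  have cP: "card P = 2 * card G" unfolding P card_G by (simp add: card_permutations)
  have setI: "set I = D" "distinct I" "length I = card D" using finD by (auto simp: I_def)
  have U: "U = {\<sigma> \<in> P. \<forall>x\<in>D. \<sigma> x = \<rho> x}"
    unfolding U_def umvirate_def P_def J_def setI(1)[symmetric]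
    by (auto simp: all_set_conv_all_nth in_set_conv_nth)
  have finU: "finite U" using finP by (simp add: U)
  have "I \<in> distinct_tuples n (card D)" using setI D by (auto simp: distinct_tuples_def)
  moreover have "J \<in> distinct_tuples n (card D)"
    using setI D G_in[OF \<rho>] inj_on_subset[OF G_inj[OF \<rho>] subset_UNIV, of D]
    by (auto simp: distinct_tuples_def J_def distinct_map)
  ultimately have "l2_norm U (indicator A) \<le> 100 ^ card D * l2_norm P (indicator A)"
    using glo unfolding is_global_def U_def P_def by blast
  moreover have "0 \<le> l2_norm U (indicator A)" by (simp add: l2_norm_def sum_nonneg)
  ultimately have "(l2_norm U (indicator A))\<^sup>2 \<le> (100 ^ card D * l2_norm P (indicator A))\<^sup>2"
    by (rule power_mono)
  also have "\<dots> = (100 ^ card D)\<^sup>2 * (l2_norm P (indicator A))\<^sup>2" by (rule power_mult_distrib)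
  also have "(100 ^ card D)\<^sup>2 = (10000 :: real) ^ card D" by (simp add: power2_eq_square flip: power_mult_distrib)
  finally have le: "real (card (A \<inter> U)) / real (card U) \<le> 10000 ^ card D * (real (card (A \<inter> P)) / real (card P))"
    unfolding l2_norm_indicator[OF finU] l2_norm_indicator[OF finP] .
  have AP: "A \<inter> P = A" using A by (auto simp: P G_def)
  have AU: "A \<inter> U = A \<inter> agr D \<rho>" using A by (auto simp: U P agr_def G_def)
  \<comment> \<open>A transposition of two points outside \<open>D\<close> maps the odd elements of
    the umvirate injectively to even ones.\<close>
  have cU: "card U \<le> 2 * card (agr D \<rho>)"
  proof -
    have "2 \<le> card ({1..n} - D)" using D finD by (simp add: card_Diff_subset)
    then obtain T where T: "T \<subseteq> {1..n} - D" "card T = 2" using obtain_subset_with_card_n by metis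
    obtain x y where xy: "T = {x, y}" "x \<noteq> y" using T(2) card_2_iff by metis
    have "(\<lambda>\<sigma>. \<sigma> \<circ> transpose x y) ` (U - agr D \<rho>) \<subseteq> agr D \<rho>"
    proof (intro image_subsetI)
      fix \<sigma> assume "\<sigma> \<in> U - agr D \<rho>"
      then have s: "\<sigma> permutes {1..n}" "\<not> evenperm \<sigma>" "\<And>z. z \<in> D \<Longrightarrow> \<sigma> z = \<rho> z"
        by (auto simp: U P agr_def G_def)
      have "permutation \<sigma>" using s(1) permutation_permutes by blast
      then have "evenperm (\<sigma> \<circ> transpose x y)"
        using s(2) xy by (simp add: evenperm_comp permutation_swap_id evenperm_swap)
      moreover have "\<sigma> \<circ> transpose x y permutes {1..n}"
        using s(1) xy T by (intro permutes_compose permutes_swap_id) auto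
      moreover have "(\<sigma> \<circ> transpose x y) z = \<rho> z" if "z \<in> D" for z
        using s(3)[OF that] that xy T by (auto simp: transpose_def)
      ultimately show "\<sigma> \<circ> transpose x y \<in> agr D \<rho>" by (simp add: agr_def G_def)
    qed
    moreover have "inj_on (\<lambda>\<sigma>. \<sigma> \<circ> transpose x y) (U - agr D \<rho>)"
    proof (rule inj_onI)
      fix p q assume "p \<circ> transpose x y = q \<circ> transpose x y"
      then have "(p \<circ> transpose x y) \<circ> transpose x y = (q \<circ> transpose x y) \<circ> transpose x y" by simp
      then show "p = q" by (simp add: comp_def)
    qed
    ultimately have "card (U - agr D \<rho>) \<le> card (agr D \<rho>)"
      by (intro card_inj_on_le[where f = "\<lambda>\<sigma>. \<sigma> \<circ> transpose x y"]) auto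
    moreover have "card U \<le> card (agr D \<rho>) + card (U - agr D \<rho>)"
      using card_mono[of "agr D \<rho> \<union> (U - agr D \<rho>)" U] card_Un_le[of "agr D \<rho>" "U - agr D \<rho>"] finU by auto
    ultimately show ?thesis by linarith
  qed
  have cpos: "0 < real (card (agr D \<rho>))" using card_agr_pos[OF \<rho>] by simp
  have Upos: "0 < real (card U)"
    using finU \<rho> by (auto simp: card_gt_0_iff U P G_def)
  have "real (card (A \<inter> agr D \<rho>)) \<le> 10000 ^ card D * (\<alpha> / 2) * real (card U)"
    using le Upos unfolding AP AU cP \<alpha> by (simp add: pos_divide_le_eq)
  also have "\<dots> \<le> 10000 ^ card D * (\<alpha> / 2) * (2 * real (card (agr D \<rho>)))"
    using cU by (intro mult_left_mono) (auto simp: \<alpha>)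
  finally have "real (card (A \<inter> agr D \<rho>)) / real (card (agr D \<rho>)) \<le> 10000 ^ card D * \<alpha>"
    using cpos by (simp add: pos_divide_le_eq mult_ac)
  moreover have "(\<Sum>\<sigma>\<in>agr D \<rho>. indicator A \<sigma>) = real (card (A \<inter> agr D \<rho>))"
    by (simp add: indicator_def sum.If_cases Int_commute)
  ultimately show "av D \<rho> (indicator A) \<le> 10000 ^ card D * \<alpha>" by (simp add: av_def)
qed (auto simp: indicator_def)

lemma dense_global_product:
  assumes A: "A \<subseteq> G" "is_global n 100 A" and \<alpha>: "\<alpha> = real (card A) / real (card G)"
    and L: "exp (- (real L / 100)) \<le> \<alpha>" "24 \<le> L" "12 * L\<^sup>2 + 1 \<le> n" "n \<le> 2 * m + 3" "256 * level_const ^ 3 * real L ^ 3 \<le> real m"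
    and x: "x \<in> G"
  shows "\<exists>a\<in>A. \<exists>b\<in>A. \<exists>c\<in>A. a \<circ> b \<circ> c = x"
proof -
  define f where "f = (indicator A :: (nat \<Rightarrow> nat) \<Rightarrow> real)"
  define h where "h = (\<lambda>\<sigma>. f (inv' \<sigma> \<circ> x))"
  \<comment> \<open>Outside the group \<open>inv'\<close> may be applied to maps that are not
    bijections; cutting off there puts the function into \<open>FS\<close>.\<close>
  define h' where "h' \<sigma> = (if \<sigma> \<in> G then h \<sigma> else 0)" for \<sigma>
  have cG: "0 < real (card G)" using card_G_pos by simp
  have f: "spread f \<alpha>" unfolding f_def by (rule spread_indicator[OF A \<alpha>])
  have h: "spread h \<alpha>" unfolding h_def by (rule spread_reflect[OF f x])
  have h'av: "av D \<rho> h' = av D \<rho> h" for D \<rho> by (rule av_fun_cong) (auto simp: h'_def dest: agr_G)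
  have h'g: "spread h' \<alpha>" using h unfolding spread_def h'av by (simp add: h'_def)
  have FS: "f \<in> FS" "h' \<in> FS" using A by (auto simp: FS_def f_def h'_def indicator_def)
  have sf: "sum f G = \<alpha> * card G"
  proof -
    have "sum f G = real (card (A \<inter> G))" by (simp add: f_def indicator_def sum.If_cases Int_commute)
    moreover have "A \<inter> G = A" using A by blast
    ultimately show ?thesis using cG G_nonempty by (simp add: \<alpha>)
  qed
  have sh: "(\<Sum>\<sigma>\<in>G. F (h' \<sigma>)) = (\<Sum>\<sigma>\<in>G. F (f \<sigma>))" for F :: "real \<Rightarrow> real"
  proof -
    have "(\<Sum>\<sigma>\<in>G. F (h' \<sigma>)) = (\<Sum>\<sigma>\<in>G. F (f (inv' \<sigma> \<circ> x)))" by (simp add: h'_def h_def)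
    also have "\<dots> = (\<Sum>\<sigma>\<in>G. F (f (\<sigma> \<circ> x)))" by (rule sum_inv[of "\<lambda>\<sigma>. F (f (\<sigma> \<circ> x))"])
    also have "\<dots> = (\<Sum>\<sigma>\<in>G. F (f \<sigma>))" by (rule sum_R[OF x, of "\<lambda>\<sigma>. F (f \<sigma>)"])
    finally show ?thesis .
  qed
  have nf: "nrm f = sum f G" unfolding nrm_def ip_def by (intro sum.cong) (auto simp: f_def indicator_def)
  have "nrm h' = nrm f" unfolding nrm_def ip_def by (rule sh[of "\<lambda>t. t * t"])
  moreover have "sum h' G = sum f G" by (rule sh[of "\<lambda>t. t"])
  ultimately have "ip (conv f f) h' \<noteq> 0"
    using sf nf by (intro conv_triple_pos[OF f FS(1) f FS(1) h'g FS(2) _ _ _ _ _ _ L]) auto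
  then obtain \<sigma> where s: "\<sigma> \<in> G" "conv f f \<sigma> * h' \<sigma> \<noteq> 0"
    unfolding ip_def by (meson sum.neutral)
  then obtain a where a: "a \<in> G" "f a * f (inv' a \<circ> \<sigma>) \<noteq> 0"
    unfolding conv_def by (metis (no_types, lifting) mult_zero_left sum.neutral)
  have "a \<in> A" "inv' a \<circ> \<sigma> \<in> A" using a(2) by (auto simp: f_def indicator_def split: if_splits)
  moreover have "inv' \<sigma> \<circ> x \<in> A" using s by (auto simp: h'_def h_def f_def indicator_def split: if_splits)
  moreover have "a \<circ> (inv' a \<circ> \<sigma>) \<circ> (inv' \<sigma> \<circ> x) = x" using a(1) s(1) by simp
  ultimately show ?thesis by blast
qed

end

text \<open>A set of more than half the group meets every set \<open>y A^-1\<close>, so two factors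
  already reach all elements; the third factor is an arbitrary \<open>c\<close>. This covers the
  small degrees.\<close>

lemma majority_product:
  assumes G: "G = carrier (alt_group n)" and A: "A \<subseteq> G" "2 * card A > card G" and x: "x \<in> G"
  shows "\<exists>a\<in>A. \<exists>b\<in>A. \<exists>c\<in>A. a \<circ> b \<circ> c = x"
proof -
  interpret group "alt_group n" by (rule alt_group_is_group)
  have finG: "finite G" unfolding G
    by (rule finite_subset[OF _ finite_permutations[of "{1..n}"]]) (auto simp: alt_group_carrier)
  have finA: "finite A" using A finG finite_subset by blast
  have "A \<noteq> {}" using A(2) by auto
  then obtain c where c: "c \<in> A" by blast
  define y where "y = x \<otimes>\<^bsub>alt_group n\<^esub> inv\<^bsub>alt_group n\<^esub> c"
  have cG: "c \<in> carrier (alt_group n)" "y \<in> carrier (alt_group n)" using c A x by (auto simp: G y_def)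
  define B where "B = (\<lambda>b. y \<otimes>\<^bsub>alt_group n\<^esub> inv\<^bsub>alt_group n\<^esub> b) ` A"
  have "inj_on (\<lambda>b. y \<otimes>\<^bsub>alt_group n\<^esub> inv\<^bsub>alt_group n\<^esub> b) A"
  proof (rule inj_onI)
    fix p q assume pq: "p \<in> A" "q \<in> A"
      "y \<otimes>\<^bsub>alt_group n\<^esub> inv\<^bsub>alt_group n\<^esub> p = y \<otimes>\<^bsub>alt_group n\<^esub> inv\<^bsub>alt_group n\<^esub> q"
    then have c: "p \<in> carrier (alt_group n)" "q \<in> carrier (alt_group n)" using A by (auto simp: G)
    then have "inv\<^bsub>alt_group n\<^esub> p = inv\<^bsub>alt_group n\<^esub> q"
      using pq(3) cG(2) Units_l_cancel[of y] by (simp add: Units_eq)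
    then show "p = q" using c inv_inv by metis
  qed
  then have cB: "card B = card A" by (simp add: B_def card_image)
  have "B \<subseteq> G" using A cG by (auto simp: B_def G)
  then have "card (A \<union> B) \<le> card G" using A finG by (intro card_mono) auto
  moreover have "card (A \<union> B) + card (A \<inter> B) = card A + card B"
    by (rule card_Un_Int[symmetric]) (use finA in \<open>simp_all add: B_def\<close>)
  ultimately have "card (A \<inter> B) \<noteq> 0" using cB A(2) by linarith
  then have "A \<inter> B \<noteq> {}" by auto
  then obtain a b where ab: "a \<in> A" "b \<in> A" "a = y \<otimes>\<^bsub>alt_group n\<^esub> inv\<^bsub>alt_group n\<^esub> b" by (auto simp: B_def)
  have abG: "a \<in> carrier (alt_group n)" "b \<in> carrier (alt_group n)" using ab A by (auto simp: G)
  have yb: "y \<otimes>\<^bsub>alt_group n\<^esub> inv\<^bsub>alt_group n\<^esub> b \<otimes>\<^bsub>alt_group n\<^esub> b = y"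
    using cG abG by (simp add: m_assoc)
  have yc: "y \<otimes>\<^bsub>alt_group n\<^esub> c = x" unfolding y_def using cG(1) x by (simp add: m_assoc G)
  have "a \<otimes>\<^bsub>alt_group n\<^esub> b \<otimes>\<^bsub>alt_group n\<^esub> c = x" unfolding ab(3) yb by (rule yc)
  then show ?thesis using ab c by (auto simp: alt_group_mult)
qed

theorem theorem1p15:
  shows "\<exists>c::real. c > 0 \<and>
    (\<forall>(n::nat) (A::(nat \<Rightarrow> nat) set).
       n \<ge> 1 \<longrightarrow>
       A \<subseteq> carrier (alt_group n) \<longrightarrow>
       is_global n 100 A \<longrightarrow>
       alt_density n A \<ge> exp (- c * real n powr (1/3)) \<longrightarrow>
       A <#>\<^bsub>alt_group n\<^esub> A <#>\<^bsub>alt_group n\<^esub> A = carrier (alt_group n))"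
proof -
  \<comment> \<open>The factor 1024 is 4 * 256: \<open>level_term_le\<close> asks for 256 in terms
    of the number of pairs, which is at least \<open>n / 4\<close>.\<close>
  define K :: nat where "K = 1024 * (2 * 10 ^ 16) ^ 3"
  \<comment> \<open>Chosen so that \<open>c\<close> times the crude bound \<open>2 * K * L\<close>
    on the cube root of \<open>n\<close> is exactly \<open>L / 100\<close>.\<close>
  define c :: real where "c = 1 / (200 * real K)"
  have K: "1 \<le> K" "real K = 1024 * level_const ^ 3" by (simp_all add: K_def level_const_def)
  have c0: "0 < c" using K(1) by (simp add: c_def)
  have main: "A <#>\<^bsub>alt_group n\<^esub> A <#>\<^bsub>alt_group n\<^esub> A = carrier (alt_group n)"
    if n: "n \<ge> 1" and A: "A \<subseteq> carrier (alt_group n)" and glo: "is_global n 100 A"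
      and dens: "alt_density n A \<ge> exp (- c * real n powr (1/3))" for n A
  proof -
    let ?G = "carrier (alt_group n)"
    interpret Gr: group "alt_group n" by (rule alt_group_is_group)
    have "\<exists>L. n < K * Suc L ^ 3"
    proof
      have "n < Suc n" by simp
      also have "Suc n \<le> K * Suc n ^ 3" using mult_mono[OF K(1) self_le_power[of "Suc n" 3]] by simp
      finally show "n < K * Suc n ^ 3" .
    qed
    \<comment> \<open>The integer part of the cube root of \<open>n / K\<close>.\<close>
    define L where "L = (LEAST L. n < K * Suc L ^ 3)"
    have L1: "n < K * Suc L ^ 3" unfolding L_def by (rule LeastI_ex) fact
    have L2: "K * L ^ 3 \<le> n"
    proof (cases L)
      case (Suc k)
      then have "\<not> n < K * Suc k ^ 3" unfolding L_def using not_less_Least by (metis lessI)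
      then show ?thesis using Suc by simp
    qed simp
    have root: "real n powr (1/3) \<le> t" if "real n \<le> t ^ 3" "0 \<le> t" for t
    proof -
      have "real n powr (1/3) \<le> (t ^ 3) powr (1/3)" using that by (intro powr_mono2) auto
      also have "\<dots> = t" using that(2) by (cases "t = 0") (auto simp: powr_powr simp flip: powr_numeral)
      finally show ?thesis .
    qed
    have triple: "\<exists>a\<in>A. \<exists>b\<in>A. \<exists>c\<in>A. a \<circ> b \<circ> c = x" if x: "x \<in> ?G" for x
    proof (cases "L < 24")
      case True
      \<comment> \<open>With \<open>n\<close> bounded, the exponent in the density hypothesis is at
        most 12/100, so \<open>A\<close> fills more than half of the group.\<close>
      have "real n \<le> (24 * real K) ^ 3"
      proof -
        have "Suc L ^ 3 \<le> 24 ^ 3" using True by (intro power_mono) auto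
        then have "n \<le> K * 24 ^ 3" using L1 mult_le_mono2[of "Suc L ^ 3" "24 ^ 3" K] by linarith
        also have "\<dots> \<le> K ^ 3 * 24 ^ 3" using self_le_power[OF K(1), of 3] by (intro mult_le_mono1) simp
        finally have "n \<le> (24 * K) ^ 3" by (simp add: power_mult_distrib mult.commute)
        then have "real n \<le> real ((24 * K) ^ 3)" by (rule of_nat_mono)
        then show ?thesis by simp
      qed
      then have "real n powr (1/3) \<le> 24 * real K" by (rule root) simp
      then have "c * real n powr (1/3) \<le> c * (24 * real K)" using c0 by (intro mult_left_mono) auto
      also have "\<dots> = 12 / 100" using K(1) by (simp add: c_def)
      finally have "c * real n powr (1/3) \<le> 12 / 100" .
      then have "1 / 2 < alt_density n A"
        using dens exp_ge_add_one_self[of "- c * real n powr (1/3)"] by linarith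
      then have "real (card ?G) < 2 * real (card A)"
        by (cases "card ?G = 0") (simp_all add: alt_density_def pos_less_divide_eq)
      then have "card ?G < 2 * card A" by linarith
      then show ?thesis by (rule majority_product[OF refl A _ x])
    next
      case False
      then have L24: "24 \<le> L" by simp
      \<comment> \<open>As many pairs as possible with two points kept aside; depending on parity
        two or three points stay unpaired.\<close>
      define m where "m = (n - 2) div 2"
      have KL: "1024 * L ^ 3 \<le> n"
      proof -
        have "1024 \<le> K" by (simp add: K_def)
        then have "1024 * L ^ 3 \<le> K * L ^ 3" by (rule mult_le_mono1)
        then show ?thesis using L2 by linarith
      qed
      have L3: "L\<^sup>2 \<le> L ^ 3" "1 \<le> L\<^sup>2" using L24 by (auto intro!: power_increasing)
      have nbig: "1024 \<le> n" using KL L3 by linarith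
      interpret alt_pairs n m by unfold_locales (use nbig in \<open>auto simp: m_def\<close>)
      show ?thesis
      proof (rule dense_global_product[OF _ glo refl])
        show "A \<subseteq> G" "x \<in> G" using A x carrier_alt by auto
        show "24 \<le> L" by (rule L24)
        show "12 * L\<^sup>2 + 1 \<le> n" using KL L3 by linarith
        show "n \<le> 2 * m + 3" unfolding m_def using nbig by linarith
        show "256 * level_const ^ 3 * real L ^ 3 \<le> real m"
        proof -
          have "n \<le> 4 * m" unfolding m_def using nbig by linarith
          then have "K * L ^ 3 \<le> 4 * m" using L2 by linarith
          then have "real (K * L ^ 3) \<le> real (4 * m)" by (rule of_nat_mono)
          then show ?thesis using K by simp
        qed
        show "exp (- (real L / 100)) \<le> real (card A) / real (card G)"
        proof -
          \<comment> \<open>Replacing \<open>K\<close> by \<open>K ^ 3\<close> is wasteful but keeps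
            the cube root free of roots of \<open>K\<close>; only the size of \<open>c\<close> is
            affected.\<close>
          have "real n \<le> (2 * real K * real L) ^ 3"
          proof -
            have "Suc L ^ 3 \<le> (2 * L) ^ 3" using L24 by (intro power_mono) auto
            then have "n \<le> K * (2 * L) ^ 3" using L1 mult_le_mono2[of "Suc L ^ 3" "(2 * L) ^ 3" K] by linarith
            also have "\<dots> \<le> K ^ 3 * (2 * L) ^ 3" using self_le_power[OF K(1), of 3] by (intro mult_le_mono1) simp
            finally have "n \<le> (2 * K * L) ^ 3" by (simp add: power_mult_distrib mult_ac)
            then have "real n \<le> real ((2 * K * L) ^ 3)" by (rule of_nat_mono)
            then show ?thesis by simp
          qed
          then have "real n powr (1/3) \<le> 2 * real K * real L" by (rule root) simp
          then have "c * real n powr (1/3) \<le> c * (2 * real K * real L)" using c0 by (intro mult_left_mono) auto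
          also have "\<dots> = real L / 100" using K(1) by (simp add: c_def)
          finally have "exp (- (real L / 100)) \<le> exp (- c * real n powr (1/3))" by simp
          then show ?thesis using dens unfolding alt_density_def carrier_alt by (rule order_trans)
        qed
      qed
    qed
    have "A <#>\<^bsub>alt_group n\<^esub> A <#>\<^bsub>alt_group n\<^esub> A \<subseteq> ?G"
      using A by (intro Gr.set_mult_closed)
    moreover have "?G \<subseteq> A <#>\<^bsub>alt_group n\<^esub> A <#>\<^bsub>alt_group n\<^esub> A"
    proof
      fix x assume "x \<in> ?G"
      then obtain a b c where "a \<in> A" "b \<in> A" "c \<in> A" "x = a \<circ> b \<circ> c" using triple by metis
      then show "x \<in> A <#>\<^bsub>alt_group n\<^esub> A <#>\<^bsub>alt_group n\<^esub> A"
        unfolding set_mult_def alt_group_mult by blast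
    qed
    ultimately show ?thesis by (rule equalityI)
  qed
  show ?thesis using c0 main by blast
qed

end
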